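(* Let $\mathscr{C}$ be an algebraic curve in $\mathbb{R}^2$ such that $C=\mathcal{P}r_{\mathscr{C}^*}$ is an irreducible quadratic curve. Then: (1) The algebraic curve $\mathscr{C}$ is a quartic curve or a cubic curve and a front such that $\mathscr{I}(\mathscr{C})$ is an irreducible quadratic curve. Moreover, if the equation of $C$ is $$a_{11}x^2+a_{22}y^2+2a_{12}xy+2a_1x+2a_2y+c=0,$$ then the equation of $\mathscr{C}$ is $$(a_{12}^2-a_{11}a_{22})(x^2+y^2)^2+2(a_{12}a_2-a_1a_{22})(x^2+y^2)x+2(a_1a_{12}-a_2a_{11})(x^2+y^2)y+(a_2^2-a_{22}c)x^2+2(a_{12}c-a_1a_2)xy+(a_1^2-a_{11}c)y^2=0.$$ If $C$ is a parabola, then $\mathscr{C}$ is a cubic curve. (2) If $\mathscr{I}(\mathscr{C})$ is an ellipse, then the origin is an isolated point of $\mathscr{C}$. Moreover, $\mathscr{C}\setminus\{(0,0)\}$ is a regular curve. (3) If $\mathscr{I}(\mathscr{C})$ is a hyperbola, then $\mathscr{C}$ is regular as a parametrized curve and it has only one node, at the origin, as an algebraic curve. Moreover, the tangent directions of the curve at the node are equal to the asymptotic directions of the hyperbola $\mathscr{I}(\mathscr{C})$. (4) If $\mathscr{I}(\mathscr{C})$ is a parabola, then $\mathscr{C}$ has an ordinary cusp at the origin and its other part is non-singular. Moreover, the tangent direction of the curve at the cusp is equal to the direction of the axis of the parabola $\mathscr{I}(\mathscr{C})$.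
   Context: Fronts and frontals. A smooth map $\boldsymbol{\gamma}:I\to\mathbb{R}^2$ on an interval is a frontal if there is a smooth $\boldsymbol{\nu}:I\to S^1$ with $\langle\dot{\boldsymbol{\gamma}}(t),\boldsymbol{\nu}(t)\rangle=0$ for all $t$; it is a front if moreover $\boldsymbol{\nu}$ can be chosen with $(\boldsymbol{\gamma},\boldsymbol{\nu})$ an immersion (so a constant map is a front). A set $S\subset\mathbb{R}^2$ is a frontal (front) set if each $\boldsymbol{x}_0\in S$ has an open neighbourhood $U$ and finitely many frontals (fronts) $\boldsymbol{\gamma}_i:(t_i-\varepsilon_i,t_i+\varepsilon_i)\to\mathbb{R}^2$ with $\boldsymbol{\gamma}_i(t_i)=\boldsymbol{x}_0$ and $\bigcup_i\boldsymbol{\gamma}_i((t_i-\varepsilon_i,t_i+\varepsilon_i))=U\cap S$; we then also say that $S$ is a frontal (front), parametrized locally by the $\boldsymbol{\gamma}_i$. Every real plane algebraic curve is a frontal set. "Regular as a parametrized curve" means that the local parametrizations $\boldsymbol{\gamma}_i$ can be chosen regular ($\dot{\boldsymbol{\gamma}}_i\ne0$). Condition $(^* )$ and primitive. A frontal $\boldsymbol{\gamma}$ with $\boldsymbol{\nu}$ satisfies condition $(^* )$ if $\langle\boldsymbol{\gamma}(t),\boldsymbol{\nu}(t)\rangle\neq0$. For such a frontal the primitive is $$\mathcal{P}r_{\boldsymbol{\gamma}}(t)=2\boldsymbol{\gamma}(t)-\frac{\|\boldsymbol{\gamma}(t)\|^2}{\langle\boldsymbol{\gamma}(t),\boldsymbol{\nu}(t)\rangle}\boldsymbol{\nu}(t)$$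 (the envelope of the lines through the points $\boldsymbol{\gamma}(t)$ perpendicular to the position vectors $\boldsymbol{\gamma}(t)$). For an algebraic curve $\mathscr{C}$, $\mathscr{C}^*$ is the set of points of $\mathscr{C}$ (regarded as a frontal set) that satisfy condition $(^* )$, and $\mathcal{P}r_{\mathscr{C}^*}$ is the curve swept out by the primitives of the local frontal parametrizations of $\mathscr{C}^*$. Inversion. For a polynomial $F(x,y)=\sum_{0\le i+j\le n}a_{ij}x^iy^j$ of degree $n$, put $\widetilde F(x,y)=\sum_{0\le i+j\le n}a_{ij}x^iy^j(x^2+y^2)^{n-(i+j)}$, reduced by removing superfluous powers of $x^2+y^2$, so that $\widetilde{\widetilde F}=F$. For $\mathscr{C}=\{F=0\}$, the inversion is $\mathscr{I}(\mathscr{C})=\{\widetilde F=0\}$; away from the origin it is the image of $\mathscr{C}\setminus\{(0,0)\}$ under $\Psi(\boldsymbol{x})=\boldsymbol{x}/\|\boldsymbol{x}\|^2$, and $\mathscr{I}(\mathscr{I}(\mathscr{C}))=\mathscr{C}$. Quadratic curves. A quadratic curve is irreducible if it is not a union of two (possibly equal) lines, equivalently $\det\begin{pmatrix} a_{11} & a_{12} & a_1 \\ a_{12} & a_{22} & a_2 \\ a_1 & a_2 & c \end{pmatrix}\neq0$. Singularities. A node is a point where exactly two regular branches with distinct tangent lines cross. An ordinary cusp is a point near which the curve is locally diffeomorphic to $\{(t^2,t^3)\mid t\in\mathbb{R}\}$ near the origin.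
   Formalization: Added: the curve contains the origin but no line or circle through it, and C has real points (otherwise (1) fails, e.g. for the unit circle). The primitive is taken with its closure, and frontals resting on an interval at a non-isolated point are excluded. *)

theory Defs
  imports
    "HOL-Analysis.Analysis"
    "HOL-Computational_Algebra.Polynomial"
begin

type_synonym plane = "real \<times> real"


section \<open>Smooth maps\<close>

primrec Ck_on :: "nat \<Rightarrow> 'a::real_normed_vector set \<Rightarrow> ('a \<Rightarrow> 'b::real_normed_vector) \<Rightarrow> bool" where
  "Ck_on 0 = (\<lambda>S f. continuous_on S f)"
| "Ck_on (Suc k) = (\<lambda>S f. (\<forall>x\<in>S. f differentiable (at x)) \<and>
      (\<forall>v. Ck_on k S (\<lambda>x. frechet_derivative f (at x) v)))"

text \<open>Only used on open subsets of Euclidean spaces, where it is the usual notion of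
  a \<open>C\<^sup>\<infinity>\<close> map.\<close>

definition smooth_on :: "'a::real_normed_vector set \<Rightarrow> ('a \<Rightarrow> 'b::real_normed_vector) \<Rightarrow> bool" where
  "smooth_on S f \<longleftrightarrow> (\<forall>k. Ck_on k S f)"

abbreviation velocity :: "(real \<Rightarrow> plane) \<Rightarrow> real \<Rightarrow> plane" where
  "velocity \<gamma> t \<equiv> vector_derivative \<gamma> (at t)"


section \<open>Frontals, fronts and local parametrizations\<close>

definition frontal_pair :: "(real \<Rightarrow> plane) \<Rightarrow> (real \<Rightarrow> plane) \<Rightarrow> real set \<Rightarrow> bool" where
  "frontal_pair \<gamma> \<nu> I \<longleftrightarrow> smooth_on I \<gamma> \<and> smooth_on I \<nu> \<and>
     (\<forall>t\<in>I. norm (\<nu> t) = 1 \<and> velocity \<gamma> t \<bullet> \<nu> t = 0)"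

definition frontal :: "(real \<Rightarrow> plane) \<Rightarrow> real set \<Rightarrow> bool" where
  "frontal \<gamma> I \<longleftrightarrow> (\<exists>\<nu>. frontal_pair \<gamma> \<nu> I)"

definition front :: "(real \<Rightarrow> plane) \<Rightarrow> real set \<Rightarrow> bool" where
  "front \<gamma> I \<longleftrightarrow> (\<exists>\<nu>. frontal_pair \<gamma> \<nu> I \<and>
     (\<forall>t\<in>I. (velocity \<gamma> t, velocity \<nu> t) \<noteq> (0, 0)))"

definition regular :: "(real \<Rightarrow> plane) \<Rightarrow> real set \<Rightarrow> bool" where
  "regular \<gamma> I \<longleftrightarrow> smooth_on I \<gamma> \<and> (\<forall>t\<in>I. velocity \<gamma> t \<noteq> 0)"

text \<open>The family \<open>\<gamma> 0, \<dots>, \<gamma> (n - 1)\<close>, with \<open>\<gamma> i\<close> defined on the open interval of radius \<open>\<epsilon> i\<close>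
  about \<open>\<tau> i\<close>, parametrizes \<open>S\<close> near \<open>x\<close> by maps of the kind \<open>Q\<close>.\<close>

definition local_parametrization ::
  "((real \<Rightarrow> plane) \<Rightarrow> real set \<Rightarrow> bool) \<Rightarrow> plane set \<Rightarrow> plane \<Rightarrow> plane set \<Rightarrow>
   nat \<Rightarrow> (nat \<Rightarrow> real \<Rightarrow> plane) \<Rightarrow> (nat \<Rightarrow> real) \<Rightarrow> (nat \<Rightarrow> real) \<Rightarrow> bool" where
  "local_parametrization Q S x U n \<gamma> \<tau> \<epsilon> \<longleftrightarrow>
     open U \<and> x \<in> U \<and>
     (\<forall>i<n. \<epsilon> i > 0 \<and> Q (\<gamma> i) {\<tau> i - \<epsilon> i<..<\<tau> i + \<epsilon> i} \<and> \<gamma> i (\<tau> i) = x) \<and>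
     (\<Union>i<n. \<gamma> i ` {\<tau> i - \<epsilon> i<..<\<tau> i + \<epsilon> i}) = U \<inter> S"

definition locally_parametrized_by ::
  "((real \<Rightarrow> plane) \<Rightarrow> real set \<Rightarrow> bool) \<Rightarrow> plane set \<Rightarrow> bool" where
  "locally_parametrized_by Q S \<longleftrightarrow>
     (\<forall>x\<in>S. \<exists>U n \<gamma> \<tau> \<epsilon>. local_parametrization Q S x U n \<gamma> \<tau> \<epsilon>)"

definition front_set :: "plane set \<Rightarrow> bool" where
  "front_set S \<longleftrightarrow> locally_parametrized_by front S"

definition regular_as_parametrized_curve :: "plane set \<Rightarrow> bool" where
  "regular_as_parametrized_curve S \<longleftrightarrow> locally_parametrized_by regular S"


section \<open>The primitive\<close>

definition primitive :: "(real \<Rightarrow> plane) \<Rightarrow> (real \<Rightarrow> plane) \<Rightarrow> real \<Rightarrow> plane" where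
  "primitive \<gamma> \<nu> t = 2 *\<^sub>R \<gamma> t - ((norm (\<gamma> t))\<^sup>2 / (\<gamma> t \<bullet> \<nu> t)) *\<^sub>R \<nu> t"

text \<open>A frontal parametrization that rests at a non-isolated point of \<open>S\<close> for some time allows
  \<open>\<nu>\<close> to rotate freely there, so that \<open>\<nu>\<close> has nothing to do with \<open>S\<close> and the primitive sweeps
  out a line segment. Such parametrizations are not admitted.  An isolated point has only
  constant parametrizations.\<close>

definition frontal_in :: "plane set \<Rightarrow> (real \<Rightarrow> plane) \<Rightarrow> real set \<Rightarrow> bool" where
  "frontal_in S \<gamma> I \<longleftrightarrow> frontal \<gamma> I \<and>
     (\<forall>a b. a < b \<and> {a<..<b} \<subseteq> I \<and> \<gamma> constant_on {a<..<b} \<longrightarrow>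
        (\<forall>t\<in>{a<..<b}. \<gamma> t isolated_in S))"

text \<open>All values, at parameters satisfying condition \<open>(\<^sup>*)\<close>, of the primitives of the local
  frontal parametrizations of \<open>S\<close>.\<close>

definition primitive_points :: "plane set \<Rightarrow> plane set" where
  "primitive_points S = {primitive (\<gamma> i) \<nu> t | x U n \<gamma> \<tau> \<epsilon> i \<nu> t.
     x \<in> S \<and> local_parametrization (frontal_in S) S x U n \<gamma> \<tau> \<epsilon> \<and> i < n \<and>
     t \<in> {\<tau> i - \<epsilon> i<..<\<tau> i + \<epsilon> i} \<and>
     frontal_pair (\<gamma> i) \<nu> {\<tau> i - \<epsilon> i<..<\<tau> i + \<epsilon> i} \<and>
     \<gamma> i t \<bullet> \<nu> t \<noteq> 0}"

text \<open>Condition \<open>(\<^sup>*)\<close> fails at the origin and at parameters where the primitive goes to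
  infinity.  Consequently the primitive never reaches a point of the envelope whose tangent line
  passes through the origin (there \<open>\<gamma> = 0\<close>), for example the two points of tangency of an
  ellipse seen from outside; the closure restores these limit points.\<close>

definition primitive_curve :: "plane set \<Rightarrow> plane set" where
  "primitive_curve S = closure (primitive_points S)"


section \<open>Algebraic curves and inversion\<close>

text \<open>\<open>F :: real poly poly\<close> stands for \<open>\<Sum>i j. coeff (coeff F j) i * x ^ i * y ^ j\<close>.\<close>

definition zeros :: "real poly poly \<Rightarrow> plane set" where
  "zeros F = {(x, y). poly (poly F [:y:]) x = 0}"

definition total_degree :: "real poly poly \<Rightarrow> nat" where
  "total_degree F = (LEAST n. \<forall>i j. coeff (coeff F j) i \<noteq> 0 \<longrightarrow> i + j \<le> n)"

definition algebraic_curve :: "plane set \<Rightarrow> bool" where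
  "algebraic_curve S \<longleftrightarrow> (\<exists>F. F \<noteq> 0 \<and> zeros F = S)"

definition curve_degree :: "plane set \<Rightarrow> nat" where
  "curve_degree S = (LEAST n. \<exists>F. F \<noteq> 0 \<and> zeros F = S \<and> total_degree F = n)"

definition cubic_curve :: "plane set \<Rightarrow> bool" where
  "cubic_curve S \<longleftrightarrow> algebraic_curve S \<and> curve_degree S = 3"

definition quartic_curve :: "plane set \<Rightarrow> bool" where
  "quartic_curve S \<longleftrightarrow> algebraic_curve S \<and> curve_degree S = 4"

text \<open>The polynomial \<open>x\<^sup>2 + y\<^sup>2\<close>.\<close>

definition r2 :: "real poly poly" where
  "r2 = [:[:0, 0, 1:], 0, 1:]"

definition inversion_poly :: "real poly poly \<Rightarrow> real poly poly" where
  "inversion_poly F =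
     (let n = total_degree F;
          G = (\<Sum>(i, j) | i + j \<le> n. monom (monom (coeff (coeff F j) i) i) j * r2 ^ (n - (i + j)))
      in G div r2 ^ (GREATEST m. r2 ^ m dvd G))"

text \<open>The zero set of \<open>inversion_poly F\<close> depends on the choice of the equation \<open>F\<close> of \<open>S\<close>, but
  only at the origin: passing from \<open>F\<close> to a multiple of \<open>F\<close> with the same zero set (for example
  \<open>(1 + x\<^sup>2) * F\<close>) may add the origin as a spurious point, and never removes it.  The
  intersection is therefore the zero set obtained from an equation without superfluous factors.\<close>

definition inversion :: "plane set \<Rightarrow> plane set" where
  "inversion S = \<Inter> {zeros (inversion_poly F) | F. F \<noteq> 0 \<and> zeros F = S}"


section \<open>Quadratic curves\<close>

definition quadratic :: "real \<Rightarrow> real \<Rightarrow> real \<Rightarrow> real \<Rightarrow> real \<Rightarrow> real \<Rightarrow> plane set" where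
  "quadratic a11 a22 a12 a1 a2 c =
     {(x, y). a11 * x\<^sup>2 + a22 * y\<^sup>2 + 2 * a12 * x * y + 2 * a1 * x + 2 * a2 * y + c = 0}"

text \<open>Quadratic equations such as \<open>x\<^sup>2 + y\<^sup>2 + 1 = 0\<close> without real points do not define a curve.\<close>

definition irreducible_quadratic :: "plane set \<Rightarrow> bool" where
  "irreducible_quadratic S \<longleftrightarrow> S \<noteq> {} \<and>
     (\<exists>a11 a22 a12 a1 a2 c. S = quadratic a11 a22 a12 a1 a2 c \<and>
        det (vector [vector [a11, a12, a1],
                     vector [a12, a22, a2],
                     vector [a1,  a2,  c]] :: real^3^3) \<noteq> 0)"

definition orthonormal_frame :: "plane \<Rightarrow> plane \<Rightarrow> bool" where
  "orthonormal_frame u v \<longleftrightarrow> norm u = 1 \<and> norm v = 1 \<and> u \<bullet> v = 0"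

definition ellipse :: "plane set \<Rightarrow> bool" where
  "ellipse S \<longleftrightarrow> (\<exists>p u v a b. orthonormal_frame u v \<and> a > 0 \<and> b > 0 \<and>
     S = {p + x *\<^sub>R u + y *\<^sub>R v | x y. x\<^sup>2 / a\<^sup>2 + y\<^sup>2 / b\<^sup>2 = 1})"

definition hyperbola :: "plane set \<Rightarrow> bool" where
  "hyperbola S \<longleftrightarrow> (\<exists>p u v a b. orthonormal_frame u v \<and> a > 0 \<and> b > 0 \<and>
     S = {p + x *\<^sub>R u + y *\<^sub>R v | x y. x\<^sup>2 / a\<^sup>2 - y\<^sup>2 / b\<^sup>2 = 1})"

definition parabola :: "plane set \<Rightarrow> bool" where
  "parabola S \<longleftrightarrow> (\<exists>p u v k. orthonormal_frame u v \<and> k > 0 \<and>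
     S = {p + x *\<^sub>R u + y *\<^sub>R v | x y. y\<^sup>2 = 4 * k * x})"

definition asymptotic_direction :: "plane set \<Rightarrow> plane \<Rightarrow> bool" where
  "asymptotic_direction S v \<longleftrightarrow> v \<noteq> 0 \<and>
     (\<exists>p. ((\<lambda>s. infdist (p + s *\<^sub>R v) S) \<longlongrightarrow> 0) at_top)"

definition reflect :: "plane \<Rightarrow> plane \<Rightarrow> plane \<Rightarrow> plane" where
  "reflect p v x = 2 *\<^sub>R (p + (((x - p) \<bullet> v) / (v \<bullet> v)) *\<^sub>R v) - x"

text \<open>Direction of an axis of (reflection) symmetry. A parabola has exactly one such axis.\<close>

definition axis_direction :: "plane set \<Rightarrow> plane \<Rightarrow> bool" where
  "axis_direction S v \<longleftrightarrow> v \<noteq> 0 \<and> (\<exists>p. reflect p v ` S = S)"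


section \<open>Singularities and tangent directions\<close>

text \<open>A regular curve without self-intersection, embedded with the subspace topology.\<close>

definition regular_arc :: "(real \<Rightarrow> plane) \<Rightarrow> real set \<Rightarrow> bool" where
  "regular_arc \<gamma> I \<longleftrightarrow> regular \<gamma> I \<and> (\<exists>g. homeomorphism I (\<gamma> ` I) \<gamma> g)"

definition regular_point :: "plane set \<Rightarrow> plane \<Rightarrow> bool" where
  "regular_point S x \<longleftrightarrow> x \<in> S \<and> (\<exists>U \<gamma> \<tau> \<epsilon>. local_parametrization regular_arc S x U 1 \<gamma> \<tau> \<epsilon>)"

definition regular_curve :: "plane set \<Rightarrow> bool" where
  "regular_curve S \<longleftrightarrow> (\<forall>x\<in>S. regular_point S x)"

definition node :: "plane set \<Rightarrow> plane \<Rightarrow> bool" where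
  "node S x \<longleftrightarrow> x \<in> S \<and> (\<exists>U \<gamma> \<tau> \<epsilon>. local_parametrization regular_arc S x U 2 \<gamma> \<tau> \<epsilon> \<and>
     \<not> collinear {0, velocity (\<gamma> 0) (\<tau> 0), velocity (\<gamma> 1) (\<tau> 1)})"

definition ordinary_cusp :: "plane set \<Rightarrow> plane \<Rightarrow> bool" where
  "ordinary_cusp S x \<longleftrightarrow> (\<exists>U V (\<phi> :: plane \<Rightarrow> plane) (\<psi> :: plane \<Rightarrow> plane). open U \<and> x \<in> U \<and> open V \<and>
     homeomorphism U V \<phi> \<psi> \<and> smooth_on U \<phi> \<and> smooth_on V \<psi> \<and> \<phi> x = (0, 0) \<and>
     \<phi> ` (U \<inter> S) = V \<inter> {(t\<^sup>2, t^3) | t :: real. True})"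

text \<open>The line spanned by \<open>v\<close> is a limit of secant directions through \<open>x\<close>; the factors \<open>c k\<close> may
  be negative.  This covers singular points: at a node these are the tangent directions of the
  two branches, at a cusp the direction of the cuspidal tangent.\<close>

definition tangent_direction :: "plane set \<Rightarrow> plane \<Rightarrow> plane \<Rightarrow> bool" where
  "tangent_direction S x v \<longleftrightarrow> v \<noteq> 0 \<and>
     (\<exists>(p :: nat \<Rightarrow> plane) (c :: nat \<Rightarrow> real). (\<forall>k. p k \<in> S - {x}) \<and> p \<longlonglongrightarrow> x \<and>
        (\<lambda>k. c k *\<^sub>R (p k - x)) \<longlonglongrightarrow> v)"

end

theory Submission
  imports Defs
begin

text \<open>If \<open>\<gamma>\<close> is a frontal with primitive \<open>z\<close>, then \<open>z \<bullet> \<gamma> = \<gamma> \<bullet> \<gamma>\<close> and \<open>z' \<bullet> \<gamma> = 0\<close>, so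
  \<open>\<gamma>\<close> is the foot of the perpendicular from the origin to the tangent line of the curve traced by
  \<open>z\<close>. When that curve is a conic, the inverse \<open>\<gamma> / (\<gamma> \<bullet> \<gamma>)\<close> therefore runs on the polar dual
  conic. A dense set of points of an algebraic curve is either isolated or locally a smooth arc;
  isolated points, lines through the origin and circles through the origin do not occur here, so
  the given curve is exactly the inverse of the dual conic together with the origin. What remains is
  the local study of the inverse of a conic at the origin: its lowest order form is the quadratic
  part of the conic, which is definite, indefinite or of rank one.\<close>


section \<open>Smooth maps\<close>

text \<open>The curve is only partly visible to its primitive, and this shapes the hypotheses as
  well as the proof. Along a line through the origin \<open>\<gamma> \<bullet> \<nu> = 0\<close>, so
  there is no primitive at all. Along a circle through the origin every line perpendicular to
  \<open>\<gamma>\<close> passes through the antipode of the origin, so the primitive is one point,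
  which may lie on the conic by accident. The origin itself never has a primitive. A nonzero
  isolated point has the opposite defect: \<open>\<nu>\<close> is arbitrary there, and the
  primitives fill a whole line, which no irreducible conic contains. Finally, an asymptote touches
  the conic only at infinity, so its foot is reached only as a limit of feet; both inclusions
  between the curve and the inverse of the dual conic are therefore closure arguments.

  The dual conic passes through the origin exactly when the given conic is a parabola. This is why
  the quartic term has the coefficient \<open>a12^2 - a11 * a22\<close> and why the degree then
  drops to three.\<close>

lemma Ck_on_cong:
  assumes "open S" "\<And>x. x \<in> S \<Longrightarrow> f x = g x" "Ck_on k S f"
  shows "Ck_on k S g"
  using assms(2,3)
proof (induction k arbitrary: f g)
  case 0
  then show ?case using continuous_on_cong by fastforce
next
  case (Suc k)
  have d: "f differentiable (at x)" if "x \<in> S" for x using Suc.prems that by simp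
  have "g differentiable (at x)" if "x \<in> S" for x
    using d[OF that] Suc.prems(1) \<open>open S\<close> that
    by (meson differentiable_def has_derivative_transform_within_open)
  moreover have "frechet_derivative f (at x) = frechet_derivative g (at x)" if "x \<in> S" for x
    using frechet_derivative_transform_within_open[OF d[OF that] \<open>open S\<close> that] Suc.prems(1) by blast
  then have "Ck_on k S (\<lambda>x. frechet_derivative g (at x) v)" for v
    using Suc.IH[of "\<lambda>x. frechet_derivative f (at x) v" "\<lambda>x. frechet_derivative g (at x) v"]
      Suc.prems(2) by simp
  ultimately show ?case by simp
qed

text \<open>\<open>frechet_derivative\<close> is a choice operator; this rule lets the inductions
  below work with any explicit derivative instead.\<close>

lemma Ck_on_SucI:
  assumes "open S" "\<And>x. x \<in> S \<Longrightarrow> (f has_derivative f' x) (at x)"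
    "\<And>v. Ck_on k S (\<lambda>x. f' x v)"
  shows "Ck_on (Suc k) S f"
proof -
  have "frechet_derivative f (at x) = f' x" if "x \<in> S" for x
    using frechet_derivative_at[OF assms(2)[OF that]] by simp
  then have "Ck_on k S (\<lambda>x. frechet_derivative f (at x) v)" for v
    using Ck_on_cong[OF \<open>open S\<close> _ assms(3)] by simp
  moreover have "f differentiable (at x)" if "x \<in> S" for x
    using assms(2)[OF that] differentiable_def by blast
  ultimately show ?thesis by simp
qed

lemma Ck_on_Suc_has_derivative:
  "Ck_on (Suc k) S f \<Longrightarrow> x \<in> S \<Longrightarrow> (f has_derivative frechet_derivative f (at x)) (at x)"
  by (simp add: frechet_derivative_works)

lemma Ck_on_Suc_frechet_derivative:
  "Ck_on (Suc k) S f \<Longrightarrow> Ck_on k S (\<lambda>x. frechet_derivative f (at x) v)"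
  by simp

lemma Ck_on_SucD: "Ck_on (Suc k) S f \<Longrightarrow> Ck_on k S f"
proof (induction k arbitrary: f)
  case 0
  then show ?case
    by (simp add: continuous_at_imp_continuous_on differentiable_imp_continuous_within)
qed auto

lemma Ck_on_const [simp]: "open S \<Longrightarrow> Ck_on k S (\<lambda>x. c)"
proof (induction k arbitrary: c)
  case (Suc k)
  then show ?case by (intro Ck_on_SucI[where f' = "\<lambda>x v. 0"]) auto
qed simp

lemma Ck_on_bounded_linear: "open S \<Longrightarrow> bounded_linear L \<Longrightarrow> Ck_on k S L"
proof (cases k)
  case 0
  assume "bounded_linear L"
  then show ?thesis using 0 by (simp add: linear_continuous_on)
next
  case (Suc j)
  assume "open S" "bounded_linear L"
  then show ?thesis using Suc
    by (auto intro!: Ck_on_SucI[where f' = "\<lambda>x. L"] bounded_linear_imp_has_derivative simp del: Ck_on.simps)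
qed

lemma Ck_on_add:
  assumes "open S" "Ck_on k S f" "Ck_on k S g"
  shows "Ck_on k S (\<lambda>x. f x + g x)"
  using assms(2,3)
proof (induction k arbitrary: f g)
  case 0
  then show ?case by (simp add: continuous_on_add)
next
  case (Suc k)
  note f' = Ck_on_Suc_has_derivative[OF Suc.prems(1)] Ck_on_Suc_frechet_derivative[OF Suc.prems(1)]
  note g' = Ck_on_Suc_has_derivative[OF Suc.prems(2)] Ck_on_Suc_frechet_derivative[OF Suc.prems(2)]
  show ?case
    by (rule Ck_on_SucI[OF \<open>open S\<close> has_derivative_add[OF f'(1) g'(1)]]) (auto intro: Suc.IH f' g')
qed

lemma Ck_on_bounded_bilinear:
  assumes "bounded_bilinear m" "open S" "Ck_on k S f" "Ck_on k S g"
  shows "Ck_on k S (\<lambda>x. m (f x) (g x))"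
  using assms(3,4)
proof (induction k arbitrary: f g)
  case 0
  then show ?case by (simp add: bounded_bilinear.continuous_on[OF assms(1)])
next
  case (Suc k)
  note f' = Ck_on_Suc_has_derivative[OF Suc.prems(1)] Ck_on_Suc_frechet_derivative[OF Suc.prems(1)]
  note g' = Ck_on_Suc_has_derivative[OF Suc.prems(2)] Ck_on_Suc_frechet_derivative[OF Suc.prems(2)]
  have fg: "Ck_on k S f" "Ck_on k S g" using Suc.prems Ck_on_SucD by blast+
  show ?case
    by (rule Ck_on_SucI[OF \<open>open S\<close> bounded_bilinear.FDERIV[OF assms(1) f'(1) g'(1)]])
      (auto intro!: Ck_on_add Suc.IH f' g' fg \<open>open S\<close>)
qed

lemmas Ck_on_mult = Ck_on_bounded_bilinear[OF bounded_bilinear_mult]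
lemmas Ck_on_scaleR = Ck_on_bounded_bilinear[OF bounded_bilinear_scaleR]
lemmas Ck_on_inner = Ck_on_bounded_bilinear[OF bounded_bilinear_inner]

lemma Ck_on_linear_compose:
  assumes "bounded_linear L" "open S" "Ck_on k S f"
  shows "Ck_on k S (\<lambda>x. L (f x))"
  using assms(3)
proof (induction k arbitrary: f)
  case 0
  then show ?case by (simp add: bounded_linear.continuous_on[OF assms(1)])
next
  case (Suc k)
  note f' = Ck_on_Suc_has_derivative[OF Suc.prems(1)] Ck_on_Suc_frechet_derivative[OF Suc.prems(1)]
  show ?case
    by (rule Ck_on_SucI[OF \<open>open S\<close> bounded_linear.has_derivative[OF assms(1) f'(1)]])
      (auto intro!: Suc.IH f')
qed

lemma Ck_on_uminus: "open S \<Longrightarrow> Ck_on k S f \<Longrightarrow> Ck_on k S (\<lambda>x. - f x)"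
  by (rule Ck_on_linear_compose[OF bounded_linear_minus[OF bounded_linear_ident]])

lemma Ck_on_diff:
  assumes "open S" "Ck_on k S f" "Ck_on k S g"
  shows "Ck_on k S (\<lambda>x. f x - g x)"
  using Ck_on_add[OF assms(1,2) Ck_on_uminus[OF assms(1,3)]] by simp

lemma Ck_on_Pair:
  assumes "open S" "Ck_on k S f" "Ck_on k S g"
  shows "Ck_on k S (\<lambda>x. (f x, g x))"
proof -
  have "bounded_linear (\<lambda>a. (a, 0 :: 'c))" "bounded_linear (\<lambda>b. (0 :: 'b, b))"
    by (auto intro!: bounded_linear_Pair bounded_linear_ident bounded_linear_zero)
  from Ck_on_add[OF assms(1) Ck_on_linear_compose[OF this(1) assms(1,2)] Ck_on_linear_compose[OF this(2) assms(1,3)]]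
  show ?thesis by simp
qed

lemma Ck_on_power:
  fixes f :: "'a::real_normed_vector \<Rightarrow> 'b::real_normed_algebra_1"
  shows "open S \<Longrightarrow> Ck_on k S f \<Longrightarrow> Ck_on k S (\<lambda>x. f x ^ n)"
  by (induction n) (auto intro: Ck_on_mult)

lemma Ck_on_inverse:
  fixes f :: "'a::real_normed_vector \<Rightarrow> real"
  assumes "open S" "\<And>x. x \<in> S \<Longrightarrow> f x \<noteq> 0" "Ck_on k S f"
  shows "Ck_on k S (\<lambda>x. inverse (f x))"
  using assms(3)
proof (induction k)
  case 0
  then show ?case using assms(2) by (simp add: continuous_on_inverse)
next
  case (Suc k)
  note f' = Ck_on_Suc_has_derivative[OF Suc.prems(1)] Ck_on_Suc_frechet_derivative[OF Suc.prems(1)]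
  have i: "Ck_on k S (\<lambda>x. inverse (f x))" using Suc.IH Suc.prems Ck_on_SucD by blast
  show ?case
    by (rule Ck_on_SucI[OF \<open>open S\<close> Deriv.has_derivative_inverse[OF assms(2) f'(1)]])
      (auto intro!: Ck_on_mult Ck_on_uminus f' \<open>open S\<close> i)
qed

lemma Ck_on_divide:
  fixes f g :: "'a::real_normed_vector \<Rightarrow> real"
  assumes "open S" "\<And>x. x \<in> S \<Longrightarrow> g x \<noteq> 0" "Ck_on k S f" "Ck_on k S g"
  shows "Ck_on k S (\<lambda>x. f x / g x)"
  unfolding divide_inverse using assms by (intro Ck_on_mult Ck_on_inverse)

lemma Ck_on_sqrt:
  fixes f :: "'a::real_normed_vector \<Rightarrow> real"
  assumes "open S" "\<And>x. x \<in> S \<Longrightarrow> f x > 0" "Ck_on k S f"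
  shows "Ck_on k S (\<lambda>x. sqrt (f x))"
  using assms(3)
proof (induction k)
  case 0
  then show ?case by (simp add: continuous_on_real_sqrt)
next
  case (Suc k)
  note f' = Ck_on_Suc_has_derivative[OF Suc.prems(1)] Ck_on_Suc_frechet_derivative[OF Suc.prems(1)]
  have i: "Ck_on k S (\<lambda>x. sqrt (f x))" using Suc.IH Suc.prems Ck_on_SucD by blast
  have d: "((\<lambda>x. sqrt (f x)) has_derivative (\<lambda>v. frechet_derivative f (at x) v * (1 / 2 * inverse (sqrt (f x))))) (at x)"
    if "x \<in> S" for x
    using has_derivative_real_sqrt[OF assms(2)[OF that] f'(1)[OF that]] by (simp add: field_simps)
  have "f x \<noteq> 0" if "x \<in> S" for x using assms(2)[OF that] by simp
  then show ?case
    by (intro Ck_on_SucI[OF \<open>open S\<close> d] Ck_on_mult Ck_on_const f' Ck_on_inverse \<open>open S\<close> i) auto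
qed

lemma has_derivative_plane:
  fixes f :: "plane \<Rightarrow> 'b::real_normed_vector"
  assumes "(f has_derivative f') F"
  shows "f' v = fst v *\<^sub>R f' (1, 0) + snd v *\<^sub>R f' (0, 1)"
proof -
  have l: "linear f'" using assms has_derivative_linear by blast
  have "v = fst v *\<^sub>R (1, 0) + snd v *\<^sub>R (0, 1)" by (cases v) simp
  then have "f' v = f' (fst v *\<^sub>R (1, 0) + snd v *\<^sub>R (0, 1))" by simp
  also have "\<dots> = fst v *\<^sub>R f' (1, 0) + snd v *\<^sub>R f' (0, 1)"
    using linear_add[OF l] linear_scale[OF l] by metis
  finally show ?thesis .
qed

text \<open>In the chain rule the derivative of \<open>f\<close> is applied to a vector that moves
  with \<open>x\<close>, while the induction hypothesis is about a fixed vector. Expanding the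
  moving vector in the basis of the plane leaves only fixed vectors; hence the restriction on the
  domain of \<open>f\<close>.\<close>

lemma Ck_on_compose_plane:
  fixes f :: "plane \<Rightarrow> 'b::real_normed_vector"
  assumes "open S" "open T" "g ` S \<subseteq> T" "Ck_on k T f" "Ck_on k S g"
  shows "Ck_on k S (\<lambda>x. f (g x))"
  using assms(4,5)
proof (induction k arbitrary: f)
  case 0
  then show ?case using assms(3) continuous_on_compose2[of T f S g] by simp
next
  case (Suc k)
  note f' = Ck_on_Suc_has_derivative[OF Suc.prems(1)] Ck_on_Suc_frechet_derivative[OF Suc.prems(1)]
  note g' = Ck_on_Suc_has_derivative[OF Suc.prems(2)] Ck_on_Suc_frechet_derivative[OF Suc.prems(2)]
  have g: "Ck_on k S g" using Suc.prems Ck_on_SucD by blast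
  have d: "((\<lambda>x. f (g x)) has_derivative
      (\<lambda>v. fst (frechet_derivative g (at x) v) *\<^sub>R frechet_derivative f (at (g x)) (1, 0) + snd (frechet_derivative g (at x) v) *\<^sub>R frechet_derivative f (at (g x)) (0, 1))) (at x)"
    if "x \<in> S" for x
  proof -
    have gT: "g x \<in> T" using assms(3) that by blast
    have e: "(\<lambda>v. frechet_derivative f (at (g x)) (frechet_derivative g (at x) v)) =
        (\<lambda>v. fst (frechet_derivative g (at x) v) *\<^sub>R frechet_derivative f (at (g x)) (1, 0) +
          snd (frechet_derivative g (at x) v) *\<^sub>R frechet_derivative f (at (g x)) (0, 1))"
      by (rule ext) (rule has_derivative_plane[OF f'(1)[OF gT]])
    show ?thesis using has_derivative_compose[OF g'(1)[OF that] f'(1)[OF gT]] unfolding e .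
  qed
  show ?case
    by (intro Ck_on_SucI[OF \<open>open S\<close> d] Ck_on_add Ck_on_scaleR \<open>open S\<close> Suc.IH f'(2) g g'(2)
        Ck_on_linear_compose[OF bounded_linear_fst] Ck_on_linear_compose[OF bounded_linear_snd])
qed

lemma Ck_on_subset: "Ck_on k S f \<Longrightarrow> T \<subseteq> S \<Longrightarrow> Ck_on k T f"
  by (induction k arbitrary: f) (auto intro: continuous_on_subset)

section \<open>Closure properties of smooth maps\<close>

named_theorems smooth_intros

lemma smooth_on_cong: "open S \<Longrightarrow> smooth_on S f \<Longrightarrow> (\<And>x. x \<in> S \<Longrightarrow> f x = g x) \<Longrightarrow> smooth_on S g"
  unfolding smooth_on_def using Ck_on_cong by blast
lemma smooth_on_subset: "smooth_on S f \<Longrightarrow> T \<subseteq> S \<Longrightarrow> smooth_on T f"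
  unfolding smooth_on_def using Ck_on_subset by blast
lemma smooth_on_const [smooth_intros]: "open S \<Longrightarrow> smooth_on S (\<lambda>x. c)"
  unfolding smooth_on_def by simp
lemma smooth_on_linear: "bounded_linear L \<Longrightarrow> open S \<Longrightarrow> smooth_on S L"
  unfolding smooth_on_def using Ck_on_bounded_linear by blast
lemma smooth_on_ident [smooth_intros]: "open S \<Longrightarrow> smooth_on S (\<lambda>x. x)"
  by (rule smooth_on_linear) auto
lemma smooth_on_linear_compose: "bounded_linear L \<Longrightarrow> open S \<Longrightarrow> smooth_on S f \<Longrightarrow> smooth_on S (\<lambda>x. L (f x))"
  unfolding smooth_on_def using Ck_on_linear_compose by blast
lemma smooth_on_fst [smooth_intros]: "open S \<Longrightarrow> smooth_on S f \<Longrightarrow> smooth_on S (\<lambda>x. fst (f x))"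
  by (rule smooth_on_linear_compose[OF bounded_linear_fst])
lemma smooth_on_snd [smooth_intros]: "open S \<Longrightarrow> smooth_on S f \<Longrightarrow> smooth_on S (\<lambda>x. snd (f x))"
  by (rule smooth_on_linear_compose[OF bounded_linear_snd])
lemma smooth_on_add [smooth_intros]:
  "open S \<Longrightarrow> smooth_on S f \<Longrightarrow> smooth_on S g \<Longrightarrow> smooth_on S (\<lambda>x. f x + g x)"
  unfolding smooth_on_def using Ck_on_add by blast
lemma smooth_on_diff [smooth_intros]:
  "open S \<Longrightarrow> smooth_on S f \<Longrightarrow> smooth_on S g \<Longrightarrow> smooth_on S (\<lambda>x. f x - g x)"
  unfolding smooth_on_def using Ck_on_diff by blast
lemma smooth_on_uminus [smooth_intros]: "open S \<Longrightarrow> smooth_on S f \<Longrightarrow> smooth_on S (\<lambda>x. - f x)"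
  unfolding smooth_on_def using Ck_on_uminus by blast
lemma smooth_on_mult [smooth_intros]:
  fixes f g :: "'a::real_normed_vector \<Rightarrow> 'b::real_normed_algebra"
  shows "open S \<Longrightarrow> smooth_on S f \<Longrightarrow> smooth_on S g \<Longrightarrow> smooth_on S (\<lambda>x. f x * g x)"
  unfolding smooth_on_def using Ck_on_mult by blast
lemma smooth_on_scaleR [smooth_intros]:
  "open S \<Longrightarrow> smooth_on S f \<Longrightarrow> smooth_on S g \<Longrightarrow> smooth_on S (\<lambda>x. f x *\<^sub>R g x)"
  unfolding smooth_on_def using Ck_on_scaleR by blast
lemma smooth_on_inner [smooth_intros]:
  "open S \<Longrightarrow> smooth_on S f \<Longrightarrow> smooth_on S g \<Longrightarrow> smooth_on S (\<lambda>x. f x \<bullet> g x)"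
  unfolding smooth_on_def using Ck_on_inner by blast
lemma smooth_on_power [smooth_intros]:
  fixes f :: "'a::real_normed_vector \<Rightarrow> 'b::real_normed_algebra_1"
  shows "open S \<Longrightarrow> smooth_on S f \<Longrightarrow> smooth_on S (\<lambda>x. f x ^ n)"
  unfolding smooth_on_def using Ck_on_power by blast
lemma smooth_on_divide [smooth_intros]:
  fixes f g :: "'a::real_normed_vector \<Rightarrow> real"
  shows "open S \<Longrightarrow> (\<And>x. x \<in> S \<Longrightarrow> g x \<noteq> 0) \<Longrightarrow> smooth_on S f \<Longrightarrow> smooth_on S g \<Longrightarrow> smooth_on S (\<lambda>x. f x / g x)"
  unfolding smooth_on_def using Ck_on_divide by blast
lemma smooth_on_sqrt [smooth_intros]:
  fixes f :: "'a::real_normed_vector \<Rightarrow> real"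
  shows "open S \<Longrightarrow> (\<And>x. x \<in> S \<Longrightarrow> f x > 0) \<Longrightarrow> smooth_on S f \<Longrightarrow> smooth_on S (\<lambda>x. sqrt (f x))"
  unfolding smooth_on_def using Ck_on_sqrt by blast
lemma smooth_on_Pair [smooth_intros]:
  "open S \<Longrightarrow> smooth_on S f \<Longrightarrow> smooth_on S g \<Longrightarrow> smooth_on S (\<lambda>x. (f x, g x))"
  unfolding smooth_on_def using Ck_on_Pair by blast
lemma smooth_on_compose_plane:
  fixes f :: "plane \<Rightarrow> 'b::real_normed_vector"
  shows "open S \<Longrightarrow> open T \<Longrightarrow> g ` S \<subseteq> T \<Longrightarrow> smooth_on T f \<Longrightarrow> smooth_on S g \<Longrightarrow> smooth_on S (\<lambda>x. f (g x))"
  unfolding smooth_on_def using Ck_on_compose_plane by blast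

lemma smooth_on_imp_continuous_on: "smooth_on S f \<Longrightarrow> continuous_on S f"
  unfolding smooth_on_def using Ck_on.simps(1) by metis

lemma smooth_on_differentiable: "smooth_on S f \<Longrightarrow> x \<in> S \<Longrightarrow> f differentiable (at x)"
  unfolding smooth_on_def using Ck_on.simps(2)[of 0] by metis

lemma smooth_on_has_derivative:
  "smooth_on S f \<Longrightarrow> x \<in> S \<Longrightarrow> (f has_derivative frechet_derivative f (at x)) (at x)"
  using smooth_on_differentiable frechet_derivative_works by blast

lemma smooth_on_frechet_derivative: "smooth_on S f \<Longrightarrow> smooth_on S (\<lambda>x. frechet_derivative f (at x) v)"
  unfolding smooth_on_def using Ck_on.simps(2) by metis

lemma smooth_on_has_vector_derivative:
  "smooth_on S f \<Longrightarrow> t \<in> S \<Longrightarrow> (f has_vector_derivative vector_derivative f (at t)) (at t)"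
  using smooth_on_differentiable vector_derivative_works by blast

lemma smooth_on_vector_derivative:
  assumes "open S" "smooth_on S f"
  shows "smooth_on S (\<lambda>t. vector_derivative f (at t))"
proof (rule smooth_on_cong[OF assms(1) smooth_on_frechet_derivative[OF assms(2), of 1]])
  fix t assume "t \<in> S"
  from smooth_on_has_vector_derivative[OF assms(2) this]
  have "frechet_derivative f (at t) = (\<lambda>h. h *\<^sub>R vector_derivative f (at t))"
    unfolding has_vector_derivative_def using frechet_derivative_at by metis
  then show "frechet_derivative f (at t) 1 = vector_derivative f (at t)" by simp
qed


section \<open>Local inverses and regular arcs\<close>

definition plane_det :: "(plane \<Rightarrow> plane) \<Rightarrow> real" where
  "plane_det D = fst (D (1, 0)) * snd (D (0, 1)) - fst (D (0, 1)) * snd (D (1, 0))"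

text \<open>With determinant zero the columns of the adjugate, \<open>(d, - c)\<close> and
  \<open>(- b, a)\<close>, lie in the kernel, so injectivity makes every entry vanish.\<close>

lemma plane_det_nonzero:
  assumes D: "\<And>v. D v = fst v *\<^sub>R D (1, 0) + snd v *\<^sub>R D (0, 1)"
    and inj: "\<And>v. v \<noteq> 0 \<Longrightarrow> D v \<noteq> 0"
  shows "plane_det D \<noteq> 0"
proof
  assume *: "plane_det D = 0"
  obtain a c where ac: "D (1, 0) = (a, c)" by (cases "D (1, 0)")
  obtain b d where bd: "D (0, 1) = (b, d)" by (cases "D (0, 1)")
  have J: "a * d = b * c" using * by (simp add: plane_det_def ac bd)
  have "D (d, - c) = 0" "D (- b, a) = 0"
    using D[of "(d, - c)"] D[of "(- b, a)"] J by (simp_all add: ac bd zero_prod_def algebra_simps)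
  then have "(d, - c) = 0" "(- b, a) = 0" using inj by blast+
  then have "D (1, 0) = 0" by (simp add: ac zero_prod_def)
  moreover have "(1 :: real, 0 :: real) \<noteq> 0" by (simp add: zero_prod_def)
  ultimately show False using inj by blast
qed

text \<open>The inverse function theorem only says that \<open>g\<close> is differentiable, with
  derivative the inverse of \<open>df (g y)\<close>. By Cramer's rule that inverse is rational in
  the entries of \<open>df (g y)\<close>, so if \<open>g\<close> is of class \<open>k\<close> then
  so is its derivative, and induction gives smoothness.\<close>

lemma smooth_local_inverse:
  fixes f :: "plane \<Rightarrow> plane"
  assumes "open U" and sf: "smooth_on U f" and "x0 \<in> U"
    and D: "(f has_derivative D) (at x0)" and J0: "plane_det D \<noteq> 0"
  obtains U' V g where "open U'" "U' \<subseteq> U" "x0 \<in> U'" "open V" "f x0 \<in> V" "homeomorphism U' V f g"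
    "smooth_on V g" "\<And>y v. y \<in> V \<Longrightarrow> v \<noteq> 0 \<Longrightarrow> frechet_derivative g (at y) v \<noteq> 0"
proof -
  define df where "df x = frechet_derivative f (at x)" for x
  define F where "F x = Blinfun (df x)" for x
  have df: "(f has_derivative df x) (at x)" if "x \<in> U" for x
    unfolding df_def using smooth_on_has_derivative[OF sf that] .
  have F: "blinfun_apply (F x) = df x" if "x \<in> U" for x
    unfolding F_def using df[OF that] bounded_linear_Blinfun_apply has_derivative_bounded_linear by blast
  have sdf: "smooth_on U (\<lambda>x. df x v)" for v
    unfolding df_def by (rule smooth_on_frechet_derivative[OF sf])
  have "continuous_on U F"
  proof (rule continuous_on_blinfun_componentwise)
    fix i :: plane
    show "continuous_on U (\<lambda>x. blinfun_apply (F x) i)"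
      using smooth_on_imp_continuous_on[OF sdf[of i]] F by (metis (no_types, lifting) continuous_on_cong)
  qed
  \<comment> \<open>Cramer's rule for the matrix with columns \<open>G (1, 0)\<close> and
    \<open>G (0, 1)\<close>.\<close>
  define solve where "solve G v = (1 / plane_det G) *\<^sub>R
      (snd (G (0, 1)) * fst v - fst (G (0, 1)) * snd v, fst (G (1, 0)) * snd v - snd (G (1, 0)) * fst v)"
    for G and v :: plane
  have dfv: "df x v = fst v *\<^sub>R df x (1, 0) + snd v *\<^sub>R df x (0, 1)" if "x \<in> U" for x v
    by (rule has_derivative_plane[OF df[OF that]])
  have solve: "df x (solve (df x) v) = v" "solve (df x) (df x v) = v" if "x \<in> U" "plane_det (df x) \<noteq> 0" for x v
  proof -
    obtain a c where ac: "df x (1, 0) = (a, c)" by (cases "df x (1, 0)")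
    obtain b d where bd: "df x (0, 1) = (b, d)" by (cases "df x (0, 1)")
    have J: "plane_det (df x) = a * d - b * c" by (simp add: plane_det_def ac bd)
    define k where "k = 1 / (a * d - b * c)"
    have k: "k * (a * d - b * c) = 1" using that J by (simp add: k_def)
    obtain v1 v2 where v: "v = (v1, v2)" by (cases v)
    show "df x (solve (df x) v) = v"
      unfolding solve_def J k_def[symmetric]
      by (subst dfv[OF that(1)]) (simp add: ac bd v, intro conjI; use k in algebra)
    show "solve (df x) (df x v) = v"
      unfolding solve_def J k_def[symmetric] dfv[OF that(1), of v]
      by (simp add: ac bd v, intro conjI; use k in algebra)
  qed
  have D_eq: "D = df x0" using has_derivative_unique[OF D df[OF \<open>x0 \<in> U\<close>]] .
  have lin: "bounded_linear (solve G)" for G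
    unfolding solve_def linear_conv_bounded_linear[symmetric]
    by (rule linearI) (simp_all add: algebra_simps)
  have inv: "Blinfun (solve (df x0)) o\<^sub>L F x0 = id_blinfun"
    using solve(2)[OF \<open>x0 \<in> U\<close>] J0 D_eq
    by (intro blinfun_eqI) (simp add: bounded_linear_Blinfun_apply[OF lin] F[OF \<open>x0 \<in> U\<close>])
  have dF: "(f has_derivative blinfun_apply (F x)) (at x)" if "x \<in> U" for x
    using df[OF that] F[OF that] by simp
  obtain U' V g g' where g: "open U'" "U' \<subseteq> U" "x0 \<in> U'" "open V" "f x0 \<in> V" "homeomorphism U' V f g"
    and g': "\<And>y. y \<in> V \<Longrightarrow> (g has_derivative (g' y)) (at y)"
    "\<And>y. y \<in> V \<Longrightarrow> g' y = inv (blinfun_apply (F (g y)))"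
    "\<And>y. y \<in> V \<Longrightarrow> bij (blinfun_apply (F (g y)))"
    using inverse_function_theorem[OF \<open>open U\<close> dF \<open>continuous_on U F\<close> \<open>x0 \<in> U\<close> inv] by metis
  have gU: "g y \<in> U" if "y \<in> V" for y
    using g(2,6) that unfolding homeomorphism_def by blast
  have bij: "bij (df (g y))" if "y \<in> V" for y using g'(3)[OF that] F[OF gU[OF that]] by simp
  have detg: "plane_det (df (g y)) \<noteq> 0" if "y \<in> V" for y
  proof (rule plane_det_nonzero[OF dfv[OF gU[OF that]]])
    fix v :: plane assume "v \<noteq> 0"
    moreover have "df (g y) 0 = 0" using dfv[OF gU[OF that], of 0] by simp
    ultimately show "df (g y) v \<noteq> 0" using bij[OF that] by (metis bij_pointE)
  qed
  have g'_solve: "g' y v = solve (df (g y)) v" if "y \<in> V" for y v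
    using g'(2)[OF that] F[OF gU[OF that]] bij[OF that] solve(1)[OF gU[OF that] detg[OF that]]
    by (metis bij_inv_eq_iff)
  have "Ck_on k V g" for k
  proof (induction k)
    case 0
    then show ?case using g(6) by (simp add: homeomorphism_def)
  next
    case (Suc k)
    have c: "Ck_on k V (\<lambda>y. df (g y) v)" for v
      using Ck_on_compose_plane[OF \<open>open V\<close> \<open>open U\<close> _ _ Suc, of "\<lambda>x. df x v"] gU sdf
      unfolding smooth_on_def by blast
    have d: "(g has_derivative solve (df (g y))) (at y)" if "y \<in> V" for y
    proof -
      have "g' y = solve (df (g y))" using g'_solve[OF that] by blast
      then show ?thesis using g'(1)[OF that] by simp
    qed
    show ?case
    proof (rule Ck_on_SucI[OF \<open>open V\<close> d])
      show "Ck_on k V (\<lambda>y. solve (df (g y)) v)" for v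
        unfolding solve_def using detg unfolding plane_det_def
        by (intro Ck_on_scaleR Ck_on_divide Ck_on_Pair Ck_on_diff Ck_on_mult Ck_on_const \<open>open V\<close> c
            Ck_on_linear_compose[OF bounded_linear_fst] Ck_on_linear_compose[OF bounded_linear_snd])
    qed
  qed
  then have sg: "smooth_on V g" by (simp add: smooth_on_def)
  have "frechet_derivative g (at y) v \<noteq> 0" if "y \<in> V" "v \<noteq> 0" for y v
  proof -
    have "frechet_derivative g (at y) v = solve (df (g y)) v"
      using frechet_derivative_at[OF g'(1)[OF that(1)]] g'_solve[OF that(1)] by simp
    moreover have "df (g y) 0 = 0" using dfv[OF gU[OF that(1)], of 0] by simp
    ultimately show ?thesis using solve(1)[OF gU[OF that(1)] detg[OF that(1)], of v] that(2) by metis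
  qed
  then show ?thesis using that[OF g(1-6) sg] by blast
qed

lemma has_derivative_along_curve:
  assumes "(f has_derivative f') (at (\<gamma> t))" "(\<gamma> has_vector_derivative v) (at t)"
  shows "((\<lambda>s. f (\<gamma> s)) has_vector_derivative f' v) (at t)"
proof -
  have "((\<lambda>s. f (\<gamma> s)) has_derivative (\<lambda>h. f' (h *\<^sub>R v))) (at t)"
    using has_derivative_compose[of \<gamma> "\<lambda>h. h *\<^sub>R v" t UNIV f f'] assms
    unfolding has_vector_derivative_def by blast
  then show ?thesis
    unfolding has_vector_derivative_def linear_scale[OF has_derivative_linear[OF assms(1)]] .
qed

lemma local_parametrization_single:
  assumes "open W" "x \<in> W" "e > 0" "Q \<gamma> {s - e<..<s + e}" "\<gamma> s = x"
    and img: "\<gamma> ` {s - e<..<s + e} = W \<inter> S"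
  shows "local_parametrization Q S x W 1 (\<lambda>_. \<gamma>) (\<lambda>_. s) (\<lambda>_. e)"
proof -
  have "(\<Union>i<1::nat. \<gamma> ` {s - e<..<s + e}) = W \<inter> S" unfolding img by auto
  then show ?thesis unfolding local_parametrization_def using assms(1-5) by blast
qed

lemma open_plane_box:
  fixes x :: plane
  assumes "open V" "x \<in> V"
  obtains e where "e > 0" "\<And>s t. \<bar>s - fst x\<bar> < e \<Longrightarrow> \<bar>t - snd x\<bar> < e \<Longrightarrow> (s, t) \<in> V"
proof -
  obtain A B where AB: "open A" "open B" "fst x \<in> A" "snd x \<in> B" "A \<times> B \<subseteq> V"
    using open_prod_elim[OF assms] by (metis mem_Times_iff)
  obtain d where d: "d > 0" "\<And>s. \<bar>s - fst x\<bar> < d \<Longrightarrow> s \<in> A"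
    using AB(1,3) unfolding open_dist dist_real_def by blast
  obtain e where e: "e > 0" "\<And>s. \<bar>s - snd x\<bar> < e \<Longrightarrow> s \<in> B"
    using AB(2,4) unfolding open_dist dist_real_def by blast
  show ?thesis
    by (rule that[of "min d e"]) (use d e AB(5) in auto)
qed

text \<open>Pairing \<open>H\<close> with the linear coordinate along its tangent line gives a local
  diffeomorphism that straightens the zero set to the horizontal axis. Its inverse on the axis is
  the arc, and its first coordinate is a continuous inverse of the arc.\<close>

lemma regular_point_level_set:
  fixes H :: "plane \<Rightarrow> real"
  assumes "open U" and H: "smooth_on U H" and "x \<in> U" "H x = 0"
    and dH: "(H has_derivative H') (at x)" "H' v0 \<noteq> 0"
    and S: "\<And>p. p \<in> U \<Longrightarrow> p \<in> S \<longleftrightarrow> H p = 0"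
  shows "regular_point S x"
proof -
  define a b where ab: "a = H' (1, 0)" "b = H' (0, 1)"
  have "a \<noteq> 0 \<or> b \<noteq> 0" using has_derivative_plane[OF dH(1), of v0] dH(2) ab by auto
  then have ab0: "a\<^sup>2 + b\<^sup>2 \<noteq> 0" by (simp add: sum_power2_eq_zero_iff)
  \<comment> \<open>\<open>(- b, a)\<close> spans the kernel of \<open>H'\<close>, and the Jacobian
    becomes \<open>- (a^2 + b^2)\<close>.\<close>
  define f where "f p = (- b * fst p + a * snd p, H p)" for p
  have sf: "smooth_on U f"
    unfolding f_def using \<open>open U\<close> H by (intro smooth_intros)
  have df: "(f has_derivative (\<lambda>v. (- b * fst v + a * snd v, H' v))) (at x)"
    unfolding f_def by (intro has_derivative_Pair dH(1)) (auto intro!: derivative_eq_intros)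
  have "plane_det (\<lambda>v. (- b * fst v + a * snd v, H' v)) = - (a\<^sup>2 + b\<^sup>2)"
    by (simp add: plane_det_def ab power2_eq_square)
  then have "plane_det (\<lambda>v. (- b * fst v + a * snd v, H' v)) \<noteq> 0" using ab0 by linarith
  from smooth_local_inverse[OF \<open>open U\<close> sf \<open>x \<in> U\<close> df this]
  obtain U' V g where g: "open U'" "U' \<subseteq> U" "x \<in> U'" "open V" "f x \<in> V" "homeomorphism U' V f g"
    "smooth_on V g" "\<And>y v. y \<in> V \<Longrightarrow> v \<noteq> 0 \<Longrightarrow> frechet_derivative g (at y) v \<noteq> 0" by metis
  define s0 where "s0 = fst (f x)"
  have fx: "f x = (s0, 0)" by (simp add: s0_def f_def \<open>H x = 0\<close>)
  obtain e where e: "e > 0" "\<And>s t. \<bar>s - s0\<bar> < e \<Longrightarrow> \<bar>t\<bar> < e \<Longrightarrow> (s, t) \<in> V"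
    using open_plane_box[OF g(4,5)] fx by auto
  define I where "I = {s0 - e<..<s0 + e}"
  define \<gamma> where "\<gamma> t = g (t, 0)" for t
  \<comment> \<open>The neighbourhood is cut down to the preimage of a box, so that the arc over
    \<open>I\<close> fills \<open>W \<inter> S\<close> exactly, as
    \<open>local_parametrization\<close> demands.\<close>
  define W where "W = U' \<inter> f -` (I \<times> {-e<..<e})"
  have gf: "g (f p) = p" if "p \<in> U'" for p using g(6) that by (simp add: homeomorphism_def)
  have fg: "f (g q) = q" "g q \<in> U'" if "q \<in> V" for q using g(6) that by (auto simp: homeomorphism_def)
  have cf: "continuous_on U' f" using g(6) by (simp add: homeomorphism_def)
  have oW: "open W" unfolding W_def
    by (rule continuous_open_preimage[OF cf g(1)]) (simp add: I_def open_Times)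
  have IV: "(t, 0) \<in> V" if "t \<in> I" for t using e that by (auto simp: I_def)
  have xW: "x \<in> W" using g(3) fx e(1) by (simp add: W_def I_def)
  have img: "\<gamma> ` I = W \<inter> S"
  proof (intro equalityI subsetI)
    fix p assume "p \<in> \<gamma> ` I"
    then obtain t where t: "t \<in> I" "p = g (t, 0)" by (auto simp: \<gamma>_def)
    have "f p = (t, 0)" "p \<in> U'" using fg[OF IV[OF t(1)]] t(2) by auto
    then show "p \<in> W \<inter> S" using t(1) S[of p] g(2) e(1) by (auto simp: W_def f_def)
  next
    fix p assume p: "p \<in> W \<inter> S"
    then have pU: "p \<in> U'" and pI: "fst (f p) \<in> I" by (auto simp: W_def)
    have "H p = 0" using S[of p] g(2) p pU by blast
    then have "\<gamma> (fst (f p)) = p" using gf[OF pU] by (simp add: f_def \<gamma>_def)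
    then show "p \<in> \<gamma> ` I" using imageI[OF pI, of \<gamma>] by simp
  qed
  have s\<gamma>: "smooth_on I \<gamma>"
    unfolding \<gamma>_def using IV
    by (intro smooth_on_compose_plane[OF _ g(4) _ g(7)] smooth_intros) (auto simp: I_def)
  have vel: "velocity \<gamma> t \<noteq> 0" if "t \<in> I" for t
  proof -
    have "((\<lambda>s. (s, 0)) has_vector_derivative (1, 0)) (at t)" for t :: real
      by (auto intro!: derivative_eq_intros)
    from has_derivative_along_curve[OF smooth_on_has_derivative[OF g(7) IV[OF that]] this]
    have "velocity \<gamma> t = frechet_derivative g (at (t, 0)) (1, 0)"
      unfolding \<gamma>_def by (rule vector_derivative_at)
    then show ?thesis using g(8)[OF IV[OF that], of "(1, 0)"] by (simp add: zero_prod_def)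
  qed
  have "homeomorphism I (\<gamma> ` I) \<gamma> (\<lambda>p. fst (f p))"
  proof (rule homeomorphismI)
    show "continuous_on I \<gamma>" by (rule smooth_on_imp_continuous_on[OF s\<gamma>])
    show "continuous_on (\<gamma> ` I) (\<lambda>p. fst (f p))"
      using img W_def by (intro continuous_on_fst continuous_on_subset[OF cf]) auto
  qed (use fg IV in \<open>auto simp: \<gamma>_def\<close>)
  then have "regular_arc \<gamma> I" using s\<gamma> vel by (auto simp: regular_arc_def regular_def)
  moreover have "\<gamma> s0 = x" using gf[OF g(3)] unfolding fx \<gamma>_def .
  ultimately have "local_parametrization regular_arc S x W 1 (\<lambda>_. \<gamma>) (\<lambda>_. s0) (\<lambda>_. e)"
    using local_parametrization_single[OF oW xW e(1)] img unfolding I_def by blast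
  moreover have "x \<in> S" using S \<open>x \<in> U\<close> \<open>H x = 0\<close> by blast
  ultimately show ?thesis unfolding regular_point_def by blast
qed

text \<open>\<open>(x, y) \<mapsto> (x, K (x, y))\<close> is a local diffeomorphism, and
  \<open>m\<close> is the second coordinate of its inverse on the axis. The bound \<open>d\<close>
  delimits uniqueness; \<open>e\<close> is shrunk until \<open>m\<close> stays below
  \<open>d\<close>.\<close>

lemma smooth_implicit_function:
  fixes K :: "plane \<Rightarrow> real"
  assumes K: "smooth_on UNIV K" "K (0, 0) = 0" "(K has_derivative K') (at (0, 0))" "K' (0, 1) \<noteq> 0"
  obtains e d m where "e > 0" "d > 0" "smooth_on {-e<..<e} m" "m 0 = 0"
    "\<And>x. \<bar>x\<bar> < e \<Longrightarrow> \<bar>m x\<bar> < d" "\<And>x y. \<bar>x\<bar> < e \<Longrightarrow> \<bar>y\<bar> < d \<Longrightarrow> K (x, y) = 0 \<longleftrightarrow> y = m x"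
proof -
  define f where "f p = (fst p, K p)" for p
  have sf: "smooth_on UNIV f" unfolding f_def using K(1) by (intro smooth_intros) auto
  have df: "(f has_derivative (\<lambda>v. (fst v, K' v))) (at (0, 0))"
    unfolding f_def by (intro has_derivative_Pair K(3)) (auto intro!: derivative_eq_intros)
  have "plane_det (\<lambda>v. (fst v, K' v)) \<noteq> 0" using K(4) by (simp add: plane_det_def)
  from smooth_local_inverse[OF open_UNIV sf UNIV_I df this]
  obtain U V g where g: "open U" "(0, 0) \<in> U" "open V" "f (0, 0) \<in> V" "homeomorphism U V f g"
    "smooth_on V g" by metis
  have f0: "f (0, 0) = (0, 0)" by (simp add: f_def K(2))
  have gf: "g (f p) = p" if "p \<in> U" for p using g(5) that by (simp add: homeomorphism_def)
  have fg: "f (g q) = q" "g q \<in> U" if "q \<in> V" for q using g(5) that by (auto simp: homeomorphism_def)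
  obtain d where d: "d > 0" "\<And>s t. \<bar>s\<bar> < d \<Longrightarrow> \<bar>t\<bar> < d \<Longrightarrow> (s, t) \<in> U"
    using open_plane_box[OF g(1,2)] by auto
  obtain e1 where e1: "e1 > 0" "\<And>s t. \<bar>s\<bar> < e1 \<Longrightarrow> \<bar>t\<bar> < e1 \<Longrightarrow> (s, t) \<in> V"
    using open_plane_box[OF g(3,4)] f0 by auto
  define m where "m x = snd (g (x, 0))" for x
  have sm: "smooth_on {-e1<..<e1} m"
    unfolding m_def using e1 g(3,6)
    by (intro smooth_on_snd smooth_on_compose_plane[OF _ g(3) _ g(6)] smooth_intros) auto
  have m0: "m 0 = 0" using gf[OF g(2)] f0 by (simp add: m_def)
  have "isCont m 0"
    using smooth_on_imp_continuous_on[OF sm] e1(1) by (auto simp: continuous_on_eq_continuous_at)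
  then obtain e2 where e2: "e2 > 0" "\<And>x. \<bar>x\<bar> < e2 \<Longrightarrow> \<bar>m x\<bar> < d"
    using d(1) m0 unfolding continuous_at_eps_delta by (auto simp: dist_real_def)
  define e where "e = min d (min e1 e2)"
  show ?thesis
  proof (rule that[of e d m])
    show "e > 0" using d e1 e2 by (simp add: e_def)
    show "smooth_on {-e<..<e} m" by (rule smooth_on_subset[OF sm]) (auto simp: e_def)
    show "\<bar>m x\<bar> < d" if "\<bar>x\<bar> < e" for x using e2 that by (simp add: e_def)
    show "K (x, y) = 0 \<longleftrightarrow> y = m x" if xy: "\<bar>x\<bar> < e" "\<bar>y\<bar> < d" for x y
    proof
      assume "K (x, y) = 0"
      then have "g (x, 0) = (x, y)" using gf[OF d(2), of x y] xy by (simp add: f_def e_def)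
      then show "y = m x" by (simp add: m_def)
    next
      assume "y = m x"
      have "f (g (x, 0)) = (x, 0)" using fg(1)[OF e1(2)] xy(1) e1(1) by (simp add: e_def)
      then show "K (x, y) = 0" using \<open>y = m x\<close>
        by (metis f_def fst_conv m_def prod.collapse snd_conv)
    qed
  qed (use d m0 in auto)
qed

section \<open>Criteria for a curve to be a front\<close>

abbreviation cross :: "plane \<Rightarrow> plane \<Rightarrow> real" where
  "cross u v \<equiv> fst u * snd v - snd u * fst v"

text \<open>The unit normal is \<open>n / norm n\<close> turned by a right angle; it stands still at \<open>t\<close> only if
  \<open>n'\<close> is parallel to \<open>n\<close>.\<close>

lemma front_from_direction:
  assumes "open I" and \<gamma>: "smooth_on I \<gamma>" and n: "smooth_on I n"
    and n0: "\<And>t. t \<in> I \<Longrightarrow> n t \<noteq> 0"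
    and vel: "\<And>t. t \<in> I \<Longrightarrow> velocity \<gamma> t = c t *\<^sub>R n t"
    and cr: "\<And>t. t \<in> I \<Longrightarrow> c t \<noteq> 0 \<or> cross (n t) (velocity n t) \<noteq> 0"
  shows "front \<gamma> I"
proof -
  define N where "N t = sqrt (n t \<bullet> n t)" for t
  have N0: "N t \<noteq> 0" if "t \<in> I" for t using n0[OF that] by (simp add: N_def)
  have sN: "smooth_on I N"
    unfolding N_def using n0 by (intro smooth_intros n \<open>open I\<close>) auto
  define \<nu> where "\<nu> t = (- snd (n t) / N t, fst (n t) / N t)" for t
  have s\<nu>: "smooth_on I \<nu>"
    unfolding \<nu>_def by (intro smooth_intros n sN \<open>open I\<close>) (use N0 in auto)
  have N2: "(N t)\<^sup>2 = (fst (n t))\<^sup>2 + (snd (n t))\<^sup>2" for t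
    by (simp add: N_def inner_prod_def power2_eq_square)
  have "norm (\<nu> t) = 1" if "t \<in> I" for t
  proof -
    have "(- snd (n t) / N t)\<^sup>2 + (fst (n t) / N t)\<^sup>2 = ((fst (n t))\<^sup>2 + (snd (n t))\<^sup>2) / (N t)\<^sup>2"
      by (simp add: power_divide add_divide_distrib)
    also have "\<dots> = 1" unfolding N2[symmetric] using N0[OF that] by simp
    finally show ?thesis unfolding \<nu>_def norm_Pair real_norm_def power2_abs by simp
  qed
  moreover have "velocity \<gamma> t \<bullet> \<nu> t = 0" if "t \<in> I" for t
    using vel[OF that] by (simp add: \<nu>_def inner_prod_def algebra_simps)
  ultimately have "frontal_pair \<gamma> \<nu> I" using \<gamma> s\<nu> by (simp add: frontal_pair_def)
  moreover have "(velocity \<gamma> t, velocity \<nu> t) \<noteq> (0, 0)" if "t \<in> I" for t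
  proof
    assume *: "(velocity \<gamma> t, velocity \<nu> t) = (0, 0)"
    then have "c t = 0" using vel[OF that] n0[OF that] by simp
    define N' where "N' = vector_derivative N (at t)"
    have dN: "(N has_vector_derivative N') (at t)"
      unfolding N'_def by (rule smooth_on_has_vector_derivative[OF sN that])
    have d\<nu>: "(\<nu> has_vector_derivative 0) (at t)"
      using smooth_on_has_vector_derivative[OF s\<nu> that] * by simp
    have d1: "((\<lambda>s. fst (\<nu> s)) has_vector_derivative 0) (at t)"
      and d2: "((\<lambda>s. snd (\<nu> s)) has_vector_derivative 0) (at t)"
      using bounded_linear.has_vector_derivative[OF bounded_linear_fst d\<nu>]
        bounded_linear.has_vector_derivative[OF bounded_linear_snd d\<nu>] by simp_all
    \<comment> \<open>\<open>n\<close> is recovered from \<open>\<nu>\<close> by turning back and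
      rescaling with \<open>N\<close>. With \<open>\<nu>' = 0\<close> only \<open>N\<close>
      contributes, so \<open>n'\<close> is parallel to \<open>n\<close>.\<close>
    have "((\<lambda>s. (N s * snd (\<nu> s), - (N s * fst (\<nu> s)))) has_vector_derivative
        (N t * 0 + N' * snd (\<nu> t), - (N t * 0 + N' * fst (\<nu> t)))) (at t)"
      by (intro has_vector_derivative_Pair has_vector_derivative_mult has_vector_derivative_minus dN d1 d2)
    moreover have "(N s * snd (\<nu> s), - (N s * fst (\<nu> s))) = n s" if "s \<in> I" for s
      using N0[OF that] by (simp add: \<nu>_def)
    ultimately have "(n has_vector_derivative (N' * snd (\<nu> t), - (N' * fst (\<nu> t)))) (at t)"
      using has_vector_derivative_transform_within_open[OF _ \<open>open I\<close> that] by fastforce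
    then have "velocity n t = (N' * snd (\<nu> t), - (N' * fst (\<nu> t)))" by (rule vector_derivative_at)
    then have "cross (n t) (velocity n t) = 0" by (simp add: \<nu>_def)
    with cr[OF that] \<open>c t = 0\<close> show False by simp
  qed
  ultimately show ?thesis unfolding front_def by blast
qed

lemma regular_imp_front: "open I \<Longrightarrow> regular \<gamma> I \<Longrightarrow> front \<gamma> I"
  unfolding regular_def
  by (rule front_from_direction[where c = "\<lambda>_. 1" and n = "velocity \<gamma>"])
    (auto intro: smooth_on_vector_derivative)

text \<open>The normal is free here; the direction \<open>(1, t)\<close> turns with nonzero speed,
  which makes the pair of curve and normal an immersion.\<close>

lemma constant_front:
  assumes "open I"
  shows "front (\<lambda>_. x) I"
proof (rule front_from_direction[where c = "\<lambda>_. 0" and n = "\<lambda>t. (1, t)"])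
  have "((\<lambda>t. (1, t)) has_vector_derivative (0, 1)) (at t)" for t :: real
    by (auto intro!: derivative_eq_intros)
  then have "velocity (\<lambda>t. (1, t)) t = (0, 1)" for t by (rule vector_derivative_at)
  then show "0 \<noteq> (0::real) \<or> cross (1, t) (velocity (\<lambda>t. (1, t)) t) \<noteq> 0" for t by simp
qed (use assms in \<open>auto intro!: smooth_intros simp: zero_prod_def\<close>)

text \<open>In the straightened picture the velocity of \<open>(t^2, t^3)\<close> is
  \<open>t\<close> times \<open>(2, 3 * t)\<close>. The derivative of \<open>\<psi>\<close> carries
  this to \<open>t *\<^sub>R n t\<close>. At \<open>t = 0\<close> the vectors \<open>n 0\<close> and
  \<open>n' 0\<close> are images of multiples of the two basis vectors, hence independent, so the
  normal turns there.\<close>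

lemma ordinary_cusp_front:
  assumes "ordinary_cusp S x"
  shows "\<exists>U n \<gamma> \<tau> \<epsilon>. local_parametrization front S x U n \<gamma> \<tau> \<epsilon>"
proof -
  obtain U V \<phi> \<psi> where U: "open U" "x \<in> U" and V: "open V" and hom: "homeomorphism U V \<phi> \<psi>"
    and s\<phi>: "smooth_on U \<phi>" and s\<psi>: "smooth_on V \<psi>" and \<phi>x: "\<phi> x = (0, 0)"
    and img: "\<phi> ` (U \<inter> S) = V \<inter> {(t\<^sup>2, t^3) | t :: real. True}"
    using assms unfolding ordinary_cusp_def by blast
  have \<psi>\<phi>: "\<psi> (\<phi> p) = p" "\<phi> p \<in> V" if "p \<in> U" for p using hom that by (auto simp: homeomorphism_def)
  have \<phi>\<psi>: "\<phi> (\<psi> q) = q" "\<psi> q \<in> U" if "q \<in> V" for q using hom that by (auto simp: homeomorphism_def)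
  have V0: "(0, 0) \<in> V" using \<psi>\<phi>(2)[OF U(2)] \<phi>x by simp
  obtain e0 where e0: "e0 > 0" "\<And>s t. \<bar>s\<bar> < e0 \<Longrightarrow> \<bar>t\<bar> < e0 \<Longrightarrow> (s, t) \<in> V"
    using open_plane_box[OF V V0] by auto
  \<comment> \<open>\<open>e \<le> 1\<close> makes \<open>t^2\<close> and
    \<open>\<bar>t^3\<bar>\<close> at most \<open>\<bar>t\<bar>\<close>.\<close>
  define e where "e = min 1 e0"
  have e: "e > 0" using e0 by (simp add: e_def)
  define I where "I = {0 - e<..<0 + e}"
  have IV: "(t\<^sup>2, t^3) \<in> V" if "t \<in> I" for t
  proof (rule e0(2))
    have t: "\<bar>t\<bar> < 1" "\<bar>t\<bar> < e0" using that by (auto simp: I_def e_def)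
    have "\<bar>t\<bar> ^ Suc n \<le> \<bar>t\<bar> ^ 1" for n using t by (intro power_decreasing) auto
    from this[of 1] this[of 2] show "\<bar>t\<^sup>2\<bar> < e0" "\<bar>t^3\<bar> < e0"
      using t by (auto simp: power_abs eval_nat_numeral abs_mult)
  qed
  define \<gamma> where "\<gamma> t = \<psi> (t\<^sup>2, t^3)" for t
  define d where "d q = frechet_derivative \<psi> (at q)" for q
  have d: "(\<psi> has_derivative d q) (at q)" if "q \<in> V" for q
    unfolding d_def by (rule smooth_on_has_derivative[OF s\<psi> that])
  have inj: "d q v \<noteq> 0" if "q \<in> V" "v \<noteq> 0" for q v
  proof
    assume "d q v = 0"
    have "((\<lambda>p. \<phi> (\<psi> p)) has_derivative (\<lambda>v. frechet_derivative \<phi> (at (\<psi> q)) (d q v))) (at q)"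
      by (rule has_derivative_compose[OF d[OF that(1)] smooth_on_has_derivative[OF s\<phi> \<phi>\<psi>(2)[OF that(1)]]])
    then have "((\<lambda>p. p) has_derivative (\<lambda>v. frechet_derivative \<phi> (at (\<psi> q)) (d q v))) (at q)"
      by (rule has_derivative_transform_within_open[OF _ V that(1)]) (use \<phi>\<psi> in auto)
    then have "(\<lambda>v. frechet_derivative \<phi> (at (\<psi> q)) (d q v)) = (\<lambda>v. v)"
      using has_derivative_unique has_derivative_ident by blast
    moreover have "frechet_derivative \<phi> (at (\<psi> q)) 0 = 0"
      using smooth_on_has_derivative[OF s\<phi> \<phi>\<psi>(2)[OF that(1)]] has_derivative_linear linear_0 by blast
    ultimately show False using that(2) \<open>d q v = 0\<close> by metis
  qed
  define n where "n t = 2 *\<^sub>R d (t\<^sup>2, t^3) (1, 0) + (3 * t) *\<^sub>R d (t\<^sup>2, t^3) (0, 1)" for t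
  have nd: "n t = d (t\<^sup>2, t^3) (2, 3 * t)" if "t \<in> I" for t
    unfolding n_def using has_derivative_plane[OF d[OF IV[OF that]], of "(2, 3 * t)"] by simp
  have oI: "open I" by (simp add: I_def)
  have sd: "smooth_on I (\<lambda>t. d (t\<^sup>2, t^3) v)" for v
    using IV unfolding d_def
    by (intro smooth_on_compose_plane[OF oI V _ smooth_on_frechet_derivative[OF s\<psi>]] smooth_intros oI) auto
  have cd: "((\<lambda>t. (t\<^sup>2, t^3)) has_vector_derivative (2 * t, 3 * t\<^sup>2)) (at t)" for t :: real
  proof -
    have "((\<lambda>t. t\<^sup>2) has_real_derivative 2 * t) (at t)" "((\<lambda>t. t^3) has_real_derivative 3 * t\<^sup>2) (at t)"
      by (auto intro!: derivative_eq_intros)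
    then show ?thesis
      by (intro has_vector_derivative_Pair) (simp_all add: has_real_derivative_iff_has_vector_derivative)
  qed
  have front: "front \<gamma> I"
  proof (rule front_from_direction[where c = "\<lambda>t. t" and n = n, OF oI])
    show "smooth_on I \<gamma>" unfolding \<gamma>_def using IV
      by (intro smooth_on_compose_plane[OF oI V _ s\<psi>] smooth_intros oI) auto
    show "smooth_on I n" unfolding n_def by (intro smooth_intros sd oI)
    show "n t \<noteq> 0" if "t \<in> I" for t
      using nd[OF that] inj[OF IV[OF that], of "(2, 3 * t)"] by (simp add: zero_prod_def)
    show "velocity \<gamma> t = t *\<^sub>R n t" if "t \<in> I" for t
    proof -
      have "velocity \<gamma> t = d (t\<^sup>2, t^3) (2 * t, 3 * t\<^sup>2)"
        unfolding \<gamma>_def by (rule vector_derivative_at[OF has_derivative_along_curve[OF d[OF IV[OF that]] cd]])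
      also have "\<dots> = t *\<^sub>R d (t\<^sup>2, t^3) (2, 3 * t)"
        using linear_scale[OF has_derivative_linear[OF d[OF IV[OF that]]], of t "(2, 3 * t)"]
        by (simp add: power2_eq_square mult_ac)
      finally show ?thesis using nd[OF that] by simp
    qed
    show "t \<noteq> 0 \<or> cross (n t) (velocity n t) \<noteq> 0" if "t \<in> I" for t
    proof (cases "t = 0")
      case True
      \<comment> \<open>The curve \<open>(t^2, t^3)\<close> has velocity zero at
        \<open>t = 0\<close>, so every differentiable function of it does too.\<close>
      have d1: "((\<lambda>t. d (t\<^sup>2, t^3) v) has_vector_derivative 0) (at 0)" for v
      proof -
        have "(\<lambda>q. d q v) differentiable (at (0, 0))"
          unfolding d_def by (rule smooth_on_differentiable[OF smooth_on_frechet_derivative[OF s\<psi>] V0])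
        then obtain D where D: "((\<lambda>q. d q v) has_derivative D) (at (0, 0))"
          unfolding differentiable_def by blast
        have "D 0 = 0" using D has_derivative_linear linear_0 by blast
        then show ?thesis
          using has_derivative_along_curve[of "\<lambda>q. d q v" D "\<lambda>t. (t\<^sup>2, t^3)" 0, OF _ cd] D
          by (simp add: zero_prod_def)
      qed
      have "((\<lambda>t. (3 * t) *\<^sub>R d (t\<^sup>2, t^3) (0, 1)) has_vector_derivative
          (3 * 0) *\<^sub>R 0 + 3 *\<^sub>R d (0\<^sup>2, 0^3) (0, 1)) (at 0)"
        by (rule has_vector_derivative_scaleR[OF _ d1]) (auto intro!: derivative_eq_intros)
      from has_vector_derivative_add[OF bounded_linear.has_vector_derivative[OF bounded_linear_scaleR_right d1] this]
      have "(n has_vector_derivative 3 *\<^sub>R d (0, 0) (0, 1)) (at 0)"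
        unfolding n_def by simp
      then have "velocity n 0 = 3 *\<^sub>R d (0, 0) (0, 1)" by (rule vector_derivative_at)
      moreover have "plane_det (d (0, 0)) \<noteq> 0"
        by (rule plane_det_nonzero[OF has_derivative_plane[OF d[OF V0]] inj[OF V0]])
      ultimately show ?thesis using True by (simp add: n_def plane_det_def algebra_simps)
    qed simp
  qed
  \<comment> \<open>Bounding the first coordinate \<open>t^2\<close> by \<open>e^2\<close> selects
    exactly the parameters with \<open>\<bar>t\<bar> < e\<close>.\<close>
  define W where "W = U \<inter> \<phi> -` {q. fst q < e\<^sup>2}"
  have "open {q :: plane. fst q < e\<^sup>2}" by (intro open_Collect_less continuous_intros)
  then have "open W" unfolding W_def using hom
    by (intro continuous_open_preimage U) (auto simp: homeomorphism_def)
  moreover have "x \<in> W" using U \<phi>x e by (simp add: W_def)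
  moreover have "\<gamma> 0 = x" using \<psi>\<phi>(1)[OF U(2)] \<phi>x by (simp add: \<gamma>_def)
  moreover have "\<gamma> ` I = W \<inter> S"
  proof (intro equalityI subsetI)
    fix p assume "p \<in> \<gamma> ` I"
    then obtain t where t: "t \<in> I" "p = \<psi> (t\<^sup>2, t^3)" by (auto simp: \<gamma>_def)
    have "(t\<^sup>2, t^3) \<in> \<phi> ` (U \<inter> S)" using IV[OF t(1)] img by auto
    then obtain p' where p': "p' \<in> U \<inter> S" "\<phi> p' = (t\<^sup>2, t^3)" by auto
    then have "p' = p" using \<psi>\<phi>(1)[of p'] t(2) by simp
    moreover have "t\<^sup>2 < e\<^sup>2" using t(1) power_strict_mono[of "\<bar>t\<bar>" e 2] by (auto simp: I_def abs_less_iff)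
    ultimately show "p \<in> W \<inter> S" using p' by (simp add: W_def)
  next
    fix p assume p: "p \<in> W \<inter> S"
    then have "\<phi> p \<in> V \<inter> {(t\<^sup>2, t^3) | t :: real. True}" using img by (auto simp: W_def)
    then obtain t where t: "\<phi> p = (t\<^sup>2, t^3)" by auto
    have "t\<^sup>2 < e\<^sup>2" using p t by (simp add: W_def)
    then have "\<bar>t\<bar> < e" using e power2_less_imp_less[of "\<bar>t\<bar>" e] by simp
    moreover have "p = \<gamma> t" using \<psi>\<phi>(1)[of p] p t by (simp add: \<gamma>_def W_def)
    ultimately show "p \<in> \<gamma> ` I" unfolding I_def by (metis abs_less_iff diff_0 greaterThanLessThan_iff add_0 imageI minus_less_iff)
  qed
  ultimately have "local_parametrization front S x W 1 (\<lambda>_. \<gamma>) (\<lambda>_. 0) (\<lambda>_. e)"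
    using local_parametrization_single[where \<gamma> = \<gamma> and s = 0, OF _ _ e] front unfolding I_def by blast
  then show ?thesis by blast
qed


section \<open>Polynomial equations of curves\<close>

definition ev :: "real poly poly \<Rightarrow> plane \<Rightarrow> real" where
  "ev F p = poly (poly F [:snd p:]) (fst p)"

lemma mem_zeros: "p \<in> zeros F \<longleftrightarrow> ev F p = 0"
  by (cases p) (simp add: zeros_def ev_def)

lemma ev_0 [simp]: "ev 0 p = 0" and ev_1 [simp]: "ev 1 p = 1"
  and ev_add [simp]: "ev (F + G) p = ev F p + ev G p"
  and ev_diff [simp]: "ev (F - G) p = ev F p - ev G p"
  and ev_mult [simp]: "ev (F * G) p = ev F p * ev G p"
  and ev_power [simp]: "ev (F ^ n) p = ev F p ^ n"
  and ev_pCons [simp]: "ev (pCons a F) p = poly a (fst p) + snd p * ev F p"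
  and ev_smult [simp]: "ev (smult a F) p = poly a (fst p) * ev F p"
  by (simp_all add: ev_def)

lemma ev_sum: "ev (sum f A) p = (\<Sum>i\<in>A. ev (f i) p)"
  by (induction A rule: infinite_finite_induct) auto

lemma ev_monom [simp]: "ev (monom (monom c i) j) p = c * fst p ^ i * snd p ^ j"
  by (simp add: ev_def poly_monom)

lemma smooth_on_ev: "smooth_on UNIV (ev F)"
proof -
  have poly: "smooth_on UNIV (\<lambda>p :: plane. poly a (fst p))" for a
    by (induction a) (auto intro!: smooth_intros)
  have "smooth_on UNIV (\<lambda>p. ev F p)"
    by (induction F) (auto intro!: smooth_intros poly)
  then show ?thesis by simp
qed

lemma continuous_on_ev: "continuous_on A (ev F)"
  using smooth_on_imp_continuous_on[OF smooth_on_ev] continuous_on_subset by blast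

lemma closed_zeros: "closed (zeros F)"
proof -
  have "zeros F = {p. ev F p = 0}" using mem_zeros by auto
  then show ?thesis using continuous_closed_preimage_constant[OF continuous_on_ev[of UNIV F] closed_UNIV]
    by (simp add: vimage_def)
qed

lemma open_ev_nonzero: "open {p. ev F p \<noteq> 0}"
proof -
  have "{p. ev F p \<noteq> 0} = - zeros F" using mem_zeros by auto
  then show ?thesis using closed_zeros by (simp add: open_Compl)
qed

lemma ev_has_derivative_snd:
  assumes "(ev F has_derivative D) (at (x, y))"
  shows "D (0, 1) = ev (pderiv F) (x, y)"
proof -
  have "((\<lambda>s. (x, s)) has_vector_derivative (0, 1)) (at y)"
    by (auto intro!: derivative_eq_intros)
  from has_derivative_along_curve[OF assms this]
  have "((\<lambda>s. ev F (x, s)) has_vector_derivative D (0, 1)) (at y)" .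
  moreover have "((\<lambda>s. ev F (x, s)) has_real_derivative ev (pderiv F) (x, y)) (at y)" for y
    by (induction F arbitrary: y) (auto simp: pderiv_pCons intro!: derivative_eq_intros)
  ultimately show ?thesis
    by (metis has_real_derivative_iff_has_vector_derivative vector_derivative_at)
qed

lemma ev_along_polynomial_curve: "\<exists>h. \<forall>s. ev F (poly a s, poly c s) = poly h s"
proof (induction F)
  case (pCons f F)
  then obtain h where "\<forall>s. ev F (poly a s, poly c s) = poly h s" by blast
  then have "\<forall>s. ev (pCons f F) (poly a s, poly c s) = poly (pcompose f a + c * h) s"
    by (simp add: poly_pcompose)
  then show ?case by blast
qed (auto intro: exI[of _ 0])

lemma ev_zero_on_line:
  assumes "infinite {s. ev F (p + s *\<^sub>R v) = 0}"
  shows "ev F (p + s *\<^sub>R v) = 0"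
proof -
  obtain h where "\<And>s. ev F (poly [:fst p, fst v:] s, poly [:snd p, snd v:] s) = poly h s"
    using ev_along_polynomial_curve by blast
  then have h: "ev F (p + s *\<^sub>R v) = poly h s" for s
    by (cases p; cases v) (simp add: mult.commute)
  with assms have "h = 0" using poly_roots_finite by fastforce
  then show ?thesis using h by simp
qed

lemma ev_nonzero_ex:
  assumes "F \<noteq> 0"
  shows "\<exists>p. p \<noteq> 0 \<and> ev F p \<noteq> 0"
proof -
  have ex: "\<exists>p. ev F p \<noteq> 0" if "F \<noteq> 0" for F
  proof -
    have "finite {x. poly (lead_coeff F) x = 0}" using that by (intro poly_roots_finite) simp
    then obtain x where x: "poly (lead_coeff F) x \<noteq> 0"
      using infinite_UNIV_char_0[where 'a = real] by (metis (mono_tags) finite_subset mem_Collect_eq subsetI)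
    define k where "k = map_poly (\<lambda>a. poly a x) F"
    have "coeff k (degree F) \<noteq> 0" using x by (simp add: k_def coeff_map_poly)
    then have "finite {y. poly k y = 0}" by (intro poly_roots_finite) auto
    then obtain y where y: "poly k y \<noteq> 0"
      using infinite_UNIV_char_0[where 'a = real] by (metis (mono_tags) finite_subset mem_Collect_eq subsetI)
    have "ev F (x, y) = poly k y" unfolding k_def
      by (induction F) (simp_all add: map_poly_pCons)
    with y show ?thesis by metis
  qed
  \<comment> \<open>\<open>pCons 0 F\<close> is \<open>F\<close> times \<open>y\<close>; a point
    where it does not vanish is off the horizontal axis, hence not the origin.\<close>
  have "pCons 0 F \<noteq> 0" using assms by simp
  then obtain p where "ev (pCons 0 F) p \<noteq> 0" using ex by blast
  then have "snd p \<noteq> 0" "ev F p \<noteq> 0" by auto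
  then show ?thesis by (metis snd_zero)
qed

lemma ev_eqI:
  assumes "\<And>p. p \<noteq> 0 \<Longrightarrow> ev F p = ev G p"
  shows "F = G"
  using ev_nonzero_ex[of "F - G"] assms by fastforce

lemma isolate_in_finite:
  fixes a :: real
  assumes "finite A"
  obtains B where "open B" "a \<in> B" "B \<inter> A \<subseteq> {a}"
proof (rule that[of "- (A - {a})"])
  show "open (- (A - {a}))" using assms by (intro open_Compl finite_imp_closed) simp
qed auto

text \<open>Among the nonzero polynomials that vanish on a nonempty relatively open piece of the curve
  inside \<open>U\<close>, take \<open>H\<close> of minimal degree in \<open>y\<close>. Neither \<open>\<partial>H/\<partial>y\<close> nor the leading coefficient
  of \<open>H\<close> vanishes on such a piece, and the pseudo-remainder of \<open>F\<close> modulo \<open>H\<close> is zero,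
  so the curve is locally the smooth level set of \<open>H\<close>.\<close>

lemma regular_or_isolated_points_dense:
  assumes "F \<noteq> 0" "open U" "p \<in> U" "p \<in> zeros F"
  shows "\<exists>q\<in>U \<inter> zeros F. q isolated_in zeros F \<or> regular_point (zeros F) q"
proof -
  define good where "good H \<longleftrightarrow> H \<noteq> 0 \<and>
    (\<exists>V. open V \<and> V \<subseteq> U \<and> V \<inter> zeros F \<noteq> {} \<and> V \<inter> zeros F \<subseteq> zeros H)" for H
  have "good F" unfolding good_def using assms by blast
  then obtain H where H: "good H" and min: "\<And>H'. good H' \<Longrightarrow> degree H \<le> degree H'"
    using ex_has_least_nat[of good F degree] by blast
  obtain V where "H \<noteq> 0" and V: "open V" "V \<subseteq> U" "V \<inter> zeros F \<noteq> {}" "V \<inter> zeros F \<subseteq> zeros H"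
    using H unfolding good_def by blast
  have notall: "\<exists>q\<in>V' \<inter> zeros F. ev H' q \<noteq> 0"
    if "H' \<noteq> 0" "degree H' < degree H" "open V'" "V' \<subseteq> U" "V' \<inter> zeros F \<noteq> {}" for V' H'
  proof (rule ccontr)
    assume "\<not> ?thesis"
    then have "V' \<inter> zeros F \<subseteq> zeros H'" by (auto simp: mem_zeros)
    then have "good H'" unfolding good_def using that by blast
    then show False using min that(2) by fastforce
  qed
  show ?thesis
  proof (cases "degree H = 0")
    \<comment> \<open>\<open>H\<close> depends on \<open>x\<close> alone, so near \<open>q\<close>
      the curve lies on the vertical line \<open>x = a\<close>. The restriction \<open>k\<close> of
      \<open>F\<close> to this line decides: if it vanishes, the line is the curve near
      \<open>q\<close>; otherwise \<open>q\<close> is isolated.\<close>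
    case True
    then obtain h where h: "H = [:h:]" by (rule degree_eq_zeroE)
    obtain q where q: "q \<in> V" "q \<in> zeros F" using V(3) by blast
    obtain a b where ab: "q = (a, b)" by (cases q)
    have "finite {x. poly h x = 0}" using \<open>H \<noteq> 0\<close> h by (intro poly_roots_finite) simp
    then obtain A where A: "open A" "a \<in> A" "A \<inter> {x. poly h x = 0} \<subseteq> {a}"
      by (rule isolate_in_finite)
    define V' where "V' = V \<inter> A \<times> UNIV"
    have V': "open V'" "q \<in> V'" using V(1) A q ab by (auto simp: V'_def open_Times)
    have vert: "fst p = a" if "p \<in> V'" "p \<in> zeros F" for p
      using that V(4) A(3) unfolding V'_def by (fastforce simp: mem_zeros h)
    define k where "k = map_poly (\<lambda>f. poly f a) F"
    have k: "ev F (a, y) = poly k y" for y unfolding k_def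
      by (induction F) (simp_all add: map_poly_pCons)
    show ?thesis
    proof (cases "k = 0")
      case True
      have "regular_point (zeros F) q"
      proof (rule regular_point_level_set[OF V'(1) _ V'(2)])
        show "smooth_on V' (\<lambda>p. fst p - a)" by (intro smooth_intros V'(1))
        show "fst q - a = 0" by (simp add: ab)
        show "((\<lambda>p. fst p - a) has_derivative fst) (at q)" by (auto intro!: derivative_eq_intros)
        show "fst (1 :: real, 0 :: real) \<noteq> 0" by simp
        show "p \<in> zeros F \<longleftrightarrow> fst p - a = 0" if "p \<in> V'" for p
          using vert[OF that] k[of "snd p"] True by (cases p) (auto simp: mem_zeros)
      qed
      then show ?thesis using q V(2) by blast
    next
      case False
      then have "finite {y. poly k y = 0}" by (rule poly_roots_finite)
      then obtain B where B: "open B" "b \<in> B" "B \<inter> {y. poly k y = 0} \<subseteq> {b}"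
        by (rule isolate_in_finite)
      have "(V' \<inter> UNIV \<times> B) \<inter> zeros F = {q}"
      proof (intro equalityI subsetI)
        fix p assume p: "p \<in> (V' \<inter> UNIV \<times> B) \<inter> zeros F"
        then have "fst p = a" using vert by blast
        moreover have "snd p = b" using p B(3) k[of "snd p"] \<open>fst p = a\<close>
          by (cases p) (auto simp: mem_zeros)
        ultimately show "p \<in> {q}" by (cases p) (simp add: ab)
      qed (use V' q ab B in auto)
      moreover have "open (V' \<inter> UNIV \<times> B)" using V' B by (intro open_Int open_Times) auto
      ultimately have "q isolated_in zeros F" using q(2) isolated_inI by blast
      then show ?thesis using q V(2) by blast
    qed
  next
    case False
    have "pderiv H \<noteq> 0" using False by (simp add: pderiv_eq_0_iff)
    moreover have "degree (pderiv H) < degree H" using False by (simp add: degree_pderiv)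
    ultimately obtain q1 where q1: "q1 \<in> V \<inter> zeros F" "ev (pderiv H) q1 \<noteq> 0"
      using notall V by meson
    define V1 where "V1 = V \<inter> {p. ev (pderiv H) p \<noteq> 0}"
    have V1: "open V1" "V1 \<subseteq> U" "V1 \<inter> zeros F \<noteq> {}"
      using V q1 open_ev_nonzero by (auto simp: V1_def)
    define c where "c = [:lead_coeff H:]"
    have c: "c \<noteq> 0" "degree c < degree H" using False \<open>H \<noteq> 0\<close> by (simp_all add: c_def)
    obtain q where q: "q \<in> V1 \<inter> zeros F" "ev c q \<noteq> 0"
      using notall[OF c V1] by blast
    define V2 where "V2 = V1 \<inter> {p. ev c p \<noteq> 0}"
    have V2: "open V2" "V2 \<subseteq> U" "q \<in> V2" "V2 \<inter> zeros F \<noteq> {}"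
      using V1 q open_ev_nonzero by (auto simp: V2_def)
    obtain Q R where QR: "pseudo_divmod F H = (Q, R)" by (cases "pseudo_divmod F H")
    define n where "n = Suc (degree F) - degree H"
    have div: "smult (lead_coeff H ^ n) F = H * Q + R" "R = 0 \<or> degree R < degree H"
      using pseudo_divmod[OF \<open>H \<noteq> 0\<close> QR] by (auto simp: n_def)
    have evdiv: "ev c p ^ n * ev F p = ev H p * ev Q p + ev R p" for p
      using arg_cong[OF div(1), of "\<lambda>F. ev F p"] by (simp add: c_def)
    \<comment> \<open>Where \<open>F\<close> and \<open>H\<close> vanish, so does \<open>R\<close>;
      having smaller degree in \<open>y\<close> than \<open>H\<close>, it must be zero by
      minimality.\<close>
    have "R = 0"
    proof (rule ccontr)
      assume "R \<noteq> 0"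
      then obtain p where "p \<in> V2 \<inter> zeros F" "ev R p \<noteq> 0" using notall div(2) V2 by meson
      moreover have "ev H p = 0" using V(4) \<open>p \<in> V2 \<inter> zeros F\<close>
        by (auto simp: V2_def V1_def mem_zeros)
      ultimately show False using evdiv[of p] by (simp add: mem_zeros)
    qed
    have lev: "p \<in> zeros F \<longleftrightarrow> ev H p = 0" if "p \<in> V2" for p
    proof
      show "p \<in> zeros F \<Longrightarrow> ev H p = 0" using that V(4) by (auto simp: V2_def V1_def mem_zeros)
      assume "ev H p = 0"
      then have "ev c p ^ n * ev F p = 0" using evdiv[of p] \<open>R = 0\<close> by simp
      then show "p \<in> zeros F" using that by (simp add: V2_def mem_zeros)
    qed
    have "regular_point (zeros F) q"
    proof (rule regular_point_level_set[OF V2(1) _ V2(3) _ _ _ lev])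
      show "smooth_on V2 (ev H)" by (rule smooth_on_subset[OF smooth_on_ev]) simp
      show "ev H q = 0" using lev q V2 by blast
      show d: "(ev H has_derivative frechet_derivative (ev H) (at q)) (at q)"
        by (rule smooth_on_has_derivative[OF smooth_on_ev]) simp
      show "frechet_derivative (ev H) (at q) (0, 1) \<noteq> 0"
        using ev_has_derivative_snd[of H _ "fst q" "snd q"] d q(1) by (simp add: V1_def)
    qed
    then show ?thesis using q V1 by blast
  qed
qed

section \<open>Total degree and inversion of polynomials\<close>

lemma coeff_total_degree:
  assumes "coeff (coeff F j) i \<noteq> 0"
  shows "i + j \<le> total_degree F"
proof -
  \<comment> \<open>A \<open>LEAST\<close> is meaningful only if some bound exists; this crude one
    serves.\<close>
  define n where "n = (\<Sum>j\<le>degree F. degree (coeff F j)) + degree F"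
  have "i + j \<le> n" if "coeff (coeff F j) i \<noteq> 0" for i j
  proof -
    have j: "j \<le> degree F" using that by (intro le_degree) auto
    have "i \<le> degree (coeff F j)" using that le_degree by blast
    also have "\<dots> \<le> (\<Sum>j\<le>degree F. degree (coeff F j))"
      using j by (intro member_le_sum) auto
    finally show ?thesis using j by (simp add: n_def)
  qed
  then have "\<forall>i j. coeff (coeff F j) i \<noteq> 0 \<longrightarrow> i + j \<le> total_degree F"
    unfolding total_degree_def
    by (intro LeastI[where P = "\<lambda>n. \<forall>i j. coeff (coeff F j) i \<noteq> 0 \<longrightarrow> i + j \<le> n"] allI impI)
  then show ?thesis using assms by blast
qed

lemma total_degree_le:
  assumes "\<And>i j. coeff (coeff F j) i \<noteq> 0 \<Longrightarrow> i + j \<le> n"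
  shows "total_degree F \<le> n"
  unfolding total_degree_def
  by (rule Least_le[where P = "\<lambda>n. \<forall>i j. coeff (coeff F j) i \<noteq> 0 \<longrightarrow> i + j \<le> n"]) (use assms in blast)

lemma finite_bidegrees: "finite {(i, j). i + j \<le> (n :: nat)}"
  by (rule finite_subset[of _ "{..n} \<times> {..n}"]) auto

lemma ev_eq_sum:
  assumes n: "total_degree F \<le> n"
  shows "ev F p = (\<Sum>(i, j) | i + j \<le> n. coeff (coeff F j) i * fst p ^ i * snd p ^ j)"
proof -
  define G where "G = (\<Sum>(i, j) | i + j \<le> n. monom (monom (coeff (coeff F j) i) i) j)"
  have "coeff (coeff G l) k = coeff (coeff F l) k" for k l
  proof -
    have "coeff (coeff G l) k =
        (\<Sum>x\<in>{(i, j). i + j \<le> n}. if x = (k, l) then coeff (coeff F l) k else 0)"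
      unfolding G_def coeff_sum by (intro sum.cong) (auto split: if_splits)
    also have "\<dots> = (if k + l \<le> n then coeff (coeff F l) k else 0)"
      using finite_bidegrees[of n] by simp
    also have "\<dots> = coeff (coeff F l) k" using coeff_total_degree[of F l k] n
      by (cases "coeff (coeff F l) k = 0") auto
    finally show ?thesis .
  qed
  then have "F = G" by (simp add: poly_eq_iff)
  then have "ev F p = ev G p" by simp
  then show ?thesis unfolding G_def ev_sum by (simp add: case_prod_unfold)
qed

text \<open>The \<open>G\<close> of \<open>inversion_poly\<close>, before powers of
  \<open>r2\<close> are divided out.\<close>

definition inversion_numerator :: "real poly poly \<Rightarrow> real poly poly" where
  "inversion_numerator F = (\<Sum>(i, j) | i + j \<le> total_degree F.
     monom (monom (coeff (coeff F j) i) i) j * r2 ^ (total_degree F - (i + j)))"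

definition \<Psi> :: "plane \<Rightarrow> plane" where
  "\<Psi> p = (1 / (p \<bullet> p)) *\<^sub>R p"

lemma \<Psi>_simps: "fst (\<Psi> p) = fst p / (p \<bullet> p)" "snd (\<Psi> p) = snd p / (p \<bullet> p)"
  by (simp_all add: \<Psi>_def)

lemma \<Psi>_\<Psi> [simp]: "\<Psi> (\<Psi> p) = p"
  by (cases "p = 0") (simp_all add: \<Psi>_def)

lemma \<Psi>_eq_0 [simp]: "\<Psi> p = 0 \<longleftrightarrow> p = 0"
  by (auto simp: \<Psi>_def)

lemma ev_r2 [simp]: "ev r2 p = p \<bullet> p"
  by (simp add: r2_def inner_prod_def)

lemma ev_inversion_numerator:
  assumes "p \<noteq> 0"
  shows "ev (inversion_numerator F) p = (p \<bullet> p) ^ total_degree F * ev F (\<Psi> p)"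
proof -
  let ?r = "p \<bullet> p" and ?n = "total_degree F"
  have "coeff (coeff F j) i * fst p ^ i * snd p ^ j * ?r ^ (?n - (i + j)) =
      ?r ^ ?n * (coeff (coeff F j) i * fst (\<Psi> p) ^ i * snd (\<Psi> p) ^ j)" if "i + j \<le> ?n" for i j
  proof -
    have "?r ^ ?n = ?r ^ (?n - (i + j)) * (?r ^ i * ?r ^ j)"
      using that by (simp flip: power_add)
    then show ?thesis using assms by (simp add: \<Psi>_simps power_divide)
  qed
  then show ?thesis
    unfolding inversion_numerator_def ev_sum ev_eq_sum[OF order_refl, of F] sum_distrib_left
    by (intro sum.cong) auto
qed

lemma inversion_poly:
  assumes "F \<noteq> 0"
  shows "\<exists>m. inversion_numerator F = inversion_poly F * r2 ^ m" and "\<not> r2 dvd inversion_poly F"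
proof -
  let ?G = "inversion_numerator F"
  obtain p where p: "p \<noteq> 0" "ev F p \<noteq> 0" using ev_nonzero_ex[OF assms] by blast
  have "ev ?G (\<Psi> p) \<noteq> 0" using p ev_inversion_numerator[of "\<Psi> p" F] by simp
  then have G0: "?G \<noteq> 0" by auto
  define m where "m = (GREATEST m. r2 ^ m dvd ?G)"
  \<comment> \<open>\<open>GREATEST\<close> needs a bound: \<open>r2 ^ m\<close> has degree
    \<open>2 * m\<close> in \<open>y\<close>, and \<open>?G\<close> is not zero.\<close>
  have "m \<le> degree ?G" if "r2 ^ m dvd ?G" for m
  proof -
    have "degree (r2 ^ m) = 2 * m" by (simp add: degree_power_eq r2_def)
    with dvd_imp_degree_le[OF that G0] show ?thesis by simp
  qed
  then have bound: "\<forall>m. r2 ^ m dvd ?G \<longrightarrow> m \<le> degree ?G" by blast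
  have m: "r2 ^ m dvd ?G" unfolding m_def by (rule GreatestI_nat[where k = 0, OF _ bound[rule_format]]) auto
  have ip: "inversion_poly F = ?G div r2 ^ m"
    by (simp add: inversion_poly_def Let_def m_def inversion_numerator_def)
  with m have eq: "?G = inversion_poly F * r2 ^ m" by simp
  then show "\<exists>m. ?G = inversion_poly F * r2 ^ m" by blast
  show "\<not> r2 dvd inversion_poly F"
  proof
    assume "r2 dvd inversion_poly F"
    then have "r2 ^ Suc m dvd ?G" by (subst eq) (simp add: mult_dvd_mono mult.commute)
    then have "Suc m \<le> m" unfolding m_def by (rule Greatest_le_nat[OF _ bound[rule_format]])
    then show False by simp
  qed
qed

lemma ev_inversion_poly:
  assumes "F \<noteq> 0" "p \<noteq> 0"
  shows "ev (inversion_poly F) p = 0 \<longleftrightarrow> ev F (\<Psi> p) = 0"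
proof -
  obtain m where "inversion_numerator F = inversion_poly F * r2 ^ m" using inversion_poly[OF assms(1)] by blast
  then have "(p \<bullet> p) ^ total_degree F * ev F (\<Psi> p) = ev (inversion_poly F) p * (p \<bullet> p) ^ m"
    using ev_inversion_numerator[OF assms(2), of F] by simp
  moreover have "p \<bullet> p \<noteq> 0" using assms(2) by simp
  ultimately show ?thesis by auto
qed


section \<open>Conics and their polar duals\<close>

locale conic =
  fixes a11 a22 a12 a1 a2 c :: real
  assumes disc: "a11 * a22 * c + 2 * a12 * a1 * a2 - a11 * a2\<^sup>2 - a22 * a1\<^sup>2 - c * a12\<^sup>2 \<noteq> 0"
begin

definition q :: "plane \<Rightarrow> real" where
  "q p = a11 * (fst p)\<^sup>2 + a22 * (snd p)\<^sup>2 + 2 * a12 * fst p * snd p + 2 * a1 * fst p + 2 * a2 * snd p + c"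

definition q2 :: "plane \<Rightarrow> real" where
  "q2 w = a11 * (fst w)\<^sup>2 + a22 * (snd w)\<^sup>2 + 2 * a12 * fst w * snd w"

text \<open>Half the gradient of \<open>q\<close>. Together, \<open>(g p, h p)\<close> is the
  symmetric matrix of the conic applied to \<open>(p, 1)\<close>, that is, the polar line of
  \<open>p\<close>.\<close>

definition g :: "plane \<Rightarrow> plane" where
  "g p = (a11 * fst p + a12 * snd p + a1, a12 * fst p + a22 * snd p + a2)"

definition h :: "plane \<Rightarrow> real" where
  "h p = a1 * fst p + a2 * snd p + c"

definition \<Delta> :: real where
  "\<Delta> = a11 * a22 * c + 2 * a12 * a1 * a2 - a11 * a2\<^sup>2 - a22 * a1\<^sup>2 - c * a12\<^sup>2"

lemma \<Delta>_nonzero: "\<Delta> \<noteq> 0"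
  using disc by (simp add: \<Delta>_def)

lemma mem_quadratic: "p \<in> quadratic a11 a22 a12 a1 a2 c \<longleftrightarrow> q p = 0"
  by (cases p) (simp add: quadratic_def q_def)

lemma q_eq_g_h: "q p = g p \<bullet> p + h p"
  by (simp add: q_def g_def h_def inner_prod_def power2_eq_square algebra_simps)

lemma q_line: "q (p + s *\<^sub>R w) = q p + 2 * s * (g p \<bullet> w) + s\<^sup>2 * q2 w"
  by (simp add: q_def q2_def g_def inner_prod_def power2_eq_square algebra_simps)

lemma continuous_on_q: "continuous_on A q"
  unfolding q_def[abs_def] by (intro continuous_intros)

lemma continuous_on_g: "continuous_on A g"
  unfolding g_def[abs_def] by (intro continuous_intros)

text \<open>The argument of \<open>q2\<close> is the tangent direction at \<open>p\<close>. Thus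
  tangent directions of the conic are never null for \<open>q2\<close>; both the smoothness of the
  conic and the absence of lines in it come from this.\<close>

lemma q2_normal:
  assumes "q p = 0"
  shows "q2 (- snd (g p), fst (g p)) = - \<Delta>"
proof -
  have "q2 (- snd (g p), fst (g p)) = - \<Delta> + (a11 * a22 - a12\<^sup>2) * q p"
    by (simp add: q2_def q_def g_def \<Delta>_def power2_eq_square algebra_simps)
  with assms show ?thesis by simp
qed

lemma g_nonzero: "q p = 0 \<Longrightarrow> g p \<noteq> 0"
  using q2_normal[of p] \<Delta>_nonzero by (auto simp: q2_def)

text \<open>Along a line in the conic the linear and the quadratic coefficient of \<open>q\<close>
  vanish. So \<open>v\<close> is tangent, hence parallel to the turned gradient, and also null for
  \<open>q2\<close>, against \<open>q2_normal\<close>.\<close>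

lemma no_line_in_conic:
  assumes "v \<noteq> 0" "\<And>s. q (p + s *\<^sub>R v) = 0"
  shows False
proof -
  have p: "q p = 0" using assms(2)[of 0] by simp
  have "2 * (g p \<bullet> v) + q2 v = 0" "- (2 * (g p \<bullet> v)) + q2 v = 0"
    using assms(2)[of 1] assms(2)[of "-1"] p unfolding q_line by simp_all
  then have *: "g p \<bullet> v = 0" "q2 v = 0" by linarith+
  define n where "n = (- snd (g p), fst (g p))"
  have "(v \<bullet> v) *\<^sub>R n = (v \<bullet> n) *\<^sub>R v"
  proof -
    obtain v1 v2 g1 g2 where vg: "v = (v1, v2)" "g p = (g1, g2)" by (metis surj_pair)
    have "g1 * v1 + g2 * v2 = 0" using *(1) by (simp add: vg)
    then have "(v1 * v1 + v2 * v2) * - g2 = (v1 * - g2 + v2 * g1) * v1"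
      "(v1 * v1 + v2 * v2) * g1 = (v1 * - g2 + v2 * g1) * v2" by algebra+
    then show ?thesis unfolding n_def vg by simp
  qed
  then have "q2 ((v \<bullet> v) *\<^sub>R n) = q2 ((v \<bullet> n) *\<^sub>R v)" by simp
  moreover have scale: "q2 (s *\<^sub>R w) = s\<^sup>2 * q2 w" for s w
    by (simp add: q2_def power2_eq_square algebra_simps)
  ultimately have "(v \<bullet> v)\<^sup>2 * q2 n = 0" using *(2) by simp
  then show False using assms(1) q2_normal[OF p] \<Delta>_nonzero by (simp add: n_def)
qed

text \<open>The second point of intersection with the line through \<open>p\<close> whose direction is the tangent,
  tilted by \<open>e\<close> towards the normal. It is \<open>p\<close> itself if that line meets the conic at infinity.\<close>

definition rational_parametrization :: "plane \<Rightarrow> real \<Rightarrow> plane" where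
  "rational_parametrization p e =
     (let w = (- snd (g p), fst (g p)) + e *\<^sub>R g p in p - (2 * e * (g p \<bullet> g p) / q2 w) *\<^sub>R w)"

lemma q_rational_parametrization:
  assumes "q p = 0"
  shows "q (rational_parametrization p e) = 0"
proof -
  define w where "w = (- snd (g p), fst (g p)) + e *\<^sub>R g p"
  have gw: "g p \<bullet> w = e * (g p \<bullet> g p)" by (simp add: w_def inner_prod_def algebra_simps)
  define s where "s = - (2 * e * (g p \<bullet> g p) / q2 w)"
  have "rational_parametrization p e = p + s *\<^sub>R w"
    by (simp add: rational_parametrization_def Let_def w_def s_def)
  then have *: "q (rational_parametrization p e) = s * (2 * (g p \<bullet> w) + s * q2 w)"
    using assms by (simp add: q_line power2_eq_square algebra_simps)
  \<comment> \<open>If \<open>q2 w = 0\<close>, division by zero gives \<open>s = 0\<close>.\<close>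
  show ?thesis
    unfolding * using gw by (cases "q2 w = 0") (simp_all add: s_def)
qed

lemma rational_parametrization_limit:
  assumes "q p = 0"
  shows "\<forall>\<^sub>F e in at 0. q2 ((- snd (g p), fst (g p)) + e *\<^sub>R g p) \<noteq> 0"
    and "(rational_parametrization p \<longlongrightarrow> p) (at 0)"
proof -
  define w where "w e = (- snd (g p), fst (g p)) + e *\<^sub>R g p" for e
  have "((\<lambda>e. q2 (w e)) \<longlongrightarrow> q2 (w 0)) (at 0)"
    unfolding q2_def w_def by (intro tendsto_intros) 
  moreover have w0: "q2 (w 0) \<noteq> 0" using q2_normal[OF assms] \<Delta>_nonzero by (simp add: w_def)
  ultimately show "\<forall>\<^sub>F e in at 0. q2 ((- snd (g p), fst (g p)) + e *\<^sub>R g p) \<noteq> 0"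
    using tendsto_imp_eventually_ne unfolding w_def by blast
  have "((\<lambda>e. p - (2 * e * (g p \<bullet> g p) / q2 (w e)) *\<^sub>R w e) \<longlongrightarrow>
      p - (2 * 0 * (g p \<bullet> g p) / q2 (w 0)) *\<^sub>R w 0) (at 0)"
    using w0 unfolding q2_def w_def by (intro tendsto_intros) auto
  then show "(rational_parametrization p \<longlongrightarrow> p) (at 0)"
    unfolding rational_parametrization_def[abs_def] Let_def w_def
    by (simp add: zero_prod_def[symmetric])
qed

text \<open>The chord from \<open>p\<close> in the tilted direction
  \<open>n + e *\<^sub>R g p\<close> leaves the line through \<open>p\<close> normal to
  \<open>l\<close> unless \<open>l\<close> is orthogonal to that direction, which does not happen
  for small \<open>e \<noteq> 0\<close>. This serves to move a point of a conic off an exceptional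
  line.\<close>

lemma conic_not_locally_in_line:
  assumes p: "q p = 0" and l: "l \<noteq> 0" and U: "open U" "p \<in> U"
  shows "\<exists>z\<in>U. q z = 0 \<and> l \<bullet> z \<noteq> l \<bullet> p"
proof -
  define n where "n = (- snd (g p), fst (g p))"
  have G: "g p \<bullet> g p \<noteq> 0" using g_nonzero[OF p] by simp
  have "\<forall>\<^sub>F e in at 0. l \<bullet> (n + e *\<^sub>R g p) \<noteq> 0"
  proof (cases "l \<bullet> n = 0")
    case True
    have "l \<bullet> g p \<noteq> 0"
    proof
      assume "l \<bullet> g p = 0"
      then have *: "fst l * fst (g p) + snd l * snd (g p) = 0" "snd l * fst (g p) - fst l * snd (g p) = 0"
        using True by (simp_all add: n_def inner_prod_def)
      have "(g p \<bullet> g p) * fst l = 0" "(g p \<bullet> g p) * snd l = 0"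
        using * unfolding inner_prod_def inner_real_def by algebra+
      then show False using G l by (auto simp: prod_eq_iff)
    qed
    moreover have "\<forall>\<^sub>F e in at 0. e \<noteq> (0 :: real)" by (rule eventually_neq_at_within)
    ultimately show ?thesis using True by (simp add: inner_add_right)
  next
    case False
    have "((\<lambda>e. l \<bullet> (n + e *\<^sub>R g p)) \<longlongrightarrow> l \<bullet> (n + 0 *\<^sub>R g p)) (at 0)" by (intro tendsto_intros)
    then show ?thesis using False tendsto_imp_eventually_ne by fastforce
  qed
  moreover have "\<forall>\<^sub>F e in at 0. rational_parametrization p e \<in> U"
    using rational_parametrization_limit(2)[OF p] U topological_tendstoD by blast
  moreover have "\<forall>\<^sub>F e in at 0. e \<noteq> (0 :: real)" by (rule eventually_neq_at_within)
  ultimately have "\<forall>\<^sub>F e in at 0. l \<bullet> (n + e *\<^sub>R g p) \<noteq> 0 \<and> rational_parametrization p e \<in> U \<and>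
      e \<noteq> (0 :: real) \<and> q2 (n + e *\<^sub>R g p) \<noteq> 0"
    using rational_parametrization_limit(1)[OF p] unfolding n_def by eventually_elim simp
  then obtain e where e: "l \<bullet> (n + e *\<^sub>R g p) \<noteq> 0" "rational_parametrization p e \<in> U"
      "e \<noteq> 0" "q2 (n + e *\<^sub>R g p) \<noteq> 0"
    using eventually_happens[of _ "at (0 :: real)"] by fastforce
  have "l \<bullet> rational_parametrization p e \<noteq> l \<bullet> p"
    using e G by (simp add: rational_parametrization_def Let_def n_def[symmetric] inner_diff_right)
  then show ?thesis using e(2) q_rational_parametrization[OF p] by blast
qed

text \<open>Substituting the rational parametrization into the second equation gives a polynomial in
  \<open>e\<close> that vanishes for all but finitely many \<open>e\<close>. Its coefficients say,
  in the orthogonal frame of tangent and gradient at \<open>p\<close>, that the second equation is a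
  multiple of the first. Inclusion of the zero sets is enough for this.\<close>

lemma quadratic_coefficients_unique:
  assumes p: "q p = 0"
    and sub: "quadratic a11 a22 a12 a1 a2 c \<subseteq> quadratic a11' a22' a12' a1' a2' c'"
  shows "\<exists>l. a11' = l * a11 \<and> a22' = l * a22 \<and> a12' = l * a12 \<and> a1' = l * a1 \<and> a2' = l * a2 \<and> c' = l * c"
proof -
  define q' where "q' z = a11' * (fst z)\<^sup>2 + a22' * (snd z)\<^sup>2 + 2 * a12' * fst z * snd z
    + 2 * a1' * fst z + 2 * a2' * snd z + c'" for z
  have q': "q' z = 0" if "q z = 0" for z
    using sub mem_quadratic[of z] that by (cases z) (auto simp: quadratic_def q'_def)
  obtain x y where xy: "p = (x, y)" by (cases p)
  obtain g1 g2 where gp: "g p = (g1, g2)" by (cases "g p")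
  define h1 h2 where "h1 = a11' * x + a12' * y + a1'" and "h2 = a12' * x + a22' * y + a2'"
  define G where "G = g1\<^sup>2 + g2\<^sup>2"
  have G: "G \<noteq> 0" using g_nonzero[OF p] by (simp add: G_def gp sum_power2_eq_zero_iff zero_prod_def)
  \<comment> \<open>Entries of the two quadratic parts in the frame \<open>(- g2, g1)\<close>,
    \<open>(g1, g2)\<close>. Below, \<open>\<alpha>\<close> and \<open>\<beta>\<close> are the inner
    products of half the gradient of \<open>q'\<close> at \<open>p\<close> with the two frame
    vectors.\<close>
  define A where "A = a11 * g2\<^sup>2 + a22 * g1\<^sup>2 - 2 * a12 * g1 * g2"
  define B where "B = (a22 - a11) * g1 * g2 + a12 * (g1\<^sup>2 - g2\<^sup>2)"
  define C where "C = a11 * g1\<^sup>2 + a22 * g2\<^sup>2 + 2 * a12 * g1 * g2"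
  define A' where "A' = a11' * g2\<^sup>2 + a22' * g1\<^sup>2 - 2 * a12' * g1 * g2"
  define B' where "B' = (a22' - a11') * g1 * g2 + a12' * (g1\<^sup>2 - g2\<^sup>2)"
  define C' where "C' = a11' * g1\<^sup>2 + a22' * g2\<^sup>2 + 2 * a12' * g1 * g2"
  define \<alpha> where "\<alpha> = h2 * g1 - h1 * g2"
  define \<beta> where "\<beta> = h1 * g1 + h2 * g2"
  have A0: "A \<noteq> 0" using q2_normal[OF p] \<Delta>_nonzero by (simp add: q2_def gp A_def algebra_simps)
  define w where "w e = (- g2 + e * g1, g1 + e * g2)" for e
  have q2w: "q2 (w e) = A + 2 * B * e + C * e\<^sup>2" for e
    by (simp add: q2_def w_def A_def B_def C_def power2_eq_square algebra_simps)
  have fin: "finite {e. q2 (w e) = 0}"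
  proof -
    have "{e. q2 (w e) = 0} = {e. poly [:A, 2 * B, C:] e = 0}"
      by (simp add: q2w power2_eq_square algebra_simps)
    then show ?thesis using poly_roots_finite[of "[:A, 2 * B, C:]"] A0 by simp
  qed
  \<comment> \<open>\<open>q'\<close> at the parametrized point, divided by \<open>2 * s\<close> and
    multiplied by \<open>q2 (w e)\<close>.\<close>
  define P where "P = [:\<alpha>, \<beta>:] * [:A, 2 * B, C:] - [:0, G:] * [:A', 2 * B', C':]"
  have "poly P e = 0" if e: "q2 (w e) \<noteq> 0" "e \<noteq> 0" for e
  proof -
    define s where "s = - (2 * e * G / q2 (w e))"
    have s0: "s \<noteq> 0" using e G by (simp add: s_def)
    have "rational_parametrization p e = (x, y) + s *\<^sub>R w e"
      by (simp add: rational_parametrization_def Let_def xy[symmetric] gp w_def s_def G_def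
          power2_eq_square inner_prod_def)
    then have "q' ((x, y) + s *\<^sub>R w e) = 0" using q'[OF q_rational_parametrization[OF p]] by metis
    moreover have "q' ((x, y) + s *\<^sub>R w e) =
        q' (x, y) + s * (2 * (\<alpha> + \<beta> * e) + s * (A' + 2 * B' * e + C' * e\<^sup>2))"
      by (simp add: q'_def w_def \<alpha>_def \<beta>_def A'_def B'_def C'_def h1_def h2_def
          power2_eq_square algebra_simps)
    moreover have "q' (x, y) = 0" using q'[OF p] xy by simp
    ultimately have "2 * (\<alpha> + \<beta> * e) + s * (A' + 2 * B' * e + C' * e\<^sup>2) = 0" using s0 by simp
    then have "2 * (\<alpha> + \<beta> * e) * q2 (w e) + (s * q2 (w e)) * (A' + 2 * B' * e + C' * e\<^sup>2) = 0"
      by algebra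
    moreover have "s * q2 (w e) = - 2 * e * G" using e(1) by (simp add: s_def)
    ultimately have "(\<alpha> + \<beta> * e) * q2 (w e) = e * G * (A' + 2 * B' * e + C' * e\<^sup>2)" by algebra
    then show ?thesis
      unfolding P_def q2w by (simp add: power2_eq_square algebra_simps)
  qed
  then have "UNIV \<subseteq> {e. poly P e = 0} \<union> {e. q2 (w e) = 0} \<union> {0}" by blast
  then have "infinite {e. poly P e = 0}"
    using fin infinite_UNIV_char_0[where 'a = real] by (meson finite.simps finite_UnI finite_subset)
  then have "P = 0" using poly_roots_finite by blast
  then have co: "\<alpha> * A = 0" "\<alpha> * (2 * B) + \<beta> * A = G * A'" "\<alpha> * C + \<beta> * (2 * B) = G * (2 * B')"
      "\<beta> * C = G * C'"
    by (simp_all add: P_def algebra_simps)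
  define l where "l = \<beta> / G"
  have \<alpha>: "\<alpha> = 0" using co A0 by simp
  have ABC: "A' = l * A" "B' = l * B" "C' = l * C"
    using co G \<alpha> by (simp_all add: l_def field_simps)
  have "G * (h1 - l * g1) = 0" "G * (h2 - l * g2) = 0"
  proof -
    have lG: "l * G = \<beta>" using G by (simp add: l_def)
    have "G * (h1 - l * g1) = G * h1 - \<beta> * g1" "G * (h2 - l * g2) = G * h2 - \<beta> * g2"
      using lG by (simp_all add: algebra_simps)
    moreover have "G * h1 = \<beta> * g1" "G * h2 = \<beta> * g2"
      using \<alpha> unfolding G_def \<alpha>_def \<beta>_def by algebra+
    ultimately show "G * (h1 - l * g1) = 0" "G * (h2 - l * g2) = 0" by simp_all
  qed
  then have hg: "h1 = l * g1" "h2 = l * g2" using G by simp_all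
  \<comment> \<open>The difference of the quadratic parts vanishes in the frame; turning the frame
    back costs the factor \<open>G^2\<close>.\<close>
  define d11 d22 d12 where "d11 = a11' - l * a11" and "d22 = a22' - l * a22" and "d12 = a12' - l * a12"
  have d: "d11 * g2\<^sup>2 + d22 * g1\<^sup>2 - 2 * d12 * g1 * g2 = 0"
      "(d22 - d11) * g1 * g2 + d12 * (g1\<^sup>2 - g2\<^sup>2) = 0"
      "d11 * g1\<^sup>2 + d22 * g2\<^sup>2 + 2 * d12 * g1 * g2 = 0"
    using ABC unfolding A_def A'_def B_def B'_def C_def C'_def d11_def d22_def d12_def by algebra+
  have "G\<^sup>2 * d11 = 0" "G\<^sup>2 * d22 = 0" "G\<^sup>2 * d12 = 0"
    using d unfolding G_def by algebra+
  then have dd: "a11' = l * a11" "a22' = l * a22" "a12' = l * a12"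
    using G by (simp_all add: d11_def d22_def d12_def)
  have g12: "g1 = a11 * x + a12 * y + a1" "g2 = a12 * x + a22 * y + a2"
    using gp by (simp_all add: g_def xy)
  have aa: "a1' = l * a1" "a2' = l * a2"
    using hg dd unfolding h1_def h2_def g12 by algebra+
  have "c' = l * c"
    using q'[OF p] p dd aa unfolding q'_def q_def xy fst_conv snd_conv by algebra
  then show ?thesis using dd aa by blast
qed

text \<open>Minus the adjugate of the matrix of the conic, with the third coordinate reversed: \<open>d\<close> lies on
  the dual conic iff the line \<open>{z. z \<bullet> d = 1}\<close> is tangent to the conic, at infinity allowed.\<close>

definition "b11 = a2\<^sup>2 - a22 * c"
definition "b22 = a1\<^sup>2 - a11 * c"
definition "b12 = a12 * c - a1 * a2"
definition "b1 = a12 * a2 - a1 * a22"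
definition "b2 = a1 * a12 - a2 * a11"
definition "b = a12\<^sup>2 - a11 * a22"

lemmas b_defs = b11_def b22_def b12_def b1_def b2_def b_def

text \<open>The adjugate of a 3 by 3 matrix of determinant \<open>\<Delta>\<close> has determinant
  \<open>\<Delta>^2\<close>; the minus sign makes it \<open>- \<Delta>^2\<close>, and reversing one
  coordinate changes nothing.\<close>

lemma dual_conic: "conic b11 b22 b12 b1 b2 b"
proof
  have "b11 * b22 * b + 2 * b12 * b1 * b2 - b11 * b2\<^sup>2 - b22 * b1\<^sup>2 - b * b12\<^sup>2 = - \<Delta>\<^sup>2"
    by (simp add: b_defs \<Delta>_def power2_eq_square algebra_simps)
  then show "b11 * b22 * b + 2 * b12 * b1 * b2 - b11 * b2\<^sup>2 - b22 * b1\<^sup>2 - b * b12\<^sup>2 \<noteq> 0"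
    using \<Delta>_nonzero by simp
qed

text \<open>The foot of the perpendicular from the origin to the tangent line at \<open>z\<close>.\<close>

definition foot :: "plane \<Rightarrow> plane" where
  "foot z = (- h z / (g z \<bullet> g z)) *\<^sub>R g z"

lemma continuous_on_foot: "continuous_on (quadratic a11 a22 a12 a1 a2 c) foot"
  unfolding foot_def[abs_def] h_def[abs_def]
  by (intro continuous_intros continuous_on_g) (use g_nonzero mem_quadratic in auto)

end


section \<open>Primitives of frontals\<close>

lemma line_in_zeros:
  assumes "infinite {p \<in> zeros F. \<exists>s. p = s *\<^sub>R v}"
  shows "span {v} \<subseteq> zeros F"
proof -
  have "{p \<in> zeros F. \<exists>s. p = s *\<^sub>R v} \<subseteq> (\<lambda>s. s *\<^sub>R v) ` {s. ev F (0 + s *\<^sub>R v) = 0}"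
    by (auto simp: mem_zeros)
  then have "infinite {s. ev F (0 + s *\<^sub>R v) = 0}" using assms finite_surj by blast
  then have "ev F (s *\<^sub>R v) = 0" for s using ev_zero_on_line[of F 0 v s] by simp
  then show ?thesis by (auto simp: span_singleton mem_zeros)
qed

lemma sphere_through_origin: "p \<in> sphere z (norm z) \<longleftrightarrow> p \<bullet> p = 2 * (z \<bullet> p)" for p :: plane
proof -
  have "p \<in> sphere z (norm z) \<longleftrightarrow> (dist z p)\<^sup>2 = (norm z)\<^sup>2" by (simp add: power2_eq_iff_nonneg)
  also have "(dist z p)\<^sup>2 = (z - p) \<bullet> (z - p)" by (simp add: dist_norm power2_norm_eq_inner)
  also have "\<dots> = z \<bullet> z - 2 * (z \<bullet> p) + p \<bullet> p" by (simp add: inner_diff_left inner_diff_right inner_commute)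
  finally show ?thesis by (auto simp: power2_norm_eq_inner)
qed

text \<open>Inversion turns a circle through the origin into a line.\<close>

lemma circle_in_zeros:
  assumes "z \<noteq> 0" "(0, 0) \<in> zeros F" and inf: "infinite (zeros F \<inter> sphere z (norm z))"
  shows "sphere z (norm z) \<subseteq> zeros F"
proof
  let ?N = "inversion_numerator F"
  \<comment> \<open>The inverse of the circle is the line \<open>{w. z \<bullet> w = 1 / 2}\<close>,
    with direction \<open>v\<close> and with \<open>d\<close> as the foot of the perpendicular from
    the origin.\<close>
  define v where "v = (- snd z, fst z)"
  define d where "d = (1 / (2 * (z \<bullet> z))) *\<^sub>R z"
  have zz: "z \<bullet> z \<noteq> 0" using assms(1) by simp
  have on_line: "\<exists>s. \<Psi> p = d + s *\<^sub>R v" if "p \<in> sphere z (norm z)" "p \<noteq> 0" for p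
  proof
    have pp: "p \<bullet> p \<noteq> 0" using that by simp
    have "(z \<bullet> \<Psi> p) = 1 / 2"
      using that(1) pp unfolding sphere_through_origin \<Psi>_def by (simp add: field_simps)
    moreover have "w = ((z \<bullet> w) / (z \<bullet> z)) *\<^sub>R z + ((v \<bullet> w) / (z \<bullet> z)) *\<^sub>R v" for w
    proof -
      obtain z1 z2 w1 w2 where zw: "z = (z1, z2)" "w = (w1, w2)" by (metis surj_pair)
      have "(z \<bullet> z) *\<^sub>R w = (z \<bullet> w) *\<^sub>R z + (v \<bullet> w) *\<^sub>R v"
        by (simp add: zw v_def algebra_simps)
      then have "(1 / (z \<bullet> z)) *\<^sub>R ((z \<bullet> z) *\<^sub>R w) =
          (1 / (z \<bullet> z)) *\<^sub>R ((z \<bullet> w) *\<^sub>R z + (v \<bullet> w) *\<^sub>R v)" by simp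
      then show ?thesis using zz by (simp add: scaleR_add_right)
    qed
    ultimately show "\<Psi> p = d + ((v \<bullet> \<Psi> p) / (z \<bullet> z)) *\<^sub>R v"
      by (metis (no_types, lifting) d_def divide_divide_eq_left)
  qed
  have "infinite ((zeros F \<inter> sphere z (norm z)) - {0})" using inf by simp
  moreover have "(zeros F \<inter> sphere z (norm z)) - {0} \<subseteq> (\<lambda>s. \<Psi> (d + s *\<^sub>R v)) ` {s. ev ?N (d + s *\<^sub>R v) = 0}"
  proof
    fix p assume p: "p \<in> (zeros F \<inter> sphere z (norm z)) - {0}"
    then obtain s where s: "\<Psi> p = d + s *\<^sub>R v" using on_line by blast
    have "ev ?N (\<Psi> p) = 0" using ev_inversion_numerator[of "\<Psi> p" F] p by (simp add: mem_zeros)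
    then show "p \<in> (\<lambda>s. \<Psi> (d + s *\<^sub>R v)) ` {s. ev ?N (d + s *\<^sub>R v) = 0}"
      using s by (metis (mono_tags) \<Psi>_\<Psi> image_eqI mem_Collect_eq)
  qed
  ultimately have "infinite {s. ev ?N (d + s *\<^sub>R v) = 0}" using finite_surj by blast
  note N = ev_zero_on_line[OF this]
  fix p assume p: "p \<in> sphere z (norm z)"
  show "p \<in> zeros F"
  proof (cases "p = 0")
    case True
    then show ?thesis using assms(2) by (simp add: zero_prod_def)
  next
    case False
    then obtain s where s: "\<Psi> p = d + s *\<^sub>R v" using on_line p by blast
    then have "ev ?N (\<Psi> p) = 0" using N by simp
    moreover have "\<Psi> p \<bullet> \<Psi> p \<noteq> 0" using False by simp
    ultimately show ?thesis using ev_inversion_numerator[of "\<Psi> p" F] False by (simp add: mem_zeros)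
  qed
qed

lemma infinite_image_interval:
  fixes \<gamma> :: "real \<Rightarrow> plane"
  assumes "continuous_on {a<..<b} \<gamma>" "\<not> \<gamma> constant_on {a<..<b}"
  shows "infinite (\<gamma> ` {a<..<b})"
proof
  assume "finite (\<gamma> ` {a<..<b})"
  moreover have "connected (\<gamma> ` {a<..<b})" by (intro connected_continuous_image assms connected_Ioo)
  ultimately have "\<gamma> ` {a<..<b} = {} \<or> (\<exists>x. \<gamma> ` {a<..<b} = {x})" using connected_finite_iff_sing by blast
  then show False using assms(2) unfolding constant_on_def by blast
qed

text \<open>For the primitive \<open>z\<close>, differentiate
  \<open>z \<bullet> \<gamma> = \<gamma> \<bullet> \<gamma>\<close>. Since \<open>\<nu>\<close> is
  orthogonal to \<open>\<gamma>'\<close>, \<open>z \<bullet> \<gamma>'\<close> equals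
  \<open>2 * (\<gamma> \<bullet> \<gamma>')\<close>, so all terms with \<open>\<gamma>'\<close>
  cancel and \<open>z' \<bullet> \<gamma> = 0\<close> remains, also at singular parameters.\<close>

lemma frontal_pair_primitive:
  assumes "open I" and fp: "frontal_pair \<gamma> \<nu> I" and t: "t \<in> I" "\<gamma> t \<bullet> \<nu> t \<noteq> 0"
  shows "primitive \<gamma> \<nu> t \<bullet> \<gamma> t = \<gamma> t \<bullet> \<gamma> t"
    and "\<exists>v. (primitive \<gamma> \<nu> has_vector_derivative v) (at t) \<and> v \<bullet> \<gamma> t = 0"
proof -
  have eq: "primitive \<gamma> \<nu> s \<bullet> \<gamma> s = \<gamma> s \<bullet> \<gamma> s" if "\<gamma> s \<bullet> \<nu> s \<noteq> 0" for s
    using that by (simp add: primitive_def inner_diff_left power2_norm_eq_inner inner_commute[of "\<nu> s"])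
  then show "primitive \<gamma> \<nu> t \<bullet> \<gamma> t = \<gamma> t \<bullet> \<gamma> t" using t by blast
  have s\<gamma>: "smooth_on I \<gamma>" and s\<nu>: "smooth_on I \<nu>" using fp by (simp_all add: frontal_pair_def)
  have c: "continuous_on I (\<lambda>s. \<gamma> s \<bullet> \<nu> s)"
    by (intro continuous_intros smooth_on_imp_continuous_on s\<gamma> s\<nu>)
  define J where "J = I \<inter> (\<lambda>s. \<gamma> s \<bullet> \<nu> s) -` (- {0})"
  have J: "open J" "t \<in> J" "J \<subseteq> I"
    unfolding J_def using continuous_open_preimage[OF c \<open>open I\<close>, of "- {0}"] t by auto
  have "smooth_on J (\<lambda>s. 2 *\<^sub>R \<gamma> s - ((\<gamma> s \<bullet> \<gamma> s) / (\<gamma> s \<bullet> \<nu> s)) *\<^sub>R \<nu> s)"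
    using smooth_on_subset[OF s\<gamma> J(3)] smooth_on_subset[OF s\<nu> J(3)] J(1)
    by (intro smooth_intros) (auto simp: J_def)
  then have "smooth_on J (primitive \<gamma> \<nu>)"
    by (simp add: primitive_def[abs_def] power2_norm_eq_inner)
  from smooth_on_has_vector_derivative[OF this J(2)] obtain v
    where v: "(primitive \<gamma> \<nu> has_vector_derivative v) (at t)" by blast
  define u where "u = velocity \<gamma> t"
  have u: "(\<gamma> has_vector_derivative u) (at t)"
    unfolding u_def by (rule smooth_on_has_vector_derivative[OF s\<gamma> t(1)])
  have "((\<lambda>s. primitive \<gamma> \<nu> s \<bullet> \<gamma> s) has_vector_derivative primitive \<gamma> \<nu> t \<bullet> u + v \<bullet> \<gamma> t) (at t)"
    by (rule bounded_bilinear.has_vector_derivative[OF bounded_bilinear_inner v u])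
  moreover have "((\<lambda>s. primitive \<gamma> \<nu> s \<bullet> \<gamma> s) has_vector_derivative \<gamma> t \<bullet> u + u \<bullet> \<gamma> t) (at t)"
    by (rule has_vector_derivative_transform_within_open[OF
          bounded_bilinear.has_vector_derivative[OF bounded_bilinear_inner u u] J(1,2)])
      (use eq in \<open>auto simp: J_def\<close>)
  ultimately have "primitive \<gamma> \<nu> t \<bullet> u + v \<bullet> \<gamma> t = \<gamma> t \<bullet> u + u \<bullet> \<gamma> t"
    by (rule vector_derivative_unique_at)
  moreover have "primitive \<gamma> \<nu> t \<bullet> u = 2 * (\<gamma> t \<bullet> u)"
    using fp t(1) by (simp add: primitive_def inner_diff_left frontal_pair_def u_def inner_commute[of "\<nu> t"])
  ultimately have "v \<bullet> \<gamma> t = 0" by (simp add: inner_commute)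
  with v show "\<exists>v. (primitive \<gamma> \<nu> has_vector_derivative v) (at t) \<and> v \<bullet> \<gamma> t = 0" by blast
qed

lemma orthogonal_cross:
  assumes "u \<bullet> w = 0" "v \<bullet> w = 0" "w \<noteq> 0"
  shows "cross u v = 0"
proof -
  obtain u1 u2 v1 v2 w1 w2 where e: "u = (u1, u2)" "v = (v1, v2)" "w = (w1, w2)" by (metis surj_pair)
  have "u1 * w1 + u2 * w2 = 0" "v1 * w1 + v2 * w2 = 0" using assms(1,2) by (simp_all add: e)
  then have "(u1 * v2 - u2 * v1) * w1 = 0" "(u1 * v2 - u2 * v1) * w2 = 0" by algebra+
  then show ?thesis using assms(3) by (auto simp: e zero_prod_def)
qed

text \<open>A constant frontal may carry any unit normal, and as the normal varies the primitive
  sweeps out the whole line through \<open>x\<close> perpendicular to \<open>x\<close>.\<close>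

lemma isolated_point_primitives:
  assumes x: "x isolated_in S" "x \<noteq> 0"
  shows "x + s *\<^sub>R (- snd x, fst x) \<in> primitive_points S"
proof -
  obtain T where T: "open T" "T \<inter> S = {x}" and xS: "x \<in> S" using x(1) by (rule isolated_inE)
  let ?I = "{0 - 1<..<0 + 1 :: real}"
  \<comment> \<open>\<open>w\<close> is the wanted point reflected in \<open>x\<close>: for
    \<open>\<nu>\<close> along \<open>w\<close> the primitive is \<open>2 *\<^sub>R x - w\<close>,
    because \<open>x \<bullet> w = x \<bullet> x\<close>.\<close>
  define w where "w = x - s *\<^sub>R (- snd x, fst x)"
  have xw: "x \<bullet> w = x \<bullet> x" by (simp add: w_def inner_prod_def algebra_simps)
  then have w0: "w \<noteq> 0" using x(2) by auto
  define \<nu> where "\<nu> = (\<lambda>t :: real. (1 / norm w) *\<^sub>R w)"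
  have vel: "velocity (\<lambda>_. x) t = 0" for t :: real by simp
  have fp: "frontal_pair (\<lambda>_. x) \<nu> ?I"
    unfolding frontal_pair_def \<nu>_def using w0 by (auto intro!: smooth_intros)
  have "frontal_in S (\<lambda>_. x) ?I" unfolding frontal_in_def frontal_def using fp x(1) by blast
  then have lp: "local_parametrization (frontal_in S) S x T 1 (\<lambda>_ _. x) (\<lambda>_. 0) (\<lambda>_. 1)"
    using T xS by (intro local_parametrization_single) (auto simp: image_constant_conv)
  have "primitive (\<lambda>_. x) \<nu> 0 = 2 *\<^sub>R x - w"
    using xw x(2) w0 by (simp add: primitive_def \<nu>_def power2_norm_eq_inner)
  also have "\<dots> = x + s *\<^sub>R (- snd x, fst x)" by (simp add: w_def algebra_simps scaleR_2)
  finally have pr: "x + s *\<^sub>R (- snd x, fst x) = primitive (\<lambda>_. x) \<nu> 0" by simp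
  have "x \<bullet> \<nu> 0 \<noteq> 0" using xw x(2) w0 by (simp add: \<nu>_def)
  then show ?thesis
    unfolding primitive_points_def mem_Collect_eq using xS lp fp pr
    by (intro exI[of _ x] exI[of _ T] exI[of _ "1::nat"] exI[of _ "\<lambda>_ _. x"] exI[of _ "\<lambda>_. 0"]
        exI[of _ "\<lambda>_. 1"] exI[of _ "0::nat"] exI[of _ \<nu>] exI[of _ "0::real"]) simp
qed

section \<open>Feet of tangent lines and the inverse of the dual conic\<close>

context conic begin

text \<open>\<open>q\<close> after inversion with denominators cleared, so that it makes sense at
  the origin, where \<open>q2\<close> is its lowest order form.\<close>

definition Inv :: "plane \<Rightarrow> real" where
  "Inv p = c * (p \<bullet> p)\<^sup>2 + 2 * (a1 * fst p + a2 * snd p) * (p \<bullet> p) + q2 p"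

lemma Inv_eq: "p \<noteq> 0 \<Longrightarrow> Inv p = (p \<bullet> p)\<^sup>2 * q (\<Psi> p)"
  by (simp add: Inv_def q_def q2_def \<Psi>_simps field_simps power2_eq_square)

lemma Inv_0 [simp]: "Inv 0 = 0"
  by (simp add: Inv_def q2_def)

lemma continuous_on_Inv: "continuous_on A Inv"
  unfolding Inv_def[abs_def] q2_def by (intro continuous_intros)

interpretation dual: conic b11 b22 b12 b1 b2 b
  by (rule dual_conic)

text \<open>\<open>g z\<close> is a multiple of \<open>\<gamma>\<close>, so the tangent line at
  \<open>z\<close> is \<open>{w. w \<bullet> \<gamma> = \<gamma> \<bullet> \<gamma>}\<close>, and
  the dual conic contains \<open>\<Psi> \<gamma>\<close>.\<close>

lemma foot_eq:
  assumes q: "q z = 0" and cr: "cross (g z) \<gamma> = 0" and z: "z \<bullet> \<gamma> = \<gamma> \<bullet> \<gamma>" and "\<gamma> \<noteq> 0"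
  shows "dual.Inv \<gamma> = 0" "foot z = \<gamma>"
proof -
  have \<gamma>: "\<gamma> \<bullet> \<gamma> \<noteq> 0" using \<open>\<gamma> \<noteq> 0\<close> by simp
  obtain g1 g2 where gz: "g z = (g1, g2)" by (cases "g z")
  obtain x y where xy: "\<gamma> = (x, y)" by (cases \<gamma>)
  define \<mu> where "\<mu> = (g z \<bullet> \<gamma>) / (\<gamma> \<bullet> \<gamma>)"
  have "(g1 * x + g2 * y) * x = g1 * (x * x + y * y)" "(g1 * x + g2 * y) * y = g2 * (x * x + y * y)"
    using cr unfolding gz xy fst_conv snd_conv by algebra+
  then have "(g z \<bullet> \<gamma>) * x = g1 * (\<gamma> \<bullet> \<gamma>)" "(g z \<bullet> \<gamma>) * y = g2 * (\<gamma> \<bullet> \<gamma>)"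
    by (simp_all add: gz xy)
  then have "\<mu> * x = g1" "\<mu> * y = g2"
    unfolding \<mu>_def times_divide_eq_left using \<gamma> by simp_all
  then have g\<mu>: "g z = \<mu> *\<^sub>R \<gamma>" by (simp add: gz xy)
  then have \<mu>: "\<mu> \<noteq> 0" using g_nonzero[OF q] by auto
  have h: "h z = - \<mu> * (\<gamma> \<bullet> \<gamma>)"
    using q z unfolding q_eq_g_h g\<mu> by (simp add: inner_commute)
  show "foot z = \<gamma>" unfolding foot_def h g\<mu> using \<gamma> \<mu> by simp
  \<comment> \<open>The dual form at the tangent line \<open>(g z, - h z)\<close>: matrix, adjugate
    and matrix multiply to \<open>\<Delta>\<close> times the matrix, and the dual carries a minus
    sign.\<close>
  have "b * (h z)\<^sup>2 - 2 * (b1 * g1 + b2 * g2) * h z + b11 * g1\<^sup>2 + b22 * g2\<^sup>2 + 2 * b12 * g1 * g2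
      = - \<Delta> * q z"
    using gz by (auto simp: b_defs q_def g_def h_def \<Delta>_def power2_eq_square algebra_simps)
  then have "b * (\<mu> * (\<gamma> \<bullet> \<gamma>))\<^sup>2 + 2 * (b1 * (\<mu> * x) + b2 * (\<mu> * y)) * (\<mu> * (\<gamma> \<bullet> \<gamma>))
      + b11 * (\<mu> * x)\<^sup>2 + b22 * (\<mu> * y)\<^sup>2 + 2 * b12 * (\<mu> * x) * (\<mu> * y) = 0"
    using h g\<mu> q gz by (simp add: xy)
  then have "\<mu>\<^sup>2 * dual.Inv \<gamma> = 0"
    by (simp add: dual.Inv_def dual.q2_def xy power2_eq_square algebra_simps)
  then show "dual.Inv \<gamma> = 0" using \<mu> by simp
qed

text \<open>Polarity is inverted: \<open>z\<close> is the pole of the line with foot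
  \<open>\<gamma>\<close>. The last hypothesis says that its third homogeneous coordinate
  \<open>X3\<close> is not zero, that is, the point of tangency is not at infinity.\<close>

lemma foot_of_tangent:
  assumes D: "dual.Inv \<gamma> = 0" and "\<gamma> \<noteq> 0" and X: "b1 * fst \<gamma> + b2 * snd \<gamma> + b * (\<gamma> \<bullet> \<gamma>) \<noteq> 0"
  shows "\<exists>z. q z = 0 \<and> foot z = \<gamma>"
proof -
  obtain x y where xy: "\<gamma> = (x, y)" by (cases \<gamma>)
  define r where "r = x\<^sup>2 + y\<^sup>2"
  have \<gamma>r: "\<gamma> \<bullet> \<gamma> = r" by (simp add: xy r_def power2_eq_square)
  define X3 where "X3 = b1 * x + b2 * y + b * r"
  define z where "z = (- (b11 * x + b12 * y + b1 * r) / X3, - (b12 * x + b22 * y + b2 * r) / X3)"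
  have X3: "X3 \<noteq> 0" using X \<gamma>r by (simp add: X3_def xy)
  have zX: "fst z * X3 = - (b11 * x + b12 * y + b1 * r)" "snd z * X3 = - (b12 * x + b22 * y + b2 * r)"
    using X3 by (simp_all add: z_def)
  have "fst (g z) * X3 = \<Delta> * x" "snd (g z) * X3 = \<Delta> * y" "h z * X3 = - \<Delta> * r"
    using zX unfolding g_def h_def fst_conv snd_conv X3_def b_defs \<Delta>_def by algebra+
  then have "fst (g z) = \<Delta> / X3 * x" "snd (g z) = \<Delta> / X3 * y" and hX: "h z = - (\<Delta> / X3) * r"
    using X3 by (simp_all add: field_simps)
  then have gX: "g z = (\<Delta> / X3) *\<^sub>R \<gamma>" by (simp add: xy prod_eq_iff)
  have "dual.Inv \<gamma> = b * r\<^sup>2 + 2 * (b1 * x + b2 * y) * r + (b11 * x\<^sup>2 + b22 * y\<^sup>2 + 2 * b12 * x * y)"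
    by (simp add: dual.Inv_def dual.q2_def \<gamma>r) (simp add: xy)
  then have "(x * fst z + y * snd z) * X3 = r * X3 - dual.Inv \<gamma>"
    using zX unfolding X3_def by algebra
  then have "\<gamma> \<bullet> z = r" using D X3 by (simp add: xy inner_prod_def)
  then have "g z \<bullet> z + h z = 0" unfolding gX hX by simp
  then have "q z = 0" by (simp add: q_eq_g_h)
  moreover have "foot z = \<gamma>"
    unfolding foot_def gX hX using \<Delta>_nonzero X3 \<open>\<gamma> \<noteq> 0\<close> by (simp flip: \<gamma>r)
  ultimately show ?thesis by blast
qed

text \<open>Points of the inverse of the dual conic that are not feet of tangent lines come from the
  asymptotes of the conic; they are limits of feet.\<close>

lemma dual_inverse_subset_closed:
  assumes "closed K" and K: "\<And>z. q z = 0 \<Longrightarrow> foot z \<in> K" and D: "dual.Inv \<gamma> = 0" "\<gamma> \<noteq> 0"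
  shows "\<gamma> \<in> K"
proof (rule ccontr)
  assume "\<gamma> \<notin> K"
  define l where "l = (b1, b2)"
  \<comment> \<open>The points not known to be feet are those whose inverse lies on the line
    \<open>l \<bullet> d = - b\<close>. Arbitrarily near them the dual conic has points off this
    line, and those are inverses of feet.\<close>
  have X_eq: "b1 * fst p + b2 * snd p + b * (p \<bullet> p) = (p \<bullet> p) * (l \<bullet> \<Psi> p + b)" if "p \<noteq> 0" for p
  proof -
    have "l \<bullet> \<Psi> p = (l \<bullet> p) / (p \<bullet> p)" by (simp add: \<Psi>_def)
    then have "(p \<bullet> p) * (l \<bullet> \<Psi> p + b) = l \<bullet> p + b * (p \<bullet> p)"
      using that by (simp add: distrib_left)
    then show ?thesis by (simp add: l_def inner_prod_def)
  qed
  have inK: "p \<in> K" if "dual.Inv p = 0" "p \<noteq> 0" "l \<bullet> \<Psi> p \<noteq> - b" for p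
  proof -
    have "b1 * fst p + b2 * snd p + b * (p \<bullet> p) \<noteq> 0"
      unfolding X_eq[OF that(2)] using that by simp
    then show ?thesis using foot_of_tangent[OF that(1,2)] K by blast
  qed
  \<comment> \<open>\<open>b1 = b2 = b = 0\<close> would give the dual matrix a zero row.\<close>
  have l: "l \<noteq> 0 \<or> b \<noteq> 0"
    using dual.disc by (auto simp: l_def zero_prod_def)
  have lb: "l \<bullet> \<Psi> \<gamma> = - b" using inK D \<open>\<gamma> \<notin> K\<close> by blast
  then have l0: "l \<noteq> 0" using l by auto
  have "continuous_on (- {0}) \<Psi>" unfolding \<Psi>_def[abs_def] by (intro continuous_intros) auto
  then have U: "open (- {0} \<inter> \<Psi> -` (- K))"
    by (rule continuous_open_preimage) (use \<open>closed K\<close> in auto)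
  have "dual.q (\<Psi> \<gamma>) = 0" using dual.Inv_eq[OF D(2)] D by simp
  moreover have "\<Psi> \<gamma> \<in> - {0} \<inter> \<Psi> -` (- K)" using D(2) \<open>\<gamma> \<notin> K\<close> by simp
  ultimately obtain d where d: "d \<noteq> 0" "\<Psi> d \<notin> K" "dual.q d = 0" "l \<bullet> d \<noteq> l \<bullet> \<Psi> \<gamma>"
    using dual.conic_not_locally_in_line[OF _ l0 U] by blast
  have "dual.Inv (\<Psi> d) = 0" using dual.Inv_eq[of "\<Psi> d"] d by simp
  then show False using inK[of "\<Psi> d"] d lb by simp
qed

end

lemma primitive_pointsI:
  assumes "x \<in> S" "local_parametrization (frontal_in S) S x U n \<gamma> \<tau> \<epsilon>" "i < n"
    "t \<in> {\<tau> i - \<epsilon> i<..<\<tau> i + \<epsilon> i}" "frontal_pair (\<gamma> i) \<nu> {\<tau> i - \<epsilon> i<..<\<tau> i + \<epsilon> i}"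
    "\<gamma> i t \<bullet> \<nu> t \<noteq> 0"
  shows "primitive (\<gamma> i) \<nu> t \<in> primitive_points S"
  unfolding primitive_points_def using assms by blast

lemma primitive_pointsE:
  assumes "z \<in> primitive_points S"
  obtains x U n \<gamma> \<tau> \<epsilon> i \<nu> t where "z = primitive (\<gamma> i) \<nu> t"
    "x \<in> S" "local_parametrization (frontal_in S) S x U n \<gamma> \<tau> \<epsilon>" "i < n"
    "t \<in> {\<tau> i - \<epsilon> i<..<\<tau> i + \<epsilon> i}" "frontal_pair (\<gamma> i) \<nu> {\<tau> i - \<epsilon> i<..<\<tau> i + \<epsilon> i}"
    "\<gamma> i t \<bullet> \<nu> t \<noteq> 0"
  using assms unfolding primitive_points_def mem_Collect_eq by (elim exE conjE) (rule that)

lemma open_interval_subset: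
  fixes t :: real
  assumes "open J" "t \<in> J"
  obtains a b where "a < t" "t < b" "{a<..<b} \<subseteq> J"
proof -
  obtain e where "e > 0" "ball t e \<subseteq> J" using assms open_contains_ball by blast
  then show ?thesis by (intro that[of "t - e" "t + e"]) (auto simp: ball_eq_greaterThanLessThan)
qed

text \<open>\<open>f\<close> is the slope of \<open>\<gamma>\<close> relative to the axis
  \<open>\<gamma> t0\<close>; the numerator of its derivative is a multiple of
  \<open>cross (\<gamma> s) (v s)\<close>. The half plane condition keeps the denominator away from
  zero.\<close>

lemma radial_curve_on_line:
  fixes \<gamma> :: "real \<Rightarrow> plane"
  assumes ab: "a < t0" "t0 < b" and d: "\<And>t. t \<in> {a<..<b} \<Longrightarrow> (\<gamma> has_vector_derivative v t) (at t)"
    and cr: "\<And>t. t \<in> {a<..<b} \<Longrightarrow> cross (\<gamma> t) (v t) = 0"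
    and pos: "\<And>t. t \<in> {a<..<b} \<Longrightarrow> \<gamma> t0 \<bullet> \<gamma> t > 0" and t: "t \<in> {a<..<b}"
  shows "\<exists>s. \<gamma> t = s *\<^sub>R \<gamma> t0"
proof -
  obtain u1 u2 where u: "\<gamma> t0 = (u1, u2)" by (cases "\<gamma> t0")
  define n where "n = (- u2, u1)"
  define f where "f t = (n \<bullet> \<gamma> t) / (\<gamma> t0 \<bullet> \<gamma> t)" for t
  have "(f has_vector_derivative 0) (at s within {a<..<b})" if s: "s \<in> {a<..<b}" for s
  proof -
    have dd: "((\<lambda>s. w \<bullet> \<gamma> s) has_real_derivative w \<bullet> v s) (at s)" for w
      using bounded_linear.has_vector_derivative[OF bounded_linear_inner_right d[OF s], of w]
      by (simp add: has_real_derivative_iff_has_vector_derivative)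
    have "(n \<bullet> v s) * (\<gamma> t0 \<bullet> \<gamma> s) - (n \<bullet> \<gamma> s) * (\<gamma> t0 \<bullet> v s) = (u1\<^sup>2 + u2\<^sup>2) * cross (\<gamma> s) (v s)"
      by (simp add: n_def u inner_prod_def power2_eq_square algebra_simps)
    then have "(f has_real_derivative 0) (at s)"
      using DERIV_divide[OF dd[of n] dd[of "\<gamma> t0"]] pos[OF s] cr[OF s] by (simp add: f_def[abs_def])
    then show ?thesis
      using has_real_derivative_iff_has_vector_derivative has_vector_derivative_at_within by blast
  qed
  then obtain k where k: "\<And>s. s \<in> {a<..<b} \<Longrightarrow> f s = k"
    using has_vector_derivative_zero_constant[of "{a<..<b}" f] by auto
  have "n \<bullet> \<gamma> t0 = 0" by (simp add: n_def u)
  then have "f t = 0" using k[of t0] k[OF t] ab by (simp add: f_def)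
  then have n0: "n \<bullet> \<gamma> t = 0" using pos[OF t] by (simp add: f_def)
  obtain x y where xy: "\<gamma> t = (x, y)" by (cases "\<gamma> t")
  have e: "u1 * y - u2 * x = 0" using n0 by (simp add: n_def xy)
  have r: "u1 * u1 + u2 * u2 \<noteq> 0" using pos[of t0] ab by (auto simp: u)
  have "(u1 * u1 + u2 * u2) * x = (u1 * x + u2 * y) * u1" "(u1 * u1 + u2 * u2) * y = (u1 * x + u2 * y) * u2"
    using e by algebra+
  then have "\<gamma> t = ((u1 * x + u2 * y) / (u1 * u1 + u2 * u2)) *\<^sub>R \<gamma> t0"
    using r by (simp add: xy u nonzero_eq_divide_eq mult.commute)
  then show ?thesis by blast
qed


section \<open>Curves with conic primitive\<close>

locale conic_primitive = conic +
  fixes F :: "real poly poly"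
  assumes F: "F \<noteq> 0" and origin: "(0, 0) \<in> zeros F"
    and no_line: "\<And>v. v \<noteq> 0 \<Longrightarrow> \<not> span {v} \<subseteq> zeros F"
    and no_circle: "\<And>p. p \<noteq> 0 \<Longrightarrow> \<not> sphere p (norm p) \<subseteq> zeros F"
    and prim: "primitive_curve (zeros F) = quadratic a11 a22 a12 a1 a2 c"
    and nonempty: "quadratic a11 a22 a12 a1 a2 c \<noteq> {}"
begin

interpretation dual: conic b11 b22 b12 b1 b2 b
  by (rule dual_conic)

lemma primitive_point_on_conic: "z \<in> primitive_points (zeros F) \<Longrightarrow> q z = 0"
  using prim closure_subset unfolding primitive_curve_def mem_quadratic[symmetric] by blast

text \<open>A nonzero isolated point would put a whole line on the conic.\<close>

lemma isolated_point_zero: "x isolated_in zeros F \<Longrightarrow> x = 0"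
  using isolated_point_primitives[of x "zeros F"] primitive_point_on_conic
    no_line_in_conic[of "(- snd x, fst x)" x] by (cases x) (auto simp: zero_prod_def)

text \<open>If \<open>g z\<close> and \<open>\<gamma>\<close> are independent at one parameter, they
  are so on an interval. There \<open>z'\<close> is orthogonal to both, so \<open>z\<close> is
  constant and \<open>\<gamma>\<close> runs on the circle with diameter from the origin to
  \<open>z\<close>. Either \<open>\<gamma>\<close> rests, or it traces infinitely many points of
  that circle, so that the circle lies in the curve; both are excluded.\<close>

lemma primitive_conormal:
  assumes lp: "x \<in> zeros F" "local_parametrization (frontal_in (zeros F)) (zeros F) x U n \<gamma>s \<tau> \<epsilon>" "i < n"
    and t: "t \<in> {\<tau> i - \<epsilon> i<..<\<tau> i + \<epsilon> i}"
    and fp: "frontal_pair (\<gamma>s i) \<nu> {\<tau> i - \<epsilon> i<..<\<tau> i + \<epsilon> i}"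
    and nz: "\<gamma>s i t \<bullet> \<nu> t \<noteq> 0"
  shows "cross (g (primitive (\<gamma>s i) \<nu> t)) (\<gamma>s i t) = 0"
proof (rule ccontr)
  assume neg: "cross (g (primitive (\<gamma>s i) \<nu> t)) (\<gamma>s i t) \<noteq> 0"
  define \<gamma> where "\<gamma> = \<gamma>s i"
  define z where "z = primitive \<gamma> \<nu>"
  define I where "I = {\<tau> i - \<epsilon> i<..<\<tau> i + \<epsilon> i}"
  have oI: "open I" by (simp add: I_def)
  have fp: "frontal_pair \<gamma> \<nu> I" using fp by (simp add: I_def \<gamma>_def)
  then have s\<gamma>: "smooth_on I \<gamma>" and s\<nu>: "smooth_on I \<nu>" by (simp_all add: frontal_pair_def)
  have c\<gamma>: "continuous_on I \<gamma>" and c\<nu>: "continuous_on I \<nu>"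
    using s\<gamma> s\<nu> smooth_on_imp_continuous_on by blast+
  have zq: "q (z s) = 0" if "s \<in> I" "\<gamma> s \<bullet> \<nu> s \<noteq> 0" for s
    unfolding z_def \<gamma>_def using primitive_point_on_conic primitive_pointsI[OF lp, of s \<nu>] that fp
    by (simp add: I_def \<gamma>_def)
  have inS: "\<gamma> s \<in> zeros F" if "s \<in> I" for s
    using lp(2,3) that unfolding local_parametrization_def I_def \<gamma>_def by blast
  define J1 where "J1 = I \<inter> (\<lambda>s. \<gamma> s \<bullet> \<nu> s) -` (- {0})"
  have "continuous_on I (\<lambda>s. \<gamma> s \<bullet> \<nu> s)" by (intro continuous_intros c\<gamma> c\<nu>)
  then have J1: "open J1" "J1 \<subseteq> I" unfolding J1_def
    using continuous_open_preimage[OF _ oI, of _ "- {0}"] by auto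
  have cz: "continuous_on J1 z"
  proof (rule continuous_at_imp_continuous_on, rule ballI)
    fix s assume "s \<in> J1"
    then obtain v where "(z has_vector_derivative v) (at s)"
      using frontal_pair_primitive(2)[OF oI fp] unfolding J1_def z_def by blast
    then show "isCont z s" by (rule has_vector_derivative_continuous)
  qed
  define J where "J = J1 \<inter> (\<lambda>s. cross (g (z s)) (\<gamma> s)) -` (- {0})"
  have "continuous_on J1 (\<lambda>s. g (z s))"
    by (rule continuous_on_compose2[OF continuous_on_g[of UNIV] cz]) simp
  then have "open J" unfolding J_def
    by (intro continuous_open_preimage J1 continuous_intros continuous_on_subset[OF c\<gamma>]) auto
  moreover have "t \<in> J" using t nz neg by (simp add: J_def J1_def I_def \<gamma>_def z_def)
  ultimately obtain a b where ab: "a < t" "t < b" "{a<..<b} \<subseteq> J"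
    by (rule open_interval_subset)
  have sub: "s \<in> I" "\<gamma> s \<bullet> \<nu> s \<noteq> 0" "cross (g (z s)) (\<gamma> s) \<noteq> 0" if "s \<in> {a<..<b}" for s
    using ab(3) that by (auto simp: J_def J1_def)
  have "(z has_vector_derivative 0) (at s)" if s: "s \<in> {a<..<b}" for s
  proof -
    obtain v where v: "(z has_vector_derivative v) (at s)" "v \<bullet> \<gamma> s = 0"
      using frontal_pair_primitive(2)[OF oI fp sub(1,2)[OF s]] unfolding z_def by blast
    have dq: "(q has_derivative (\<lambda>w. 2 * (g p \<bullet> w))) (at p)" for p
      unfolding q_def[abs_def] by (auto intro!: derivative_eq_intros
          simp: g_def inner_prod_def power2_eq_square algebra_simps)
    have "((\<lambda>s. q (z s)) has_vector_derivative 2 * (g (z s) \<bullet> v)) (at s)"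
      by (rule has_derivative_along_curve[OF dq v(1)])
    moreover have "((\<lambda>s. q (z s)) has_vector_derivative 0) (at s)"
      by (rule has_vector_derivative_transform_within_open[OF has_vector_derivative_const
            open_greaterThanLessThan s]) (simp add: zq[OF sub(1,2)])
    ultimately have "2 * (g (z s) \<bullet> v) = 0" by (rule vector_derivative_unique_at)
    then have "g (z s) \<bullet> v = 0" by simp
    moreover have "\<gamma> s \<bullet> v = 0" using v(2) by (subst inner_commute)
    ultimately have "v = 0" using orthogonal_cross[of "g (z s)" v "\<gamma> s"] sub(3)[OF s] by blast
    then show ?thesis using v(1) by simp
  qed
  then have "(z has_vector_derivative 0) (at s within {a<..<b})" if "s \<in> {a<..<b}" for s
    using that has_vector_derivative_at_within by blast
  then obtain z0 where z0: "\<And>s. s \<in> {a<..<b} \<Longrightarrow> z s = z0"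
    using has_vector_derivative_zero_constant[of "{a<..<b}" z] by auto
  have circ: "\<gamma> s \<bullet> \<gamma> s = z0 \<bullet> \<gamma> s" if "s \<in> {a<..<b}" for s
    using frontal_pair_primitive(1)[OF oI fp sub(1,2)[OF that]] z0[OF that] by (simp add: z_def)
  show False
  proof (cases "\<gamma> constant_on {a<..<b}")
    case True
    have "frontal_in (zeros F) \<gamma> I" using lp(2,3) by (simp add: local_parametrization_def I_def \<gamma>_def)
    moreover have "{a<..<b} \<subseteq> I" using sub(1) by blast
    moreover have "a < b" "t \<in> {a<..<b}" using ab(1,2) by auto
    ultimately have "\<gamma> t isolated_in zeros F" using True unfolding frontal_in_def by blast
    then have "\<gamma> t = 0" by (rule isolated_point_zero)
    then show False using nz by (simp add: \<gamma>_def)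
  next
    case False
    define m where "m = (1 / 2) *\<^sub>R z0"
    have cont: "continuous_on {a<..<b} \<gamma>" using continuous_on_subset[OF c\<gamma>] sub(1) by blast
    have "\<gamma> ` {a<..<b} \<subseteq> zeros F \<inter> sphere m (norm m)"
    proof (intro image_subsetI IntI)
      fix s assume s: "s \<in> {a<..<b}"
      show "\<gamma> s \<in> zeros F" using inS sub(1)[OF s] .
      show "\<gamma> s \<in> sphere m (norm m)"
        unfolding sphere_through_origin using circ[OF s] by (simp add: m_def)
    qed
    then have inf: "infinite (zeros F \<inter> sphere m (norm m))"
      using infinite_image_interval[OF cont False] finite_subset by blast
    have "\<gamma> t \<noteq> 0" using nz by (auto simp: \<gamma>_def)
    then have "z0 \<noteq> 0" using circ[of t] ab by auto
    then have "m \<noteq> 0" by (simp add: m_def)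
    then show False using circle_in_zeros[OF _ origin inf] no_circle by blast
  qed
qed

lemma foot_of_primitive:
  assumes lp: "x \<in> zeros F" "local_parametrization (frontal_in (zeros F)) (zeros F) x U n \<gamma>s \<tau> \<epsilon>" "i < n"
    and t: "t \<in> {\<tau> i - \<epsilon> i<..<\<tau> i + \<epsilon> i}"
    and fp: "frontal_pair (\<gamma>s i) \<nu> {\<tau> i - \<epsilon> i<..<\<tau> i + \<epsilon> i}"
    and nz: "\<gamma>s i t \<bullet> \<nu> t \<noteq> 0"
  shows "dual.Inv (\<gamma>s i t) = 0" "foot (primitive (\<gamma>s i) \<nu> t) = \<gamma>s i t"
proof -
  have "q (primitive (\<gamma>s i) \<nu> t) = 0"
    using primitive_point_on_conic primitive_pointsI[OF lp t fp nz] .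
  moreover have "primitive (\<gamma>s i) \<nu> t \<bullet> \<gamma>s i t = \<gamma>s i t \<bullet> \<gamma>s i t"
    by (rule frontal_pair_primitive(1)[OF open_greaterThanLessThan fp t nz])
  moreover have "\<gamma>s i t \<noteq> 0" using nz by auto
  ultimately show "dual.Inv (\<gamma>s i t) = 0" "foot (primitive (\<gamma>s i) \<nu> t) = \<gamma>s i t"
    using foot_eq primitive_conormal[OF assms] by blast+
qed

text \<open>What is needed is a parameter near that of \<open>x\<close> with
  \<open>\<gamma> \<bullet> \<nu> \<noteq> 0\<close>. If there were none, \<open>\<gamma>\<close>
  and \<open>\<gamma>'\<close> would both be orthogonal to \<open>\<nu>\<close>, so the arc would be
  radial, and a polynomial that vanishes on infinitely many points of a line vanishes on all of
  it.\<close>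

lemma regular_point_near_dual_inverse:
  assumes x: "regular_point (zeros F) x" "x \<noteq> 0" and U: "open U" "x \<in> U"
  shows "\<exists>y\<in>U. dual.Inv y = 0 \<and> y \<noteq> 0"
proof -
  obtain W \<gamma>s \<tau> \<epsilon> where xS: "x \<in> zeros F"
    and lp: "local_parametrization regular_arc (zeros F) x W 1 \<gamma>s \<tau> \<epsilon>"
    using x(1) unfolding regular_point_def by blast
  define I where "I = {\<tau> 0 - \<epsilon> 0<..<\<tau> 0 + \<epsilon> (0::nat)}"
  define \<gamma> where "\<gamma> = \<gamma>s 0"
  have I0: "\<epsilon> 0 > 0" "regular_arc \<gamma> I" "\<gamma> (\<tau> 0) = x" and img: "\<gamma> ` I = W \<inter> zeros F"
    using lp by (auto simp: local_parametrization_def I_def \<gamma>_def)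
  have \<tau>: "\<tau> 0 \<in> I" using I0(1) by (simp add: I_def)
  have oI: "open I" by (simp add: I_def)
  have reg: "regular \<gamma> I" using I0(2) by (simp add: regular_arc_def)
  then have s\<gamma>: "smooth_on I \<gamma>" and vel: "\<And>t. t \<in> I \<Longrightarrow> velocity \<gamma> t \<noteq> 0" by (auto simp: regular_def)
  have inj: "inj_on \<gamma> I"
    using I0(2) unfolding regular_arc_def homeomorphism_def by (metis inj_on_inverseI)
  have d: "(\<gamma> has_vector_derivative velocity \<gamma> t) (at t)" if "t \<in> I" for t
    by (rule smooth_on_has_vector_derivative[OF s\<gamma> that])
  obtain \<nu> where fp: "frontal_pair \<gamma> \<nu> I"
    using regular_imp_front[OF oI reg] unfolding front_def by blast
  \<comment> \<open>An injective arc never rests, so it is admissible for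
    \<open>frontal_in\<close>.\<close>
  have nconst: "\<not> \<gamma> constant_on {a<..<b}" if "a < b" "{a<..<b} \<subseteq> I" for a b
  proof
    assume "\<gamma> constant_on {a<..<b}"
    moreover have "(2 * a + b) / 3 \<in> {a<..<b}" "(a + 2 * b) / 3 \<in> {a<..<b}" using that(1) by auto
    ultimately have "\<gamma> ((2 * a + b) / 3) = \<gamma> ((a + 2 * b) / 3)" unfolding constant_on_def by metis
    moreover have "(2 * a + b) / 3 \<in> I" "(a + 2 * b) / 3 \<in> I"
      using that \<open>(2 * a + b) / 3 \<in> {a<..<b}\<close> \<open>(a + 2 * b) / 3 \<in> {a<..<b}\<close> by blast+
    ultimately have "(2 * a + b) / 3 = (a + 2 * b) / 3" using inj by (metis inj_onD)
    then show False using that(1) by simp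
  qed
  then have "frontal_in (zeros F) \<gamma> I" unfolding frontal_in_def frontal_def using fp by blast
  then have lp': "local_parametrization (frontal_in (zeros F)) (zeros F) x W 1 \<gamma>s \<tau> \<epsilon>"
    using lp by (simp add: local_parametrization_def I_def \<gamma>_def)
  \<comment> \<open>The half plane around \<open>x\<close> avoids the origin and keeps the radial
    slope well defined.\<close>
  define J where "J = I \<inter> \<gamma> -` (U \<inter> {p. x \<bullet> p > 0})"
  have "open J" unfolding J_def
    by (intro continuous_open_preimage smooth_on_imp_continuous_on[OF s\<gamma>] oI open_Int U(1)
        open_Collect_less continuous_intros)
  moreover have "\<tau> 0 \<in> J" using \<tau> U(2) I0(3) x(2) by (simp add: J_def)
  ultimately obtain a b where ab: "a < \<tau> 0" "\<tau> 0 < b" "{a<..<b} \<subseteq> J"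
    by (rule open_interval_subset)
  have sub: "s \<in> I" "\<gamma> s \<in> U" "x \<bullet> \<gamma> s > 0" if "s \<in> {a<..<b}" for s
    using ab(3) that by (auto simp: J_def)
  have "\<exists>t\<in>{a<..<b}. \<gamma> t \<bullet> \<nu> t \<noteq> 0"
  proof (rule ccontr)
    assume "\<not> ?thesis"
    then have "cross (\<gamma> t) (velocity \<gamma> t) = 0" if "t \<in> {a<..<b}" for t
      using fp sub(1)[OF that] that
      by (intro orthogonal_cross[where w = "\<nu> t"]) (auto simp: frontal_pair_def)
    then have line: "\<exists>s. \<gamma> t = s *\<^sub>R x" if "t \<in> {a<..<b}" for t
      using radial_curve_on_line[of a "\<tau> 0" b \<gamma> "velocity \<gamma>" t] ab d sub I0(3) that by auto
    have "{a<..<b} \<subseteq> I" using sub(1) by blast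
    then have "infinite (\<gamma> ` {a<..<b})"
      using infinite_image_interval[of a b \<gamma>] nconst[of a b] ab
        continuous_on_subset[OF smooth_on_imp_continuous_on[OF s\<gamma>]] by auto
    moreover have "\<gamma> ` {a<..<b} \<subseteq> {p \<in> zeros F. \<exists>s. p = s *\<^sub>R x}"
      using line img \<open>{a<..<b} \<subseteq> I\<close> by blast
    ultimately have "infinite {p \<in> zeros F. \<exists>s. p = s *\<^sub>R x}" using finite_subset by blast
    then show False using line_in_zeros no_line[OF x(2)] by blast
  qed
  then obtain t where t: "t \<in> {a<..<b}" "\<gamma> t \<bullet> \<nu> t \<noteq> 0" by blast
  have "dual.Inv (\<gamma> t) = 0"
    using foot_of_primitive(1)[OF xS lp', of 0 t \<nu>] t sub(1)[OF t(1)] fp by (simp add: I_def \<gamma>_def)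
  then show ?thesis using sub(2)[OF t(1)] t(2) by (intro bexI[of _ "\<gamma> t"]) auto
qed

text \<open>From left to right: away from the origin regular points are dense, and each is a limit
  of points of the dual inverse, which is closed. From right to left: \<open>foot\<close> is
  continuous on the conic and maps the primitive points into the closed set \<open>zeros F\<close>,
  hence also their closure, which is the whole conic.\<close>

theorem zeros_eq_dual_inverse: "zeros F = {p. dual.Inv p = 0}"
proof (intro equalityI subsetI)
  fix p assume p: "p \<in> zeros F"
  show "p \<in> {p. dual.Inv p = 0}"
  proof (rule ccontr)
    assume "p \<notin> {p. dual.Inv p = 0}"
    then have "dual.Inv p \<noteq> 0" "p \<noteq> 0" by auto
    define U where "U = {p. dual.Inv p \<noteq> 0} \<inter> - {0}"
    have "open U" unfolding U_def
      by (intro open_Int open_Collect_neq dual.continuous_on_Inv continuous_intros)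
    moreover have "p \<in> U" using \<open>dual.Inv p \<noteq> 0\<close> \<open>p \<noteq> 0\<close> by (simp add: U_def)
    ultimately obtain y where y: "y \<in> U" "y \<in> zeros F" "y isolated_in zeros F \<or> regular_point (zeros F) y"
      using regular_or_isolated_points_dense[OF F _ _ p] by blast
    have "y \<noteq> 0" using y(1) by (simp add: U_def)
    then have "regular_point (zeros F) y" using y(3) isolated_point_zero by blast
    then obtain y' where "y' \<in> U" "dual.Inv y' = 0"
      using regular_point_near_dual_inverse \<open>y \<noteq> 0\<close> \<open>open U\<close> y(1) by blast
    then show False by (simp add: U_def)
  qed
next
  fix p assume p: "p \<in> {p. dual.Inv p = 0}"
  have "foot z \<in> zeros F" if "z \<in> primitive_points (zeros F)" for z
  proof -
    obtain x U n \<gamma>s \<tau> \<epsilon> i \<nu> t where z: "z = primitive (\<gamma>s i) \<nu> t"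
      and a: "x \<in> zeros F" "local_parametrization (frontal_in (zeros F)) (zeros F) x U n \<gamma>s \<tau> \<epsilon>"
        "i < n" "t \<in> {\<tau> i - \<epsilon> i<..<\<tau> i + \<epsilon> i}"
        "frontal_pair (\<gamma>s i) \<nu> {\<tau> i - \<epsilon> i<..<\<tau> i + \<epsilon> i}" "\<gamma>s i t \<bullet> \<nu> t \<noteq> 0"
      using \<open>z \<in> primitive_points (zeros F)\<close> by (rule primitive_pointsE)
    have "\<gamma>s i t \<in> zeros F" using a(2,3,4) unfolding local_parametrization_def by blast
    then show ?thesis using foot_of_primitive(2)[OF a] z by simp
  qed
  then have "foot ` primitive_points (zeros F) \<subseteq> zeros F" by blast
  moreover have "continuous_on (closure (primitive_points (zeros F))) foot"
    using continuous_on_foot prim by (simp add: primitive_curve_def)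
  ultimately have "foot ` closure (primitive_points (zeros F)) \<subseteq> zeros F"
    by (intro image_closure_subset closed_zeros)
  then have "foot z \<in> zeros F" if "q z = 0" for z
    using that prim unfolding primitive_curve_def mem_quadratic[symmetric] by blast
  then show "p \<in> zeros F"
    using dual_inverse_subset_closed[OF closed_zeros, of F p] p origin
    by (cases "p = 0") (auto simp: zero_prod_def)
qed

lemma dual_conic_nonempty: "\<exists>d. d \<noteq> 0 \<and> dual.q d = 0"
proof -
  have "primitive_points (zeros F) \<noteq> {}"
  proof
    assume "primitive_points (zeros F) = {}"
    then show False using nonempty prim by (simp add: primitive_curve_def)
  qed
  then obtain z where "z \<in> primitive_points (zeros F)" by blast
  then obtain x U n \<gamma>s \<tau> \<epsilon> i \<nu> t where
    a: "x \<in> zeros F" "local_parametrization (frontal_in (zeros F)) (zeros F) x U n \<gamma>s \<tau> \<epsilon>"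
      "i < n" "t \<in> {\<tau> i - \<epsilon> i<..<\<tau> i + \<epsilon> i}"
      "frontal_pair (\<gamma>s i) \<nu> {\<tau> i - \<epsilon> i<..<\<tau> i + \<epsilon> i}" "\<gamma>s i t \<bullet> \<nu> t \<noteq> 0"
    by (rule primitive_pointsE)
  then have "\<gamma>s i t \<noteq> 0" "dual.Inv (\<gamma>s i t) = 0" using foot_of_primitive(1)[OF a] by auto
  then show ?thesis using dual.Inv_eq[of "\<gamma>s i t"] by (intro exI[of _ "\<Psi> (\<gamma>s i t)"]) auto
qed

end

lemma cusp_curve_eq: "{(t\<^sup>2, t^3) | t :: real. True} = {(X, Y). Y\<^sup>2 = X^3}"
proof (intro equalityI subsetI)
  fix p :: plane assume "p \<in> {(X, Y). Y\<^sup>2 = X^3}"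
  then obtain X Y where p: "p = (X, Y)" "Y\<^sup>2 = X^3" by auto
  show "p \<in> {(t\<^sup>2, t^3) | t :: real. True}"
  proof (cases "X = 0")
    case True
    then show ?thesis using p by (auto intro!: exI[of _ 0])
  next
    case False
    have "(Y / X)\<^sup>2 = X" "(Y / X)^3 = Y"
      using False p(2) by (simp_all add: field_simps power2_eq_square power3_eq_cube)
    then show ?thesis using p(1) by (auto intro!: exI[of _ "Y / X"])
  qed
qed (auto simp flip: power_mult)


section \<open>The inverse of a conic near the origin\<close>

text \<open>A curve through the origin in the frame of \<open>w\<close> and its normal:
  \<open>x\<close> is the abscissa and \<open>m x\<close> the slope of the secant from the
  origin.\<close>

definition branch :: "plane \<Rightarrow> (real \<Rightarrow> real) \<Rightarrow> real \<Rightarrow> plane" where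
  "branch w m x = x *\<^sub>R (w + m x *\<^sub>R (- snd w, fst w))"

lemma islimpt_direction:
  fixes x :: plane
  assumes "x islimpt T"
  shows "\<exists>p v. norm v = 1 \<and> (\<forall>k. p k \<in> T - {x}) \<and> p \<longlonglongrightarrow> x \<and>
    (\<lambda>k. (1 / norm (p k - x)) *\<^sub>R (p k - x)) \<longlonglongrightarrow> v"
proof -
  obtain p where p: "\<And>k :: nat. p k \<in> T - {x}" "p \<longlonglongrightarrow> x"
    using assms unfolding islimpt_sequential by blast
  define u where "u k = (1 / norm (p k - x)) *\<^sub>R (p k - x)" for k
  have "u k \<in> sphere 0 1" for k using p(1)[of k] by (simp add: u_def)
  then obtain v r where v: "v \<in> sphere 0 1" "strict_mono (r :: nat \<Rightarrow> nat)" "(u \<circ> r) \<longlonglongrightarrow> v"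
    using compact_sphere[of "0 :: plane" 1] unfolding compact_def by metis
  show ?thesis
    by (rule exI[of _ "p \<circ> r"], rule exI[of _ v])
      (use v p LIMSEQ_subseq_LIMSEQ[OF p(2) v(2)] in \<open>auto simp: u_def o_def\<close>)
qed

context conic begin

lemma smooth_on_q: "open U \<Longrightarrow> smooth_on U q"
  unfolding q_def[abs_def] by (intro smooth_intros)

lemma smooth_on_\<Psi>: "open U \<Longrightarrow> 0 \<notin> U \<Longrightarrow> smooth_on U \<Psi>"
  unfolding \<Psi>_def[abs_def] by (intro smooth_intros) auto

lemma q_has_derivative: "(q has_derivative (\<lambda>w. 2 * (g p \<bullet> w))) (at p)"
  unfolding q_def[abs_def]
  by (auto intro!: derivative_eq_intros simp: g_def inner_prod_def power2_eq_square algebra_simps)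

text \<open>Away from the origin the equation \<open>q (\<Psi> p) = 0\<close> replaces
  \<open>Inv p = 0\<close>. Since \<open>\<Psi>\<close> is an involution, the chain rule along
  \<open>\<Psi> (d + s *\<^sub>R w)\<close> with \<open>w = g d\<close> gives the derivative the
  nonzero value \<open>2 * (w \<bullet> w)\<close>.\<close>

lemma Inv_regular_point:
  assumes p: "Inv p = 0" "p \<noteq> 0"
  shows "regular_point {p. Inv p = 0} p" "regular_point ({p. Inv p = 0} - {0}) p"
proof -
  have U: "open (- {0 :: plane})" by auto
  define H where "H p = q (\<Psi> p)" for p
  have sH: "smooth_on (- {0}) H"
    unfolding H_def by (rule smooth_on_compose_plane[OF U open_UNIV subset_UNIV smooth_on_q smooth_on_\<Psi>]) auto
  have lev: "Inv x = 0 \<longleftrightarrow> H x = 0" if "x \<in> - {0}" for x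
    using Inv_eq[of x] that by (simp add: H_def)
  have dH: "(H has_derivative frechet_derivative H (at p)) (at p)"
    using smooth_on_has_derivative[OF sH] p(2) by simp
  define d where "d = \<Psi> p"
  define w where "w = g d"
  have d0: "d \<in> - {0}" using p(2) by (simp add: d_def)
  have "((\<lambda>s. d + s *\<^sub>R w) has_vector_derivative w) (at 0)"
    by (auto intro!: derivative_eq_intros)
  then have 1: "((\<lambda>s. \<Psi> (d + s *\<^sub>R w)) has_vector_derivative frechet_derivative \<Psi> (at d) w) (at 0)"
    using has_derivative_along_curve[where f = \<Psi> and \<gamma> = "\<lambda>s. d + s *\<^sub>R w" and t = 0 and v = w]
      smooth_on_has_derivative[OF smooth_on_\<Psi>[OF U] d0] by simp
  have "((\<lambda>s. H (\<Psi> (d + s *\<^sub>R w))) has_vector_derivative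
      frechet_derivative H (at p) (frechet_derivative \<Psi> (at d) w)) (at 0)"
    by (rule has_derivative_along_curve[OF _ 1]) (use dH in \<open>simp add: d_def\<close>)
  moreover have "((\<lambda>s. H (\<Psi> (d + s *\<^sub>R w))) has_vector_derivative 2 * (g d \<bullet> w)) (at 0)"
    unfolding H_def \<Psi>_\<Psi>
    using has_derivative_along_curve[OF q_has_derivative, where \<gamma> = "\<lambda>s. d + s *\<^sub>R w" and t = 0 and v = w]
      \<open>((\<lambda>s. d + s *\<^sub>R w) has_vector_derivative w) (at 0)\<close> by simp
  ultimately have "frechet_derivative H (at p) (frechet_derivative \<Psi> (at d) w) = 2 * (w \<bullet> w)"
    unfolding w_def by (rule vector_derivative_unique_at)
  moreover have "q d = 0" using lev[of p] p by (simp add: d_def H_def)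
  then have "w \<noteq> 0" unfolding w_def by (rule g_nonzero)
  ultimately have nz: "frechet_derivative H (at p) (frechet_derivative \<Psi> (at d) w) \<noteq> 0" by simp
  have Hp: "H p = 0" using lev[of p] p by simp
  have pU: "p \<in> - {0}" using p by simp
  show "regular_point {p. Inv p = 0} p" "regular_point ({p. Inv p = 0} - {0}) p"
    using lev by (auto intro!: regular_point_level_set[OF U sH pU Hp dH nz])
qed

lemma q2_scale: "q2 (s *\<^sub>R w) = s\<^sup>2 * q2 w"
  by (simp add: q2_def power2_eq_square algebra_simps)

text \<open>After multiplication of \<open>Inv (p n) = 0\<close> by \<open>(k n)^2\<close> the
  quadratic part converges to \<open>q2 v\<close>, while the terms of order three and four still
  carry a factor that tends to zero.\<close>

lemma tangent_direction_null:
  assumes "tangent_direction {p. Inv p = 0} 0 v"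
  shows "q2 v = 0"
proof -
  obtain p :: "nat \<Rightarrow> plane" and k where p: "\<And>n. Inv (p n) = 0" "p \<longlonglongrightarrow> 0" "(\<lambda>n. k n *\<^sub>R p n) \<longlonglongrightarrow> v"
    using assms unfolding tangent_direction_def by auto
  define u where "u n = k n *\<^sub>R p n" for n
  have u: "u \<longlonglongrightarrow> v" using p(3) unfolding u_def[abs_def] .
  have eq: "q2 (u n) = - ((u n \<bullet> u n) * (c * (p n \<bullet> p n) + 2 * (a1 * fst (p n) + a2 * snd (p n))))" for n
  proof -
    have "(k n)\<^sup>2 * Inv (p n) = 0" using p(1) by simp
    then show ?thesis unfolding Inv_def u_def q2_scale by (simp add: power2_eq_square algebra_simps)
  qed
  have "(\<lambda>n. - ((u n \<bullet> u n) * (c * (p n \<bullet> p n) + 2 * (a1 * fst (p n) + a2 * snd (p n)))))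
      \<longlonglongrightarrow> - ((v \<bullet> v) * (c * (0 \<bullet> (0 :: plane)) + 2 * (a1 * fst (0 :: plane) + a2 * snd (0 :: plane))))"
    by (intro tendsto_intros u p(2))
  moreover have "(\<lambda>n. q2 (u n)) \<longlonglongrightarrow> q2 v" unfolding q2_def by (intro tendsto_intros u)
  ultimately show ?thesis unfolding eq using LIMSEQ_unique by fastforce
qed

text \<open>If the origin were not isolated, compactness of the unit circle would give a unit
  tangent direction; it is null for \<open>q2\<close>, but \<open>q2\<close> is definite.\<close>

lemma isolated_origin:
  assumes "a12\<^sup>2 < a11 * a22"
  shows "0 isolated_in {p. Inv p = 0}"
proof (rule ccontr)
  assume "\<not> ?thesis"
  then have "0 islimpt {p. Inv p = 0}" by (simp add: isolated_in_islimpt_iff)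
  from islimpt_direction[OF this] obtain p v where p: "norm v = 1" "\<And>k. p k \<in> {p. Inv p = 0} - {0}"
    "p \<longlonglongrightarrow> 0" "(\<lambda>k. (1 / norm (p k - 0)) *\<^sub>R (p k - 0)) \<longlonglongrightarrow> v" by blast
  have "v \<noteq> 0" using p(1) by auto
  then have "tangent_direction {p. Inv p = 0} 0 v"
    unfolding tangent_direction_def using p by (intro conjI exI[of _ p] exI[of _ "\<lambda>k. 1 / norm (p k - 0)"]) auto
  then have v: "q2 v = 0" by (rule tangent_direction_null)
  have "a11 * q2 v = (a11 * fst v + a12 * snd v)\<^sup>2 + (a11 * a22 - a12\<^sup>2) * (snd v)\<^sup>2"
    by (simp add: q2_def power2_eq_square algebra_simps)
  moreover have "(a11 * a22 - a12\<^sup>2) * (snd v)\<^sup>2 \<ge> 0" using assms by simp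
  moreover have "(a11 * fst v + a12 * snd v)\<^sup>2 \<ge> 0" by simp
  ultimately have "(a11 * a22 - a12\<^sup>2) * (snd v)\<^sup>2 = 0" "(a11 * fst v + a12 * snd v)\<^sup>2 = 0"
    unfolding v by linarith+
  then have "snd v = 0" "a11 * fst v = 0" using assms by auto
  moreover have "a11 \<noteq> 0"
  proof
    assume "a11 = 0"
    then show False using assms zero_le_power2[of a12] by simp
  qed
  ultimately show False using \<open>v \<noteq> 0\<close> by (simp add: prod_eq_iff)
qed

section \<open>The indefinite case: two branches and a node\<close>

definition bil :: "plane \<Rightarrow> plane \<Rightarrow> real" where
  "bil u w = a11 * fst u * fst w + a12 * (fst u * snd w + snd u * fst w) + a22 * snd u * snd w"

lemma q2_add: "q2 (u + s *\<^sub>R w) = q2 u + 2 * s * bil u w + s\<^sup>2 * q2 w"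
  by (simp add: q2_def bil_def power2_eq_square algebra_simps)

text \<open>\<open>w\<close> and its normal span the plane, so a zero would put \<open>w\<close>
  into the radical of \<open>q2\<close>, which is trivial. This value is the transversal derivative
  in \<open>null_branch\<close>.\<close>

lemma bil_normal_nonzero:
  assumes d: "a12\<^sup>2 > a11 * a22" and w: "w \<noteq> 0" "q2 w = 0"
  shows "bil w (- snd w, fst w) \<noteq> 0"
proof
  assume *: "bil w (- snd w, fst w) = 0"
  obtain x y where xy: "w = (x, y)" by (cases w)
  have e: "a11 * x\<^sup>2 + a22 * y\<^sup>2 + 2 * a12 * x * y = 0" "- a11 * x * y + a12 * (x\<^sup>2 - y\<^sup>2) + a22 * x * y = 0"
    using * w by (simp_all add: xy q2_def bil_def power2_eq_square algebra_simps)
  then have "(x\<^sup>2 + y\<^sup>2) * (a11 * x + a12 * y) = 0" "(x\<^sup>2 + y\<^sup>2) * (a12 * x + a22 * y) = 0" by algebra+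
  moreover have "x\<^sup>2 + y\<^sup>2 \<noteq> 0" using w by (simp add: xy sum_power2_eq_zero_iff zero_prod_def)
  ultimately have "a11 * x + a12 * y = 0" "a12 * x + a22 * y = 0" by (metis mult_eq_0_iff)+
  then have "(a12\<^sup>2 - a11 * a22) * x = 0" "(a12\<^sup>2 - a11 * a22) * y = 0" by algebra+
  then show False using d w by (simp add: xy zero_prod_def)
qed

text \<open>On the line \<open>y = m x\<close> (in the frame of a null direction \<open>w\<close> and its normal) \<open>Inv\<close> is
  \<open>x\<^sup>2\<close> times a function that vanishes to first order at \<open>x = m = 0\<close>.\<close>

lemma null_branch:
  assumes d: "a12\<^sup>2 > a11 * a22" and w: "w \<noteq> 0" "q2 w = 0"
  obtains e \<delta> m where "e > 0" "\<delta> > 0" "smooth_on {-e<..<e} m" "m 0 = 0"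
    "\<And>x. \<bar>x\<bar> < e \<Longrightarrow> Inv (branch w m x) = 0"
    "\<And>x y. \<bar>x\<bar> < e \<Longrightarrow> x \<noteq> 0 \<Longrightarrow> \<bar>y\<bar> < \<delta> \<Longrightarrow> Inv (x *\<^sub>R (w + y *\<^sub>R (- snd w, fst w))) = 0 \<Longrightarrow> y = m x"
proof -
  define n where "n = (- snd w, fst w)"
  \<comment> \<open>The blow-up of the origin: \<open>Inv (x *\<^sub>R (w + y *\<^sub>R n))\<close>
    divided by \<open>x^2\<close>, a polynomial in \<open>x\<close> and \<open>y\<close> whose
    constant term \<open>q2 w\<close> is zero.\<close>
  define K where "K p = c * (fst p)\<^sup>2 * ((w \<bullet> w) * (1 + (snd p)\<^sup>2))\<^sup>2
    + 2 * fst p * (a1 * (fst w + snd p * fst n) + a2 * (snd w + snd p * snd n)) * ((w \<bullet> w) * (1 + (snd p)\<^sup>2))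
    + (2 * snd p * bil w n + (snd p)\<^sup>2 * q2 n)" for p :: plane
  have K: "Inv (x *\<^sub>R (w + y *\<^sub>R n)) = x\<^sup>2 * K (x, y)" for x y
  proof -
    have uu: "(w + y *\<^sub>R n) \<bullet> (w + y *\<^sub>R n) = (w \<bullet> w) * (1 + y\<^sup>2)"
      by (simp add: n_def inner_prod_def power2_eq_square algebra_simps)
    have xu: "(x *\<^sub>R u) \<bullet> (x *\<^sub>R u) = x\<^sup>2 * (u \<bullet> u)" for u :: plane
      by (simp add: power2_eq_square)
    show ?thesis
      unfolding Inv_def q2_scale q2_add w(2) xu uu K_def fst_scaleR snd_scaleR fst_add snd_add
        fst_conv snd_conv real_scaleR_def by algebra
  qed
  have sK: "smooth_on UNIV K" unfolding K_def by (intro smooth_intros) auto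
  have dK: "(K has_derivative frechet_derivative K (at (0, 0))) (at (0, 0))"
    by (rule smooth_on_has_derivative[OF sK]) simp
  have "((\<lambda>s. (0, s)) has_vector_derivative (0, 1)) (at 0)" by (auto intro!: derivative_eq_intros)
  from has_derivative_along_curve[OF dK this]
  have "((\<lambda>s. K (0, s)) has_vector_derivative frechet_derivative K (at (0, 0)) (0, 1)) (at 0)" .
  moreover have "((\<lambda>s. K (0, s)) has_real_derivative 2 * bil w n) (at 0)"
    unfolding K_def by (auto intro!: derivative_eq_intros)
  ultimately have "frechet_derivative K (at (0, 0)) (0, 1) = 2 * bil w n"
    unfolding has_real_derivative_iff_has_vector_derivative by (rule vector_derivative_unique_at)
  then have nz: "frechet_derivative K (at (0, 0)) (0, 1) \<noteq> 0"
    using bil_normal_nonzero[OF d w] by (simp add: n_def)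
  have K0: "K (0, 0) = 0" by (simp add: K_def)
  obtain e \<delta> m where *: "e > 0" "\<delta> > 0" "smooth_on {-e<..<e} m" "m 0 = 0"
    "\<And>x. \<bar>x\<bar> < e \<Longrightarrow> \<bar>m x\<bar> < \<delta>" "\<And>x y. \<bar>x\<bar> < e \<Longrightarrow> \<bar>y\<bar> < \<delta> \<Longrightarrow> K (x, y) = 0 \<longleftrightarrow> y = m x"
    by (rule smooth_implicit_function[OF sK K0 dK nz]) blast
  show ?thesis
    by (rule that[of e \<delta> m]) (use * K in \<open>auto simp: branch_def n_def[symmetric]\<close>)
qed

end

lemma cross_zero_parallel:
  assumes "cross u v = 0" "u \<noteq> 0"
  shows "\<exists>s. v = s *\<^sub>R u"
proof -
  obtain u1 u2 v1 v2 where e: "u = (u1, u2)" "v = (v1, v2)" by (metis surj_pair)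
  have r: "u1 * u1 + u2 * u2 \<noteq> 0" using assms(2) by (simp add: e zero_prod_def)
  have "u1 * v2 - u2 * v1 = 0" using assms(1) by (simp add: e)
  then have "(u1 * u1 + u2 * u2) * v1 = (u1 * v1 + u2 * v2) * u1" "(u1 * u1 + u2 * u2) * v2 = (u1 * v1 + u2 * v2) * u2"
    by algebra+
  then have "v = ((u1 * v1 + u2 * v2) / (u1 * u1 + u2 * u2)) *\<^sub>R u"
    using r by (simp add: e nonzero_eq_divide_eq mult.commute)
  then show ?thesis by blast
qed

lemma collinear_iff_cross: "collinear {0, u, v} \<longleftrightarrow> cross u v = 0"
proof
  assume "collinear {0, u, v}"
  then have "u = 0 \<or> v = 0 \<or> (\<exists>c. v = c *\<^sub>R u)" by (simp add: collinear_lemma)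
  then show "cross u v = 0" by auto
next
  assume "cross u v = 0"
  then show "collinear {0, u, v}" using cross_zero_parallel by (metis collinear_lemma)
qed

lemma branch_coordinates: "branch w m x \<bullet> w = x * (w \<bullet> w)"
  by (simp add: branch_def inner_prod_def algebra_simps)

lemma branch_0 [simp]: "branch w m 0 = 0"
  by (simp add: branch_def)

text \<open>The component along \<open>w\<close> is linear in the parameter; this gives both the
  nonzero velocity and a continuous inverse.\<close>

lemma branch_regular_arc:
  assumes m: "smooth_on {-e<..<e} m" and w: "w \<noteq> 0" and h: "h \<le> e"
  shows "regular_arc (branch w m) {-h<..<h}"
proof -
  let ?I = "{-h<..<h}" and ?n = "(- snd w, fst w)"
  have m: "smooth_on ?I m" by (rule smooth_on_subset[OF m]) (use h in auto)
  have s: "smooth_on ?I (branch w m)" unfolding branch_def[abs_def] by (intro smooth_intros m) auto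
  have "velocity (branch w m) t \<noteq> 0" if "t \<in> ?I" for t
  proof
    assume *: "velocity (branch w m) t = 0"
    have "((\<lambda>x. branch w m x \<bullet> w) has_vector_derivative velocity (branch w m) t \<bullet> w) (at t)"
      by (rule bounded_linear.has_vector_derivative[OF bounded_linear_inner_left smooth_on_has_vector_derivative[OF s that]])
    moreover have "((\<lambda>x. branch w m x \<bullet> w) has_vector_derivative w \<bullet> w) (at t)"
      unfolding branch_coordinates by (auto intro!: derivative_eq_intros simp: has_real_derivative_iff_has_vector_derivative[symmetric])
    ultimately have "w \<bullet> w = 0" using * vector_derivative_unique_at by fastforce
    then show False using w by simp
  qed
  moreover have "homeomorphism ?I (branch w m ` ?I) (branch w m) (\<lambda>p. (p \<bullet> w) / (w \<bullet> w))"
  proof (rule homeomorphismI)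
    show "continuous_on ?I (branch w m)" by (rule smooth_on_imp_continuous_on[OF s])
    show "continuous_on (branch w m ` ?I) (\<lambda>p. (p \<bullet> w) / (w \<bullet> w))"
      using w by (intro continuous_intros) auto
  qed (use w in \<open>auto simp: branch_coordinates\<close>)
  ultimately show ?thesis unfolding regular_arc_def regular_def using s by blast
qed

lemma branch_velocity:
  assumes m: "smooth_on {-e<..<e} m" and e: "e > 0" and m0: "m 0 = 0"
  shows "velocity (branch w m) 0 = w"
proof -
  have m': "(m has_vector_derivative vector_derivative m (at 0)) (at 0)"
    using e by (intro smooth_on_has_vector_derivative[OF m]) simp
  have "((\<lambda>x. m x *\<^sub>R (- snd w, fst w)) has_vector_derivative vector_derivative m (at 0) *\<^sub>R (- snd w, fst w)) (at 0)"
    using bounded_linear.has_vector_derivative[OF bounded_linear_scaleR_left m'] .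
  then have "((\<lambda>x. w + m x *\<^sub>R (- snd w, fst w)) has_vector_derivative
      0 + vector_derivative m (at 0) *\<^sub>R (- snd w, fst w)) (at 0)"
    by (intro has_vector_derivative_add has_vector_derivative_const)
  from has_vector_derivative_scaleR[OF DERIV_ident this]
  have "(branch w m has_vector_derivative w) (at 0)"
    unfolding branch_def[abs_def] by (simp add: m0 zero_prod_def[symmetric])
  then show ?thesis by (rule vector_derivative_at)
qed

text \<open>The union of the arcs must be exactly \<open>U \<inter> S\<close>. The arcs over
  \<open>{-h<..<h}\<close> cover \<open>S\<close> near \<open>x\<close> but may leave the
  neighbourhood, so they are shortened to \<open>\<epsilon>\<close>, and the compact images of the
  remaining parameters are removed from the neighbourhood. Injectivity and \<open>meet\<close>
  ensure that this takes nothing from the short arcs.\<close>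

lemma local_parametrization_two_arcs:
  fixes \<gamma> :: "nat \<Rightarrow> real \<Rightarrow> plane"
  assumes arc: "\<And>i. i < 2 \<Longrightarrow> regular_arc (\<gamma> i) {-e<..<e}" and e: "e > 0" and \<gamma>0: "\<And>i. i < 2 \<Longrightarrow> \<gamma> i 0 = x"
    and S: "\<And>i t. i < 2 \<Longrightarrow> \<bar>t\<bar> < e \<Longrightarrow> \<gamma> i t \<in> S"
    and meet: "\<And>s t. \<bar>s\<bar> < e \<Longrightarrow> \<bar>t\<bar> < e \<Longrightarrow> \<gamma> 0 s = \<gamma> 1 t \<Longrightarrow> s = 0 \<and> t = 0"
    and cover: "\<And>h. 0 < h \<Longrightarrow> h < e \<Longrightarrow> \<exists>W. open W \<and> x \<in> W \<and> W \<inter> S \<subseteq> \<gamma> 0 ` {-h<..<h} \<union> \<gamma> 1 ` {-h<..<h}"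
  shows "\<exists>U \<epsilon>. local_parametrization regular_arc S x U 2 \<gamma> (\<lambda>_. 0) (\<lambda>_. \<epsilon>)"
proof -
  define h where "h = e / 2"
  have h: "0 < h" "h < e" using e by (auto simp: h_def)
  obtain W where W: "open W" "x \<in> W" "W \<inter> S \<subseteq> \<gamma> 0 ` {-h<..<h} \<union> \<gamma> 1 ` {-h<..<h}"
    using cover[OF h] by blast
  have c: "continuous_on {-e<..<e} (\<gamma> i)" if "i < 2" for i
    using arc[OF that] unfolding regular_arc_def homeomorphism_def by blast
  have inj: "inj_on (\<gamma> i) {-e<..<e}" if "i < 2" for i
    using arc[OF that] unfolding regular_arc_def homeomorphism_def by (metis inj_on_inverseI)
  have "\<exists>d>0. \<forall>t. \<bar>t\<bar> < d \<longrightarrow> \<gamma> i t \<in> W" if i: "i < 2" for i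
  proof -
    have "open ({-e<..<e} \<inter> \<gamma> i -` W)" by (rule continuous_open_preimage[OF c[OF i] _ W(1)]) simp
    moreover have "0 \<in> {-e<..<e} \<inter> \<gamma> i -` W" using e \<gamma>0[OF i] W(2) by simp
    ultimately obtain d where "d > 0" "ball 0 d \<subseteq> {-e<..<e} \<inter> \<gamma> i -` W"
      unfolding open_contains_ball by blast
    then show ?thesis by (intro exI[of _ d]) (auto simp: subset_eq dist_real_def)
  qed
  then obtain d where d: "\<And>i. i < 2 \<Longrightarrow> d i > 0" "\<And>i t. i < 2 \<Longrightarrow> \<bar>t\<bar> < d i \<Longrightarrow> \<gamma> i t \<in> W" by metis
  define \<epsilon> where "\<epsilon> = min h (min (d 0) (d 1))"
  have \<epsilon>: "0 < \<epsilon>" "\<epsilon> \<le> h" using h d by (auto simp: \<epsilon>_def)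
  have \<epsilon>W: "\<gamma> i t \<in> W" if "i < 2" "\<bar>t\<bar> < \<epsilon>" for i t
  proof -
    have "i = 0 \<or> i = 1" using that(1) by auto
    then show ?thesis using d(2)[of i t] that by (auto simp: \<epsilon>_def)
  qed
  define A where "A = {-h..-\<epsilon>} \<union> {\<epsilon>..h}"
  have A: "compact A" "A \<subseteq> {-e<..<e}" "0 \<notin> A" using \<epsilon> h by (auto simp: A_def intro!: compact_Un)
  define U where "U = W - (\<gamma> 0 ` A \<union> \<gamma> 1 ` A)"
  have "closed (\<gamma> i ` A)" if "i < 2" for i
    by (intro compact_imp_closed compact_continuous_image A continuous_on_subset[OF c[OF that]])
  then have oU: "open U" unfolding U_def using W(1) by (intro open_Diff closed_Un) auto
  have notA: "\<gamma> i t \<notin> \<gamma> j ` A" if i: "i < 2" "j < 2" "\<bar>t\<bar> < \<epsilon>" for i j t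
  proof
    assume "\<gamma> i t \<in> \<gamma> j ` A"
    then obtain s where s: "s \<in> A" "\<gamma> i t = \<gamma> j s" by blast
    have se: "\<bar>s\<bar> < e" "s \<noteq> 0" "t \<noteq> s" "s \<in> {-e<..<e}" using s(1) A(2,3) i(3) \<epsilon>(1) h(2) by (auto simp: A_def)
    have te: "\<bar>t\<bar> < e" "t \<in> {-e<..<e}" using i(3) \<epsilon> h by auto
    show False
    proof (cases "i = j")
      case True
      then show False using inj_onD[OF inj[OF i(1)] _ te(2) se(4)] s(2) se(3) by simp
    next
      case False
      then have "i = 0 \<and> j = 1 \<or> i = 1 \<and> j = 0" using i by auto
      then show False using meet[OF te(1) se(1)] meet[OF se(1) te(1)] s(2) se(2) by auto
    qed
  qed
  have xU: "x \<in> U"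
    using W(2) notA[of 0 0 0] notA[of 0 1 0] \<epsilon>(1) \<gamma>0[of 0] by (auto simp: U_def)
  have "(\<Union>i<2. \<gamma> i ` {-\<epsilon><..<\<epsilon>}) = U \<inter> S"
  proof (intro equalityI subsetI)
    fix p assume "p \<in> (\<Union>i<2. \<gamma> i ` {-\<epsilon><..<\<epsilon>})"
    then obtain i t where it: "i < 2" "t \<in> {-\<epsilon><..<\<epsilon>}" "p = \<gamma> i t" by blast
    then have it: "i < 2" "\<bar>t\<bar> < \<epsilon>" "p = \<gamma> i t" by auto
    then show "p \<in> U \<inter> S"
      using \<epsilon>W[OF it(1,2)] notA[OF it(1) _ it(2), of 0] notA[OF it(1) _ it(2), of 1] S[OF it(1)] \<epsilon> h
      by (auto simp: U_def)
  next
    fix p assume p: "p \<in> U \<inter> S"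
    then have "p \<in> \<gamma> 0 ` {-h<..<h} \<union> \<gamma> 1 ` {-h<..<h}" using W(3) by (auto simp: U_def)
    then obtain i t where it: "i < 2" "t \<in> {-h<..<h}" "p = \<gamma> i t" by (metis UnE imageE one_less_numeral_iff pos2 semiring_norm(76))
    have "i = 0 \<or> i = 1" using it(1) by auto
    then have "t \<notin> A" using p it(3) by (auto simp: U_def)
    then have "t \<in> {-\<epsilon><..<\<epsilon>}" using it(2) by (auto simp: A_def)
    then show "p \<in> (\<Union>i<2. \<gamma> i ` {-\<epsilon><..<\<epsilon>})" using it by blast
  qed
  moreover have "regular_arc (\<gamma> i) {-\<epsilon><..<\<epsilon>}" if i: "i < 2" for i
  proof -
    have sub: "{-\<epsilon><..<\<epsilon>} \<subseteq> {-e<..<e}" using \<epsilon> h by auto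
    obtain g where g: "homeomorphism {-e<..<e} (\<gamma> i ` {-e<..<e}) (\<gamma> i) g" and r: "regular (\<gamma> i) {-e<..<e}"
      using arc[OF i] unfolding regular_arc_def by blast
    have "homeomorphism {-\<epsilon><..<\<epsilon>} (\<gamma> i ` {-\<epsilon><..<\<epsilon>}) (\<gamma> i) g"
      by (rule homeomorphism_of_subsets[OF g sub]) auto
    moreover have "regular (\<gamma> i) {-\<epsilon><..<\<epsilon>}"
      using r sub smooth_on_subset unfolding regular_def by blast
    ultimately show ?thesis unfolding regular_arc_def by blast
  qed
  ultimately have "local_parametrization regular_arc S x U 2 \<gamma> (\<lambda>_. 0) (\<lambda>_. \<epsilon>)"
    unfolding local_parametrization_def using oU xU \<epsilon>(1) \<gamma>0 by simp
  then show ?thesis by blast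
qed

context conic begin

lemma bil_discriminant: "(bil u w)\<^sup>2 - q2 u * q2 w = (a12\<^sup>2 - a11 * a22) * (cross u w)\<^sup>2"
  by (simp add: bil_def q2_def power2_eq_square algebra_simps)

lemma null_directions:
  assumes "a12\<^sup>2 > a11 * a22"
  obtains w1 w2 where "q2 w1 = 0" "q2 w2 = 0" "cross w1 w2 \<noteq> 0"
proof (cases "a11 = 0")
  case True
  have "q2 (1, 0) = 0" "q2 (- a22, 2 * a12) = 0" unfolding q2_def by (simp_all add: True power2_eq_square)
  moreover have "cross (1, 0) (- a22, 2 * a12) \<noteq> 0" using assms True by simp
  ultimately show ?thesis by (rule that)
next
  case False
  define s where "s = sqrt (a12\<^sup>2 - a11 * a22)"
  have s2: "s * s = a12\<^sup>2 - a11 * a22" and "s \<noteq> 0" using assms by (simp_all add: s_def)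
  have "q2 (- a12 + s, a11) = a11 * (s * s - a12\<^sup>2 + a11 * a22)"
    "q2 (- a12 - s, a11) = a11 * (s * s - a12\<^sup>2 + a11 * a22)"
    by (simp_all add: q2_def power2_eq_square algebra_simps)
  then have "q2 (- a12 + s, a11) = 0" "q2 (- a12 - s, a11) = 0" by (simp_all add: s2)
  moreover have "cross (- a12 + s, a11) (- a12 - s, a11) \<noteq> 0"
    using False \<open>s \<noteq> 0\<close> by (simp add: algebra_simps)
  ultimately show ?thesis by (rule that)
qed

text \<open>By Cramer's rule \<open>v\<close> is a combination of \<open>w1\<close> and
  \<open>w2\<close>; as both are null, only the mixed term of \<open>q2 v\<close> survives, and
  \<open>bil w1 w2 \<noteq> 0\<close>.\<close>

lemma null_direction_parallel:
  assumes d: "a12\<^sup>2 > a11 * a22" and w: "q2 w1 = 0" "q2 w2 = 0" "cross w1 w2 \<noteq> 0" and v: "q2 v = 0"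
  shows "cross w1 v = 0 \<or> cross w2 v = 0"
proof -
  have "(cross w1 w2)\<^sup>2 * q2 v =
      (cross v w2)\<^sup>2 * q2 w1 - 2 * cross v w2 * cross v w1 * bil w1 w2 + (cross v w1)\<^sup>2 * q2 w2"
    by (simp add: bil_def q2_def power2_eq_square algebra_simps)
  then have "cross v w2 * cross v w1 * bil w1 w2 = 0" using v w by simp
  moreover have "bil w1 w2 \<noteq> 0" using bil_discriminant[of w1 w2] d w by auto
  ultimately have "cross v w2 = 0 \<or> cross v w1 = 0" by simp
  then show ?thesis by (auto simp: mult.commute)
qed

text \<open>In the frame of \<open>w\<close> the point \<open>p k\<close> has abscissa
  \<open>x k\<close> and slope \<open>y k\<close>. Both tend to zero, so eventually
  \<open>p k\<close> lies in the box where \<open>m\<close> is the only solution. Being a ratio, the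
  slope does not notice whether \<open>v\<close> points along \<open>w\<close> or against
  it.\<close>

lemma eventually_on_branch:
  assumes w: "w \<noteq> 0" and e: "0 < \<eta>" "\<eta> \<le> e" "\<delta> > 0"
    and br: "\<And>x y. \<bar>x\<bar> < e \<Longrightarrow> x \<noteq> 0 \<Longrightarrow> \<bar>y\<bar> < \<delta> \<Longrightarrow> Inv (x *\<^sub>R (w + y *\<^sub>R (- snd w, fst w))) = 0 \<Longrightarrow> y = m x"
    and p: "\<And>k. Inv (p k) = 0" "\<And>k. p k \<noteq> 0" "p \<longlonglongrightarrow> 0"
    and u: "(\<lambda>k. (1 / norm (p k)) *\<^sub>R p k) \<longlonglongrightarrow> v" "v \<noteq> 0" "cross w v = 0"
  shows "\<forall>\<^sub>F k in sequentially. p k \<in> branch w m ` {-\<eta><..<\<eta>}"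
proof -
  define n where "n = (- snd w, fst w)"
  define r where "r = w \<bullet> w"
  have r: "r \<noteq> 0" using w by (simp add: r_def)
  have dec: "z = ((z \<bullet> w) / r) *\<^sub>R w + ((z \<bullet> n) / r) *\<^sub>R n" for z
  proof -
    have "r *\<^sub>R z = (z \<bullet> w) *\<^sub>R w + (z \<bullet> n) *\<^sub>R n"
      by (cases z; cases w) (simp add: r_def n_def algebra_simps)
    then have "(1 / r) *\<^sub>R (r *\<^sub>R z) = (1 / r) *\<^sub>R ((z \<bullet> w) *\<^sub>R w + (z \<bullet> n) *\<^sub>R n)" by simp
    then show ?thesis using r(1) by (simp add: scaleR_add_right)
  qed
  have vn: "v \<bullet> n = 0" using u(3) by (simp add: n_def inner_prod_def algebra_simps)
  have vw: "v \<bullet> w \<noteq> 0"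
  proof
    assume "v \<bullet> w = 0"
    then have "v = 0" using dec[of v] vn by simp
    then show False using u(2) by simp
  qed
  define x where "x k = (p k \<bullet> w) / r" for k
  define y where "y k = (p k \<bullet> n) / (p k \<bullet> w)" for k
  have y_eq: "y k = (((1 / norm (p k)) *\<^sub>R p k) \<bullet> n) / (((1 / norm (p k)) *\<^sub>R p k) \<bullet> w)" for k
    using p(2)[of k] by (simp add: y_def)
  have "y \<longlonglongrightarrow> (v \<bullet> n) / (v \<bullet> w)"
    unfolding y_eq[abs_def] by (intro tendsto_intros u(1) vw)
  then have "y \<longlonglongrightarrow> 0" using vn by simp
  then have 1: "\<forall>\<^sub>F k in sequentially. \<bar>y k\<bar> < \<delta>" 
    using tendstoD[of y 0 sequentially \<delta>] e(3) by simp
  have "x \<longlonglongrightarrow> (0 \<bullet> w) / r" unfolding x_def using r by (intro tendsto_intros p(3)) auto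
  then have "x \<longlonglongrightarrow> 0" by simp
  then have 2: "\<forall>\<^sub>F k in sequentially. \<bar>x k\<bar> < \<eta>" 
    using tendstoD[of x 0 sequentially \<eta>] e(1) by simp
  have "(\<lambda>k. ((1 / norm (p k)) *\<^sub>R p k) \<bullet> w) \<longlonglongrightarrow> v \<bullet> w" by (intro tendsto_intros u(1))
  then have "\<forall>\<^sub>F k in sequentially. ((1 / norm (p k)) *\<^sub>R p k) \<bullet> w \<noteq> 0"
    using vw by (rule tendsto_imp_eventually_ne)
  with 1 2 show ?thesis
  proof eventually_elim
    case (elim k)
    have pw: "p k \<bullet> w \<noteq> 0" using elim(3) by auto
    have pe: "p k = x k *\<^sub>R (w + y k *\<^sub>R n)"
      using dec[of "p k"] pw by (simp add: x_def y_def scaleR_add_right)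
    have "Inv (x k *\<^sub>R (w + y k *\<^sub>R n)) = 0" unfolding pe[symmetric] by (rule p(1))
    moreover have "x k \<noteq> 0" using pw r by (simp add: x_def)
    moreover have "\<bar>x k\<bar> < e" using elim(2) e(2) by simp
    ultimately have "y k = m (x k)" using br[of "x k" "y k"] elim(1) unfolding n_def by blast
    then have "p k = branch w m (x k)" unfolding pe branch_def n_def by (rule arg_cong)
    moreover have "x k \<in> {-\<eta><..<\<eta>}" using elim(2) by auto
    ultimately show ?case by (metis imageI)
  qed
qed

text \<open>If points off both branches accumulated at the origin, a limit of their directions would
  be null, hence parallel to \<open>w1\<close> or \<open>w2\<close>, and
  \<open>eventually_on_branch\<close> would put them on a branch after all.\<close>

lemma node_origin:
  assumes d: "a12\<^sup>2 > a11 * a22"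
  shows "\<exists>U \<gamma> \<epsilon>. local_parametrization regular_arc {p. Inv p = 0} 0 U 2 \<gamma> (\<lambda>_. 0) (\<lambda>_. \<epsilon>) \<and>
    cross (velocity (\<gamma> 0) 0) (velocity (\<gamma> 1) 0) \<noteq> 0"
proof -
  let ?S = "{p. Inv p = 0}"
  obtain w1 w2 where w: "q2 w1 = 0" "q2 w2 = 0" "cross w1 w2 \<noteq> 0" using null_directions[OF d] .
  then have w0: "w1 \<noteq> 0" "w2 \<noteq> 0" by auto
  obtain e1 \<delta>1 m1 where b1: "e1 > 0" "\<delta>1 > 0" "smooth_on {-e1<..<e1} m1" "m1 0 = 0"
    "\<And>x. \<bar>x\<bar> < e1 \<Longrightarrow> Inv (branch w1 m1 x) = 0"
    "\<And>x y. \<bar>x\<bar> < e1 \<Longrightarrow> x \<noteq> 0 \<Longrightarrow> \<bar>y\<bar> < \<delta>1 \<Longrightarrow> Inv (x *\<^sub>R (w1 + y *\<^sub>R (- snd w1, fst w1))) = 0 \<Longrightarrow> y = m1 x"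
    by (rule null_branch[OF d w0(1) w(1)]) blast
  obtain e2 \<delta>2 m2 where b2: "e2 > 0" "\<delta>2 > 0" "smooth_on {-e2<..<e2} m2" "m2 0 = 0"
    "\<And>x. \<bar>x\<bar> < e2 \<Longrightarrow> Inv (branch w2 m2 x) = 0"
    "\<And>x y. \<bar>x\<bar> < e2 \<Longrightarrow> x \<noteq> 0 \<Longrightarrow> \<bar>y\<bar> < \<delta>2 \<Longrightarrow> Inv (x *\<^sub>R (w2 + y *\<^sub>R (- snd w2, fst w2))) = 0 \<Longrightarrow> y = m2 x"
    by (rule null_branch[OF d w0(2) w(2)]) blast
  \<comment> \<open>While the directions of the two secants from the origin are independent, the
    branches can meet only at the origin.\<close>
  define X where "X p = cross (w1 + m1 (fst p) *\<^sub>R (- snd w1, fst w1)) (w2 + m2 (snd p) *\<^sub>R (- snd w2, fst w2))" for p :: plane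
  define B where "B = {-e1<..<e1} \<times> {-e2<..<e2}"
  have "continuous_on B (\<lambda>p. m1 (fst p))" "continuous_on B (\<lambda>p. m2 (snd p))"
    by (rule continuous_on_compose2[OF smooth_on_imp_continuous_on[OF b1(3)]], auto simp: B_def intro!: continuous_intros)
      (rule continuous_on_compose2[OF smooth_on_imp_continuous_on[OF b2(3)]], auto simp: B_def intro!: continuous_intros)
  then have "continuous_on B X" unfolding X_def by (intro continuous_intros)
  then have "open (B \<inter> X -` (- {0}))" by (rule continuous_open_preimage) (auto simp: B_def open_Times)
  moreover have "(0, 0) \<in> B \<inter> X -` (- {0})" using b1(1,4) b2(1,4) w(3) by (simp add: B_def X_def)
  ultimately obtain e where e: "e > 0" "\<And>s t. \<bar>s\<bar> < e \<Longrightarrow> \<bar>t\<bar> < e \<Longrightarrow> (s, t) \<in> B \<inter> X -` (- {0})"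
    using open_plane_box[of "B \<inter> X -` (- {0})" "(0, 0)"] by auto
  have sub: "\<bar>s\<bar> < e \<Longrightarrow> \<bar>s\<bar> < e1 \<and> \<bar>s\<bar> < e2" for s using e(2)[of s s] by (auto simp: B_def)
  have "e \<le> e1" "e \<le> e2"
    using sub[of e1] sub[of e2] b1(1) b2(1) by (auto simp: not_less[symmetric])
  define \<gamma> where "\<gamma> i = (if i = 0 then branch w1 m1 else branch w2 m2)" for i :: nat
  have "\<exists>U \<epsilon>. local_parametrization regular_arc ?S 0 U 2 \<gamma> (\<lambda>_. 0) (\<lambda>_. \<epsilon>)"
  proof (rule local_parametrization_two_arcs)
    show "e > 0" by fact
    show "regular_arc (\<gamma> i) {-e<..<e}" for i
      using branch_regular_arc[OF b1(3) w0(1) \<open>e \<le> e1\<close>] branch_regular_arc[OF b2(3) w0(2) \<open>e \<le> e2\<close>]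
      by (simp add: \<gamma>_def)
    show "\<gamma> i 0 = 0" for i by (simp add: \<gamma>_def)
    show "\<gamma> i t \<in> ?S" if "\<bar>t\<bar> < e" for i t using b1(5) b2(5) sub[OF that] by (simp add: \<gamma>_def)
    show "s = 0 \<and> t = 0" if st: "\<bar>s\<bar> < e" "\<bar>t\<bar> < e" "\<gamma> 0 s = \<gamma> 1 t" for s t
    proof -
      define A where "A = w1 + m1 s *\<^sub>R (- snd w1, fst w1)"
      define B where "B = w2 + m2 t *\<^sub>R (- snd w2, fst w2)"
      have eq: "s *\<^sub>R A = t *\<^sub>R B" using st(3) by (simp add: \<gamma>_def branch_def A_def B_def)
      have AB: "cross A B \<noteq> 0" using e(2)[OF st(1,2)] by (simp add: X_def A_def B_def)
      have "s * cross A B = cross (t *\<^sub>R B) B" unfolding eq[symmetric] by (simp add: algebra_simps)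
      moreover have "t * cross A B = cross A (s *\<^sub>R A)" unfolding eq by (simp add: algebra_simps)
      ultimately have "s * cross A B = 0" "t * cross A B = 0" by simp_all
      then show ?thesis using AB by simp
    qed
    show "\<exists>W. open W \<and> 0 \<in> W \<and> W \<inter> ?S \<subseteq> \<gamma> 0 ` {-h<..<h} \<union> \<gamma> 1 ` {-h<..<h}"
      if h: "0 < h" "h < e" for h
    proof (rule ccontr)
      assume neg: "\<not> ?thesis"
      define T where "T = ?S - (\<gamma> 0 ` {-h<..<h} \<union> \<gamma> 1 ` {-h<..<h})"
      have "0 islimpt T"
      proof (rule ccontr)
        assume "\<not> 0 islimpt T"
        then obtain W where W: "0 \<in> W" "open W" "\<And>y. y \<in> T \<Longrightarrow> y \<in> W \<Longrightarrow> y = 0"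
          unfolding islimpt_def by blast
        have "0 \<in> \<gamma> 0 ` {-h<..<h}" using h by (intro image_eqI[of _ _ 0]) (auto simp: \<gamma>_def)
        then have "W \<inter> ?S \<subseteq> \<gamma> 0 ` {-h<..<h} \<union> \<gamma> 1 ` {-h<..<h}" using W(3) unfolding T_def by blast
        then show False using neg W by blast
      qed
      from islimpt_direction[OF this] obtain p v where p: "norm v = 1" "\<And>k. p k \<in> T - {0}"
        "p \<longlonglongrightarrow> 0" "(\<lambda>k. (1 / norm (p k)) *\<^sub>R p k) \<longlonglongrightarrow> v" by auto
      have "v \<noteq> 0" using p(1) by auto
      have pS: "Inv (p k) = 0" "p k \<noteq> 0" for k using p(2)[of k] by (auto simp: T_def)
      have "tangent_direction ?S 0 v"
        unfolding tangent_direction_def using p(3,4) pS \<open>v \<noteq> 0\<close>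
        by (intro conjI exI[of _ p] exI[of _ "\<lambda>k. 1 / norm (p k)"]) auto
      then have "q2 v = 0" by (rule tangent_direction_null)
      from null_direction_parallel[OF d w this]
      have "\<forall>\<^sub>F k in sequentially. p k \<in> \<gamma> 0 ` {-h<..<h} \<union> \<gamma> 1 ` {-h<..<h}"
      proof
        assume "cross w1 v = 0"
        moreover have "h \<le> e1" using h \<open>e \<le> e1\<close> by simp
        ultimately have "\<forall>\<^sub>F k in sequentially. p k \<in> branch w1 m1 ` {-h<..<h}"
          using eventually_on_branch[where e = e1 and m = m1, OF w0(1) h(1) _ b1(2,6) pS p(3,4) \<open>v \<noteq> 0\<close>]
          by blast
        then show ?thesis by (rule eventually_mono) (simp add: \<gamma>_def)
      next
        assume "cross w2 v = 0"
        moreover have "h \<le> e2" using h \<open>e \<le> e2\<close> by simp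
        ultimately have "\<forall>\<^sub>F k in sequentially. p k \<in> branch w2 m2 ` {-h<..<h}"
          using eventually_on_branch[where e = e2 and m = m2, OF w0(2) h(1) _ b2(2,6) pS p(3,4) \<open>v \<noteq> 0\<close>]
          by blast
        then show ?thesis by (rule eventually_mono) (simp add: \<gamma>_def)
      qed
      then obtain k where "p k \<in> \<gamma> 0 ` {-h<..<h} \<union> \<gamma> 1 ` {-h<..<h}"
        unfolding eventually_sequentially by blast
      then show False using p(2)[of k] by (simp add: T_def)
    qed
  qed
  moreover have "cross (velocity (\<gamma> 0) 0) (velocity (\<gamma> 1) 0) \<noteq> 0"
    using w(3) branch_velocity[OF b1(3,1,4)] branch_velocity[OF b2(3,1,4)] by (simp add: \<gamma>_def)
  ultimately show ?thesis by blast
qed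

lemma null_tangent_hyperbolic:
  assumes d: "a12\<^sup>2 > a11 * a22" and v: "v \<noteq> 0" "q2 v = 0"
  shows "tangent_direction {p. Inv p = 0} 0 v"
proof -
  obtain e \<delta> m where b: "e > 0" "\<delta> > 0" "smooth_on {-e<..<e} m" "m 0 = 0"
    "\<And>x. \<bar>x\<bar> < e \<Longrightarrow> Inv (branch v m x) = 0"
    "\<And>x y. \<bar>x\<bar> < e \<Longrightarrow> x \<noteq> 0 \<Longrightarrow> \<bar>y\<bar> < \<delta> \<Longrightarrow> Inv (x *\<^sub>R (v + y *\<^sub>R (- snd v, fst v))) = 0 \<Longrightarrow> y = m x"
    by (rule null_branch[OF d v]) blast
  \<comment> \<open>The shift by 2 keeps \<open>x k\<close> strictly below \<open>e\<close> from
    \<open>k = 0\<close> on.\<close>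
  define x where "x k = e / real (k + 2)" for k
  have "0 < x k" "x k < e" for k
    using b(1) divide_strict_left_mono[of 1 "real (k + 2)" e] by (simp_all add: x_def)
  then have x: "x k \<noteq> 0" "\<bar>x k\<bar> < e" for k by (simp_all add: less_imp_neq[symmetric] abs_of_pos)
  have x0: "x \<longlonglongrightarrow> 0" unfolding x_def by (intro lim_const_over_n[THEN LIMSEQ_ignore_initial_segment])
  have "isCont m 0"
    using smooth_on_imp_continuous_on[OF b(3)] b(1) by (auto simp: continuous_on_eq_continuous_at)
  then have mx: "(\<lambda>k. m (x k)) \<longlonglongrightarrow> 0" using isCont_tendsto_compose[OF _ x0, of m] b(4) by simp
  define u where "u k = v + m (x k) *\<^sub>R (- snd v, fst v)" for k
  have "u \<longlonglongrightarrow> v + 0 *\<^sub>R (- snd v, fst v)" unfolding u_def by (intro tendsto_intros mx)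
  then have u: "u \<longlonglongrightarrow> v" by (simp only: scaleR_zero_left add_0_right)
  have br: "branch v m (x k) = x k *\<^sub>R u k" for k by (simp add: branch_def u_def)
  have "(\<lambda>k. branch v m (x k)) \<longlonglongrightarrow> 0" unfolding br using tendsto_scaleR[OF x0 u] by simp
  moreover have "branch v m (x k) \<noteq> 0" for k
    using branch_coordinates[of v m "x k"] x(1)[of k] v(1) by auto
  moreover have "(\<lambda>k. (1 / x k) *\<^sub>R (branch v m (x k) - 0)) \<longlonglongrightarrow> v" unfolding br using x(1) u by simp
  ultimately show ?thesis
    unfolding tangent_direction_def using v(1) b(5) x
    by (intro conjI exI[of _ "\<lambda>k. branch v m (x k)"] exI[of _ "\<lambda>k. 1 / x k"]) auto
qed

text \<open>A form of rank one is \<open>k\<close> times the square of the coordinate along a unit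
  vector \<open>(n1, n2)\<close>. Then \<open>\<Delta> = - k * (a1 * n2 - a2 * n1)^2\<close>, so the
  linear part has a nonzero component along the axis \<open>(n2, - n1)\<close>.\<close>

lemma parabolic_frame:
  assumes d: "a12\<^sup>2 = a11 * a22"
  obtains n1 n2 k where "n1\<^sup>2 + n2\<^sup>2 = 1" "k \<noteq> 0" "a11 = k * n1\<^sup>2" "a22 = k * n2\<^sup>2" "a12 = k * n1 * n2"
    "a1 * n2 - a2 * n1 \<noteq> 0"
proof -
  have "\<exists>n1 n2 k. n1\<^sup>2 + n2\<^sup>2 = 1 \<and> k \<noteq> 0 \<and> a11 = k * n1\<^sup>2 \<and> a22 = k * n2\<^sup>2 \<and> a12 = k * n1 * n2"
  proof (cases "a11 = 0")
    case True
    then have "a12 = 0" using d by simp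
    then have "a22 \<noteq> 0" using disc True by auto
    then show ?thesis using True \<open>a12 = 0\<close> by (intro exI[of _ 0] exI[of _ 1] exI[of _ a22]) simp
  next
    case False
    define N where "N = a11\<^sup>2 + a12\<^sup>2"
    have N: "N > 0" using False by (simp add: N_def sum_power2_gt_zero_iff)
    have sN: "(sqrt N)\<^sup>2 = N" "sqrt N \<noteq> 0" using N by simp_all
    define n1 n2 k where "n1 = a11 / sqrt N" and "n2 = a12 / sqrt N" and "k = N / a11"
    have "n1\<^sup>2 + n2\<^sup>2 = 1" using N by (simp add: n1_def n2_def power_divide sN flip: add_divide_distrib N_def)
    moreover have "k \<noteq> 0" using N False by (simp add: k_def)
    moreover have "a11 = k * n1\<^sup>2" "a22 = k * n2\<^sup>2"
      using N False d by (simp_all add: k_def n1_def n2_def power_divide sN power2_eq_square)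
    moreover have "a12 = k * n1 * n2"
    proof -
      have "k * n1 * n2 = k * (a11 * a12) / (sqrt N)\<^sup>2" by (simp add: n1_def n2_def power2_eq_square)
      then show ?thesis using N False by (simp add: sN k_def)
    qed
    ultimately show ?thesis by blast
  qed
  then obtain n1 n2 k where n: "n1\<^sup>2 + n2\<^sup>2 = 1" "k \<noteq> 0" "a11 = k * n1\<^sup>2" "a22 = k * n2\<^sup>2" "a12 = k * n1 * n2"
    by blast
  have "\<Delta> = - k * (a1 * n2 - a2 * n1)\<^sup>2"
    unfolding \<Delta>_def using n(3-5) by algebra
  then have "a1 * n2 - a2 * n1 \<noteq> 0" using \<Delta>_nonzero by auto
  then show ?thesis using that n by blast
qed

lemma q_parabolic_frame:
  assumes n: "n1\<^sup>2 + n2\<^sup>2 = 1" "a11 = k * n1\<^sup>2" "a22 = k * n2\<^sup>2" "a12 = k * n1 * n2"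
  shows "q p = k * (n1 * fst p + n2 * snd p)\<^sup>2 + 2 * (a1 * n2 - a2 * n1) * (n2 * fst p - n1 * snd p)
      + 2 * (a1 * n1 + a2 * n2) * (n1 * fst p + n2 * snd p) + c"
    and "q2 p = k * (n1 * fst p + n2 * snd p)\<^sup>2"
proof -
  show q2: "q2 p = k * (n1 * fst p + n2 * snd p)\<^sup>2"
    unfolding q2_def using n(2-4) by algebra
  have "a1 * fst p + a2 * snd p = (a1 * n2 - a2 * n1) * (n2 * fst p - n1 * snd p)
      + (a1 * n1 + a2 * n2) * (n1 * fst p + n2 * snd p)"
    using n(1) by algebra
  moreover have "q p = q2 p + 2 * (a1 * fst p + a2 * snd p) + c" by (simp add: q_def q2_def)
  ultimately show "q p = k * (n1 * fst p + n2 * snd p)\<^sup>2 + 2 * (a1 * n2 - a2 * n1) * (n2 * fst p - n1 * snd p)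
      + 2 * (a1 * n1 + a2 * n2) * (n1 * fst p + n2 * snd p) + c"
    unfolding q2 by algebra
qed

text \<open>Completing the square in \<open>Y\<close> writes \<open>Inv\<close> near the origin as \<open>A (Y1\<^sup>2 + C X\<^sup>3)\<close>
  with \<open>A\<close> and \<open>C\<close> nonvanishing; \<open>(- C X, C Y1)\<close> are coordinates straightening the cusp, since
  \<open>(C Y1)\<^sup>2 - (- C X)\<^sup>3 = C\<^sup>2 (Y1\<^sup>2 + C X\<^sup>3)\<close>.\<close>

lemma cusp_origin:
  assumes d: "a12\<^sup>2 = a11 * a22"
  shows "ordinary_cusp {p. Inv p = 0} 0"
proof -
  obtain n1 n2 k where n: "n1\<^sup>2 + n2\<^sup>2 = 1" "k \<noteq> 0" "a11 = k * n1\<^sup>2" "a22 = k * n2\<^sup>2" "a12 = k * n1 * n2"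
    "a1 * n2 - a2 * n1 \<noteq> 0" using parabolic_frame[OF d] .
  define l1 l2 where "l1 = a1 * n2 - a2 * n1" and "l2 = a1 * n1 + a2 * n2"
  define X where "X p = n2 * fst p - n1 * snd p" for p :: plane
  define Y where "Y p = n1 * fst p + n2 * snd p" for p :: plane
  \<comment> \<open>Sorted by powers of \<open>Y\<close>, \<open>Inv\<close> is
    \<open>A * Y^2 + 2 * l2 * X^2 * Y + (2 * l1 + c * X) * X^3\<close>; \<open>A\<close> collects
    all that is divisible by \<open>Y^2\<close>.\<close>
  define A where "A p = k + 2 * l1 * X p + 2 * l2 * Y p + c * (2 * (X p)\<^sup>2 + (Y p)\<^sup>2)" for p
  define C where "C p = (2 * l1 + c * X p) / A p - l2\<^sup>2 * X p / (A p)\<^sup>2" for p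
  \<comment> \<open>Keeping the two factors \<open>X\<close> apart lets the product rule show that
    \<open>Y1\<close> and \<open>Y\<close> have the same derivative at the origin.\<close>
  define Y1 where "Y1 p = Y p + X p * (X p * (l2 / A p))" for p
  define \<phi> where "\<phi> p = (- (C p * X p), C p * Y1 p)" for p
  have XY0: "X 0 = 0" "Y 0 = 0" by (simp_all add: X_def Y_def)
  have A0: "A 0 = k" by (simp add: A_def XY0)
  have C0: "C 0 \<noteq> 0" using n by (simp add: C_def XY0 A0 l1_def)
  have Inv_A: "Inv p = A p * ((Y1 p)\<^sup>2 + C p * (X p)^3)" if "A p \<noteq> 0" for p
  proof -
    have r: "p \<bullet> p = (X p)\<^sup>2 + (Y p)\<^sup>2"
      unfolding X_def Y_def inner_prod_def inner_real_def using n(1) by algebra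
    have l: "a1 * fst p + a2 * snd p = l1 * X p + l2 * Y p"
      unfolding X_def Y_def l1_def l2_def using n(1) by algebra
    have e: "Inv p = c * ((X p)\<^sup>2 + (Y p)\<^sup>2)\<^sup>2 + 2 * (l1 * X p + l2 * Y p) * ((X p)\<^sup>2 + (Y p)\<^sup>2) + k * (Y p)\<^sup>2"
      unfolding Inv_def r l q_parabolic_frame(2)[OF n(1,3-5)] Y_def by simp
    define i where "i = 1 / A p"
    have i: "i * A p = 1" using that by (simp add: i_def)
    have C: "C p = (2 * l1 + c * X p) * i - l2\<^sup>2 * X p * i\<^sup>2" by (simp add: C_def i_def power_divide)
    have Y1: "Y1 p = Y p + l2 * (X p)\<^sup>2 * i" by (simp add: Y1_def i_def power2_eq_square)
    have Ae: "A p = k + 2 * l1 * X p + 2 * l2 * Y p + c * (2 * (X p)\<^sup>2 + (Y p)\<^sup>2)" by (simp add: A_def)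
    have "A p * ((Y1 p)\<^sup>2 + C p * (X p)^3) = A p * (Y p)\<^sup>2 + 2 * l2 * (X p)\<^sup>2 * Y p + (2 * l1 + c * X p) * (X p)^3"
      unfolding C Y1 using i by algebra
    then show ?thesis unfolding e Ae by algebra
  qed
  have sXY: "smooth_on U X" "smooth_on U Y" if "open U" for U
    unfolding X_def[abs_def] Y_def[abs_def] using that by (auto intro!: smooth_intros)
  have sA: "smooth_on U A" if "open U" for U
    unfolding A_def[abs_def] by (intro smooth_intros sXY that)
  define U0 where "U0 = {p. A p \<noteq> 0}"
  have oU0: "open U0"
    unfolding U0_def using smooth_on_imp_continuous_on[OF sA[OF open_UNIV]]
    by (intro open_Collect_neq continuous_intros) auto
  have sC: "smooth_on U0 C"
    unfolding C_def[abs_def] by (intro smooth_intros sXY sA oU0) (auto simp: U0_def)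
  have sY1: "smooth_on U0 Y1"
    unfolding Y1_def[abs_def] by (intro smooth_intros sXY sA oU0) (auto simp: U0_def)
  define U where "U = U0 \<inter> C -` (- {0})"
  have oU: "open U" unfolding U_def
    by (rule continuous_open_preimage[OF smooth_on_imp_continuous_on[OF sC] oU0]) auto
  have U0: "0 \<in> U" "U \<subseteq> U0" using C0 A0 n(2) by (auto simp: U_def U0_def)
  have s\<phi>: "smooth_on U \<phi>" unfolding \<phi>_def[abs_def]
    by (intro smooth_intros smooth_on_subset[OF sC U0(2)] smooth_on_subset[OF sY1 U0(2)] sXY oU)
  have dX: "(X has_derivative X) (at 0)" and dY: "(Y has_derivative Y) (at 0)"
    unfolding X_def[abs_def] Y_def[abs_def] by (auto intro!: derivative_eq_intros)
  have "(\<lambda>p. l2 / A p) differentiable (at 0)"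
    by (rule smooth_on_differentiable[of U0]) (use oU0 U0 in \<open>auto intro!: smooth_intros sA simp: U0_def\<close>)
  then obtain B' where B': "((\<lambda>p. l2 / A p) has_derivative B') (at 0)" unfolding differentiable_def by blast
  obtain C' where C': "(C has_derivative C') (at 0)"
    using smooth_on_differentiable[OF sC] U0 unfolding differentiable_def by blast
  have dY1: "(Y1 has_derivative Y) (at 0)"
    unfolding Y1_def[abs_def]
    using has_derivative_add[OF dY has_derivative_mult[OF dX has_derivative_mult[OF dX B']]] by (simp add: XY0)
  have Y10: "Y1 0 = 0" by (simp add: Y1_def XY0)
  have d\<phi>: "(\<phi> has_derivative (\<lambda>v. (- (C 0 * X v), C 0 * Y v))) (at 0)"
    unfolding \<phi>_def[abs_def]
    using has_derivative_Pair[OF has_derivative_minus[OF has_derivative_mult[OF C' dX]] has_derivative_mult[OF C' dY1]]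
    by (simp add: XY0 Y10)
  have "plane_det (\<lambda>v. (- (C 0 * X v), C 0 * Y v)) = - (C 0)\<^sup>2 * (n1\<^sup>2 + n2\<^sup>2)"
    by (simp add: plane_det_def X_def Y_def power2_eq_square algebra_simps)
  then have "plane_det (\<lambda>v. (- (C 0 * X v), C 0 * Y v)) \<noteq> 0" using n(1) C0 by simp
  from smooth_local_inverse[OF oU s\<phi> U0(1) d\<phi> this]
  obtain U' V \<psi> where g: "open U'" "U' \<subseteq> U" "0 \<in> U'" "open V" "homeomorphism U' V \<phi> \<psi>" "smooth_on V \<psi>" by metis
  have cusp_iff: "Inv p = 0 \<longleftrightarrow> (snd (\<phi> p))\<^sup>2 = (fst (\<phi> p))^3" if "p \<in> U'" for p
  proof -
    have AC: "A p \<noteq> 0" "C p \<noteq> 0" using that g(2) by (auto simp: U_def U0_def)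
    have "(snd (\<phi> p))\<^sup>2 - (fst (\<phi> p))^3 = (C p)\<^sup>2 * ((Y1 p)\<^sup>2 + C p * (X p)^3)"
      by (simp add: \<phi>_def power2_eq_square power3_eq_cube algebra_simps)
    moreover have "Inv p = 0 \<longleftrightarrow> (Y1 p)\<^sup>2 + C p * (X p)^3 = 0" using Inv_A[OF AC(1)] AC(1) by simp
    moreover have "(C p)\<^sup>2 \<noteq> 0" using AC by simp
    ultimately show ?thesis by (metis eq_iff_diff_eq_0 mult_eq_0_iff)
  qed
  have im: "\<phi> ` U' = V" using g(5) by (simp add: homeomorphism_def)
  have img: "\<phi> ` (U' \<inter> {p. Inv p = 0}) = V \<inter> {(t\<^sup>2, t^3) | t :: real. True}"
    unfolding cusp_curve_eq im[symmetric] using cusp_iff by (auto simp: case_prod_unfold)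
  have "\<phi> 0 = (0, 0)" by (simp add: \<phi>_def XY0 Y10)
  then show ?thesis
    unfolding ordinary_cusp_def using g img smooth_on_subset[OF s\<phi> g(2)] by blast
qed

text \<open>Points of the parabola \<open>q = 0\<close> that run to infinity are inverted; they tend
  to the origin, and their directions tend to that of the axis \<open>w\<close>, up to sign.\<close>

lemma null_tangent_parabolic:
  assumes d: "a12\<^sup>2 = a11 * a22" and v: "v \<noteq> 0" "q2 v = 0"
  shows "tangent_direction {p. Inv p = 0} 0 v"
proof -
  obtain n1 n2 k where n: "n1\<^sup>2 + n2\<^sup>2 = 1" "k \<noteq> 0" "a11 = k * n1\<^sup>2" "a22 = k * n2\<^sup>2" "a12 = k * n1 * n2"
    "a1 * n2 - a2 * n1 \<noteq> 0" using parabolic_frame[OF d] .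
  define l1 l2 where "l1 = a1 * n2 - a2 * n1" and "l2 = a1 * n1 + a2 * n2"
  have l10: "l1 \<noteq> 0" using n(6) by (simp add: l1_def)
  define w where "w = (n2, - n1)"
  have "(n1 * fst v + n2 * snd v) = 0"
    using v(2) n(2) unfolding q_parabolic_frame(2)[OF n(1,3-5)] by simp
  then have "cross w v = 0" by (simp add: w_def algebra_simps)
  moreover have "w \<noteq> 0" using n(1) by (auto simp: w_def zero_prod_def)
  ultimately obtain s where s: "v = s *\<^sub>R w" using cross_zero_parallel by blast
  define t where "t j = 1 / real (Suc j)" for j
  have t: "t j > 0" for j by (simp add: t_def)
  have t0: "t \<longlonglongrightarrow> 0" unfolding t_def using LIMSEQ_inverse_real_of_nat by (simp add: inverse_eq_divide)
  \<comment> \<open>\<open>f j\<close> is \<open>(t j)^2\<close> times the point of the parabola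
    whose coordinate along \<open>(n1, n2)\<close> is \<open>1 / t j\<close>; the scaling gives it a
    finite nonzero limit.\<close>
  define f where "f j = (- (k + 2 * l2 * t j + c * (t j)\<^sup>2) / (2 * l1)) *\<^sub>R w + t j *\<^sub>R (n1, n2)" for j
  have "f \<longlonglongrightarrow> (- (k + 2 * l2 * 0 + c * 0\<^sup>2) / (2 * l1)) *\<^sub>R w + 0 *\<^sub>R (n1, n2)"
    unfolding f_def using n(6) by (intro tendsto_intros t0) (simp add: l1_def)
  then have f: "f \<longlonglongrightarrow> (- k / (2 * l1)) *\<^sub>R w"
    by (simp only: mult_zero_right power_zero_numeral scaleR_zero_left add_0_right)
  define e where "e j = (1 / (t j)\<^sup>2) *\<^sub>R f j" for j
  have fY: "n1 * fst (f j) + n2 * snd (f j) = t j" for j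
  proof -
    define z where "z = - (k + 2 * l2 * t j + c * (t j)\<^sup>2) / (2 * l1)"
    have "f j = z *\<^sub>R w + t j *\<^sub>R (n1, n2)" by (simp add: f_def z_def)
    then have "n1 * fst (f j) + n2 * snd (f j) = t j * (n1\<^sup>2 + n2\<^sup>2)"
      by (simp add: w_def power2_eq_square algebra_simps)
    then show ?thesis using n(1) by simp
  qed
  have fX: "n2 * fst (f j) - n1 * snd (f j) = - (k + 2 * l2 * t j + c * (t j)\<^sup>2) / (2 * l1)" for j
  proof -
    define z where "z = - (k + 2 * l2 * t j + c * (t j)\<^sup>2) / (2 * l1)"
    have "f j = z *\<^sub>R w + t j *\<^sub>R (n1, n2)" by (simp add: f_def z_def)
    then have "n2 * fst (f j) - n1 * snd (f j) = z * (n1\<^sup>2 + n2\<^sup>2)"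
      by (simp add: w_def power2_eq_square algebra_simps)
    then show ?thesis using n(1) by (simp add: z_def)
  qed
  have f0: "f j \<noteq> 0" for j using fY[of j] t[of j] by auto
  have qe: "q (e j) = 0" for j
  proof -
    define i where "i = 1 / t j"
    have i: "i * t j = 1" using t[of j] by (simp add: i_def)
    have "n1 * fst (e j) + n2 * snd (e j) = i\<^sup>2 * (n1 * fst (f j) + n2 * snd (f j))"
      "n2 * fst (e j) - n1 * snd (e j) = i\<^sup>2 * (n2 * fst (f j) - n1 * snd (f j))"
      by (simp_all add: e_def i_def power_divide algebra_simps)
    then have eY: "n1 * fst (e j) + n2 * snd (e j) = i"
      and eX: "2 * l1 * (n2 * fst (e j) - n1 * snd (e j)) = - i\<^sup>2 * (k + 2 * l2 * t j + c * (t j)\<^sup>2)"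
      unfolding fX fY using i n(6) by (simp_all add: power2_eq_square l1_def field_simps)
    show ?thesis
      unfolding q_parabolic_frame(1)[OF n(1,3-5)] l1_def[symmetric] l2_def[symmetric] eX eY using i by algebra
  qed
  define p where "p j = \<Psi> (e j)" for j
  have e0: "e j \<noteq> 0" for j using f0 t[of j] by (simp add: e_def)
  then have p0: "p j \<noteq> 0" for j by (simp add: p_def)
  have Inv: "Inv (p j) = 0" for j using Inv_eq[OF p0] qe by (simp add: p_def)
  have p_eq: "p j = ((t j)\<^sup>2 / (f j \<bullet> f j)) *\<^sub>R f j" for j
    using t[of j] by (simp add: p_def \<Psi>_def e_def power2_eq_square)
  have w1: "w \<bullet> w = 1" using n(1) by (simp add: w_def power2_eq_square add.commute)
  have lim: "(- k / (2 * l1)) *\<^sub>R w \<noteq> 0" using n(2,6) w1 by (auto simp: l1_def)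
  have "p \<longlonglongrightarrow> (0\<^sup>2 / (((- k / (2 * l1)) *\<^sub>R w) \<bullet> ((- k / (2 * l1)) *\<^sub>R w))) *\<^sub>R ((- k / (2 * l1)) *\<^sub>R w)"
    unfolding p_eq[abs_def] by (intro tendsto_intros t0 f) (use lim in simp)
  then have p_lim: "p \<longlonglongrightarrow> 0" by simp
  define m where "m j = (s * (- 2 * l1 / k)) * ((f j \<bullet> f j) / (t j)\<^sup>2)" for j
  have "m j *\<^sub>R p j = (s * (- 2 * l1 / k)) *\<^sub>R f j" for j
    using f0[of j] t[of j] by (simp add: m_def p_eq)
  moreover have "(\<lambda>j. (s * (- 2 * l1 / k)) *\<^sub>R f j) \<longlonglongrightarrow> (s * (- 2 * l1 / k)) *\<^sub>R ((- k / (2 * l1)) *\<^sub>R w)"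
    by (intro tendsto_intros f)
  moreover have "(s * (- 2 * l1 / k)) *\<^sub>R ((- k / (2 * l1)) *\<^sub>R w) = v"
    using n(2) l10 by (simp add: s)
  ultimately have "(\<lambda>j. m j *\<^sub>R (p j - 0)) \<longlonglongrightarrow> v" by simp
  then show ?thesis
    unfolding tangent_direction_def using v(1) Inv p0 p_lim by blast
qed


subsection \<open>Asymptotes and axes\<close>

text \<open>The point of the conic nearest to \<open>p + s *\<^sub>R v\<close> differs from it by
  \<open>u s\<close>, which tends to zero. Dividing its equation by \<open>s^2\<close> leaves
  \<open>q2 v = 0\<close> in the limit.\<close>

lemma asymptotic_direction_null:
  assumes ne: "q p0 = 0" and as: "asymptotic_direction {p. q p = 0} v"
  shows "q2 v = 0"
proof -
  let ?E = "{p. q p = 0}"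
  obtain p where p: "((\<lambda>s. infdist (p + s *\<^sub>R v) ?E) \<longlongrightarrow> 0) at_top"
    using as unfolding asymptotic_direction_def by blast
  have cl: "closed ?E" using continuous_closed_preimage_constant[OF continuous_on_q[of UNIV] closed_UNIV]
    by (simp add: vimage_def)
  have "?E \<noteq> {}" using ne by blast
  then have "\<exists>e. q e = 0 \<and> infdist x ?E = dist x e" for x
    using infdist_attains_inf[OF cl, of x] by blast
  then have "\<forall>x. \<exists>e. q e = 0 \<and> infdist x ?E = dist x e" by blast
  then obtain e where "\<forall>x. q (e x) = 0 \<and> infdist x ?E = dist x (e x)"
    unfolding choice_iff by (elim exE)
  then have e: "q (e x) = 0" "infdist x ?E = dist x (e x)" for x by blast+
  define u where "u s = e (p + s *\<^sub>R v) - (p + s *\<^sub>R v)" for s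
  have "((\<lambda>s. norm (u s)) \<longlongrightarrow> 0) at_top"
    using p unfolding e(2) u_def by (simp add: dist_norm norm_minus_commute)
  then have u: "(u \<longlongrightarrow> 0) at_top" by (rule tendsto_norm_zero_cancel)
  have inv: "((\<lambda>s :: real. inverse s) \<longlongrightarrow> 0) at_top" by (rule tendsto_inverse_0_at_top[OF filterlim_ident])
  have pu: "((\<lambda>s. p + u s) \<longlongrightarrow> p + 0) at_top" by (intro tendsto_intros u)
  have "((\<lambda>s. q (p + u s)) \<longlongrightarrow> q (p + 0)) at_top" "((\<lambda>s. g (p + u s)) \<longlongrightarrow> g (p + 0)) at_top"
    using continuous_on_tendsto_compose[OF continuous_on_q[of UNIV] pu]
      continuous_on_tendsto_compose[OF continuous_on_g[of UNIV] pu] by auto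
  then have "((\<lambda>s. - (q (p + u s) * (inverse s)\<^sup>2 + 2 * inverse s * (g (p + u s) \<bullet> v))) \<longlongrightarrow>
      - (q (p + 0) * 0\<^sup>2 + 2 * 0 * (g (p + 0) \<bullet> v))) at_top"
    by (intro tendsto_intros inv)
  then have "((\<lambda>s. - (q (p + u s) * (inverse s)\<^sup>2 + 2 * inverse s * (g (p + u s) \<bullet> v))) \<longlongrightarrow> 0) at_top"
    by simp
  moreover have "\<forall>\<^sub>F s in at_top. - (q (p + u s) * (inverse s)\<^sup>2 + 2 * inverse s * (g (p + u s) \<bullet> v)) = q2 v"
    using eventually_gt_at_top[of "0 :: real"]
  proof eventually_elim
    case (elim s)
    have "e (p + s *\<^sub>R v) = (p + u s) + s *\<^sub>R v" by (simp add: u_def)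
    then have "q (p + u s) + 2 * s * (g (p + u s) \<bullet> v) + s\<^sup>2 * q2 v = 0"
      using e(1)[of "p + s *\<^sub>R v"] q_line by metis
    moreover have "inverse s * s = 1" using elim by simp
    ultimately show ?case by algebra
  qed
  ultimately have "((\<lambda>s. q2 v) \<longlongrightarrow> 0) (at_top :: real filter)"
    by (rule Lim_transform_eventually)
  then show ?thesis by (simp add: tendsto_const_iff)
qed

text \<open>In the frame of \<open>v\<close> and its normal the equation is linear in
  \<open>s\<close>, with a factor \<open>y - y0\<close> at \<open>s\<close>. For large
  \<open>s\<close> it changes sign between \<open>y0 - e\<close> and \<open>y0 + e\<close>, so the
  line at height \<open>y0\<close> is an asymptote.\<close>

lemma null_asymptotic_direction:
  assumes d: "a12\<^sup>2 > a11 * a22" and v: "v \<noteq> 0" "q2 v = 0"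
  shows "asymptotic_direction {p. q p = 0} v"
proof -
  define n where "n = (- snd v, fst v)"
  define B where "B = bil v n"
  define y0 where "y0 = - (a1 * fst v + a2 * snd v) / B"
  define N where "N y = y\<^sup>2 * q2 n + 2 * y * (a1 * fst n + a2 * snd n) + c" for y
  have B: "B \<noteq> 0" using bil_normal_nonzero[OF d v] by (simp add: B_def n_def)
  have "n \<noteq> 0" using v(1) by (auto simp: n_def prod_eq_iff)
  have f: "q (s *\<^sub>R v + y *\<^sub>R n) = 2 * s * B * (y - y0) + N y" for s y
  proof -
    have "q p = q2 p + 2 * (a1 * fst p + a2 * snd p) + c" for p by (simp add: q_def q2_def)
    then have "q (s *\<^sub>R v + y *\<^sub>R n) =
        2 * s * y * B + y\<^sup>2 * q2 n + 2 * (s * (a1 * fst v + a2 * snd v) + y * (a1 * fst n + a2 * snd n)) + c"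
      using v(2) by (simp add: B_def q2_add q2_scale) (simp add: bil_def algebra_simps)
    moreover have "B * y0 = - (a1 * fst v + a2 * snd v)" using B by (simp add: y0_def)
    ultimately show ?thesis unfolding N_def by algebra
  qed
  have close: "\<forall>\<^sub>F s in at_top. infdist (y0 *\<^sub>R n + s *\<^sub>R v) {p. q p = 0} \<le> e * norm n" if e: "e > 0" for e
  proof -
    \<comment> \<open>From \<open>M\<close> on the term linear in \<open>s\<close> outweighs
      \<open>N\<close> at both ends of the interval; multiplying the equation by \<open>B\<close>
      fixes the signs.\<close>
    define M where "M = (\<bar>B * N (y0 + e)\<bar> + \<bar>B * N (y0 - e)\<bar>) / (2 * B\<^sup>2 * e)"
    show ?thesis using eventually_ge_at_top[of M]
    proof eventually_elim
      case (elim s)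
      have "2 * B\<^sup>2 * e > 0" using B e by simp
      then have s: "\<bar>B * N (y0 + e)\<bar> + \<bar>B * N (y0 - e)\<bar> \<le> s * (2 * B\<^sup>2 * e)"
        using elim by (simp add: M_def divide_le_eq)
      define F where "F y = B * q (s *\<^sub>R v + y *\<^sub>R n)" for y
      have "F (y0 - e) = - (s * (2 * B\<^sup>2 * e)) + B * N (y0 - e)"
        "F (y0 + e) = s * (2 * B\<^sup>2 * e) + B * N (y0 + e)"
        unfolding F_def f by (simp_all add: power2_eq_square algebra_simps)
      then have "F (y0 - e) \<le> 0" "0 \<le> F (y0 + e)" using s by linarith+
      moreover have "continuous_on {y0 - e..y0 + e} F"
        unfolding F_def q_def by (intro continuous_intros)
      ultimately obtain y where y: "y0 - e \<le> y" "y \<le> y0 + e" "F y = 0"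
        using IVT'[of F "y0 - e" 0 "y0 + e"] e by auto
      then have "infdist (y0 *\<^sub>R n + s *\<^sub>R v) {p. q p = 0} \<le> dist (y0 *\<^sub>R n + s *\<^sub>R v) (s *\<^sub>R v + y *\<^sub>R n)"
        using B by (intro infdist_le) (simp add: F_def)
      also have "\<dots> = norm ((y0 - y) *\<^sub>R n)" by (simp add: dist_norm algebra_simps)
      also have "\<dots> \<le> e * norm n" using y by (simp add: abs_le_iff mult_right_mono)
      finally show ?case .
    qed
  qed
  have "((\<lambda>s. infdist (y0 *\<^sub>R n + s *\<^sub>R v) {p. q p = 0}) \<longlongrightarrow> 0) at_top"
  proof (rule tendstoI)
    fix e :: real assume "e > 0"
    then have "e / (2 * norm n) > 0" using \<open>n \<noteq> 0\<close> by simp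
    from close[OF this] show "\<forall>\<^sub>F s in at_top. dist (infdist (y0 *\<^sub>R n + s *\<^sub>R v) {p. q p = 0}) 0 < e"
      by eventually_elim (use \<open>n \<noteq> 0\<close> \<open>e > 0\<close> in \<open>simp add: dist_real_def infdist_nonneg\<close>)
  qed
  then show ?thesis unfolding asymptotic_direction_def using v(1) by blast
qed

end

lemma reflect_reflect:
  assumes "v \<noteq> 0"
  shows "reflect p v (reflect p v z) = z"
proof -
  define m where "m = ((z - p) \<bullet> v) / (v \<bullet> v)"
  have m: "m * (v \<bullet> v) = z \<bullet> v - p \<bullet> v" using assms by (simp add: m_def inner_diff_left)
  have "reflect p v z - p = (p - z) + (2 * m) *\<^sub>R v"
    by (simp add: reflect_def m_def[symmetric] scaleR_add_right) (simp add: scaleR_2)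
  then have "(reflect p v z - p) \<bullet> v = (z - p) \<bullet> v"
    using m by (simp add: inner_diff_left inner_add_left)
  then show ?thesis unfolding reflect_def[of p v "reflect p v z"] by (simp add: reflect_def)
qed

context conic begin

text \<open>A null direction is that of the explicit line of symmetry. Conversely, the mirror image
  of a quadratic parametrization is put into the equation: the leading coefficient of the resulting
  quartic makes \<open>v\<close> parallel or perpendicular to the axis, and a perpendicular mirror
  would turn the parabola around.\<close>

lemma axis_direction_iff_null:
  assumes d: "a12\<^sup>2 = a11 * a22"
  shows "axis_direction {p. q p = 0} v \<longleftrightarrow> v \<noteq> 0 \<and> q2 v = 0"
proof -
  let ?E = "{p. q p = 0}"
  obtain n1 n2 k where n: "n1\<^sup>2 + n2\<^sup>2 = 1" "k \<noteq> 0" "a11 = k * n1\<^sup>2" "a22 = k * n2\<^sup>2" "a12 = k * n1 * n2"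
    "a1 * n2 - a2 * n1 \<noteq> 0" using parabolic_frame[OF d] .
  define l1 l2 where "l1 = a1 * n2 - a2 * n1" and "l2 = a1 * n1 + a2 * n2"
  have l10: "l1 \<noteq> 0" using n(6) by (simp add: l1_def)
  define w where "w = (n2, - n1)"
  define m where "m = (n1, n2)"
  have wm: "w \<bullet> w = 1" "m \<bullet> m = 1" "w \<bullet> m = 0" "m \<bullet> w = 0"
    using n(1) by (simp_all add: w_def m_def power2_eq_square add.commute)
  have qf: "q p = k * (m \<bullet> p)\<^sup>2 + 2 * l1 * (w \<bullet> p) + 2 * l2 * (m \<bullet> p) + c" for p
    unfolding q_parabolic_frame(1)[OF n(1,3-5)] l1_def l2_def by (simp add: w_def m_def inner_prod_def)
  have q2f: "q2 p = k * (m \<bullet> p)\<^sup>2" for p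
    unfolding q_parabolic_frame(2)[OF n(1,3-5)] by (simp add: m_def inner_prod_def)
  show ?thesis
  proof
    assume "v \<noteq> 0 \<and> q2 v = 0"
    then have v: "v \<noteq> 0" "m \<bullet> v = 0" using n(2) by (simp_all add: q2f)
    then have "cross w v = 0" by (simp add: w_def m_def inner_prod_def algebra_simps)
    moreover have "w \<noteq> 0" using wm(1) by auto
    ultimately obtain s where s: "v = s *\<^sub>R w" using cross_zero_parallel by blast
    then have s0: "s \<noteq> 0" using v(1) by auto
    \<comment> \<open>Completing the square in \<open>m \<bullet> z\<close> puts the axis at
      \<open>m \<bullet> z = - l2 / k\<close>.\<close>
    define p where "p = (- l2 / k) *\<^sub>R m"
    have rw: "w \<bullet> reflect p v z = w \<bullet> z" "m \<bullet> reflect p v z = - 2 * l2 / k - m \<bullet> z" for z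
    proof -
      have "((z - p) \<bullet> v) / (v \<bullet> v) = (w \<bullet> z) / s"
      proof -
        have "(z - p) \<bullet> w = w \<bullet> z" by (subst inner_commute) (simp add: p_def inner_diff_right inner_add_right wm)
        then show ?thesis using s0 by (simp add: s wm)
      qed
      then have r: "reflect p v z = 2 *\<^sub>R (p + (w \<bullet> z) *\<^sub>R w) - z" using s0 by (simp add: reflect_def s)
      show "w \<bullet> reflect p v z = w \<bullet> z" "m \<bullet> reflect p v z = - 2 * l2 / k - m \<bullet> z"
        unfolding r by (simp_all add: inner_diff_right inner_add_right p_def wm)
    qed
    have inv: "q (reflect p v z) = q z" for z
    proof -
      define i where "i = 1 / k"
      have "i * k = 1" using n(2) by (simp add: i_def)
      moreover have "- 2 * l2 / k = - 2 * l2 * i" by (simp add: i_def)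
      ultimately show ?thesis unfolding qf rw by algebra
    qed
    have "reflect p v ` ?E = ?E"
    proof (intro equalityI subsetI)
      fix z assume "z \<in> ?E"
      then have "reflect p v z \<in> ?E" by (simp add: inv)
      then show "z \<in> reflect p v ` ?E" using reflect_reflect[OF v(1), of p z] by (metis imageI)
    qed (auto simp: inv)
    then show "axis_direction ?E v" unfolding axis_direction_def using v(1) by blast
  next
    assume "axis_direction ?E v"
    then obtain p where v: "v \<noteq> 0" and p: "reflect p v ` ?E = ?E" unfolding axis_direction_def by blast
    define x where "x y = - (k * y\<^sup>2 + 2 * l2 * y + c) / (2 * l1)" for y
    define e where "e y = x y *\<^sub>R w + y *\<^sub>R m" for y
    have x: "2 * l1 * x y = - (k * y\<^sup>2 + 2 * l2 * y + c)" for y using l10 by (simp add: x_def)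
    have "w \<bullet> e y = x y" "m \<bullet> e y = y" for y by (simp_all add: e_def inner_add_right wm)
    then have "q (e y) = 0" for y unfolding qf using x by simp
    then have qr: "q (reflect p v (e y)) = 0" for y using p by blast
    \<comment> \<open>\<open>L\<close> and \<open>P\<close> are the linear and the constant part of
      the reflection.\<close>
    define L where "L z = (2 * ((z \<bullet> v) / (v \<bullet> v))) *\<^sub>R v - z" for z
    define P where "P = 2 *\<^sub>R p - (2 * ((p \<bullet> v) / (v \<bullet> v))) *\<^sub>R v"
    have re: "reflect p v (e y) = P + x y *\<^sub>R L w + y *\<^sub>R L m" for y
      by (simp add: reflect_def e_def L_def P_def inner_diff_left inner_add_left add_divide_distrib
          diff_divide_distrib algebra_simps scaleR_2)
    define \<alpha> \<beta> \<gamma> where "\<alpha> = m \<bullet> L w" and "\<beta> = m \<bullet> L m" and "\<gamma> = m \<bullet> P"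
    define \<alpha>' \<beta>' \<gamma>' where "\<alpha>' = w \<bullet> L w" and "\<beta>' = w \<bullet> L m" and "\<gamma>' = w \<bullet> P"
    have F: "k * (\<gamma> + x y * \<alpha> + y * \<beta>)\<^sup>2 + 2 * l1 * (\<gamma>' + x y * \<alpha>' + y * \<beta>') + 2 * l2 * (\<gamma> + x y * \<alpha> + y * \<beta>) + c = 0" for y
      using qr[of y] unfolding qf re by (simp add: inner_add_right \<alpha>_def \<beta>_def \<gamma>_def \<alpha>'_def \<beta>'_def \<gamma>'_def)
    have vv: "v \<bullet> v = (w \<bullet> v)\<^sup>2 + (m \<bullet> v)\<^sup>2"
      unfolding w_def m_def inner_prod_def inner_real_def fst_conv snd_conv using n(1) by algebra
    define A where "A = - k / (2 * l1)"
    have A: "A \<noteq> 0" using n(2) l10 by (simp add: A_def)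
    define B C where "B = - 2 * l2 / (2 * l1)" and "C = - c / (2 * l1)"
    have xABC: "x y = A * y\<^sup>2 + B * y + C" for y
      by (simp add: x_def A_def B_def C_def add_divide_distrib diff_divide_distrib)
    define f1 f0 where "f1 = B * \<alpha> + \<beta>" and "f0 = \<gamma> + C * \<alpha>"
    define r2 r1 r0 where "r2 = 2 * l1 * \<alpha>' * A + 2 * l2 * \<alpha> * A"
      and "r1 = 2 * l1 * (\<alpha>' * B + \<beta>') + 2 * l2 * (\<alpha> * B + \<beta>)"
      and "r0 = 2 * l1 * (\<gamma>' + \<alpha>' * C) + 2 * l2 * (\<gamma> + \<alpha> * C) + c"
    define a where "a = \<alpha> * A"
    define G where "G y = k * (a * y\<^sup>2 + f1 * y + f0)\<^sup>2 + r2 * y\<^sup>2 + r1 * y + r0" for y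
    have G0: "G y = 0" for y
      using F[of y] unfolding G_def a_def xABC f1_def f0_def r2_def r1_def r0_def by algebra
    \<comment> \<open>fourth difference of a quartic\<close>
    have "24 * (k * a\<^sup>2) = G 2 + G (- 2) - 4 * (G 1 + G (- 1)) + 6 * G 0"
      unfolding G_def by (simp add: power2_eq_square algebra_simps)
    then have "\<alpha> = 0" using n(2) A by (simp add: G0 a_def)
    moreover have "\<alpha> = 2 * ((w \<bullet> v) * (m \<bullet> v)) / (v \<bullet> v)"
      by (simp add: \<alpha>_def L_def inner_diff_right wm)
    ultimately have "w \<bullet> v = 0 \<or> m \<bullet> v = 0" using v by simp
    moreover have "w \<bullet> v \<noteq> 0"
    proof
      assume *: "w \<bullet> v = 0"
      have "(m \<bullet> v)\<^sup>2 = v \<bullet> v" using vv * by simp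
      have "\<beta> = 2 * (m \<bullet> v)\<^sup>2 / (v \<bullet> v) - 1"
        by (simp add: \<beta>_def L_def inner_diff_right wm power2_eq_square)
      then have "\<beta> = 1" using \<open>(m \<bullet> v)\<^sup>2 = v \<bullet> v\<close> v by simp
      have "\<alpha>' = - 1" "\<beta>' = 0"
        using * by (simp_all add: \<alpha>'_def \<beta>'_def L_def inner_diff_right wm)
      \<comment> \<open>The equation of the mirror image with \<open>x y\<close> eliminated: a
        quadratic in \<open>y\<close> with leading coefficient \<open>2 * k\<close>, which the
        second difference below extracts.\<close>
      define H where "H y = k * (\<gamma> + y)\<^sup>2 + 2 * l1 * \<gamma>' + 2 * l2 * (\<gamma> + y) + c + (k * y\<^sup>2 + 2 * l2 * y + c)" for y
      have "H y = 0" for y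
        using F[of y] x[of y] \<open>\<beta> = 1\<close> \<open>\<alpha>' = - 1\<close> \<open>\<beta>' = 0\<close> \<open>\<alpha> = 0\<close> unfolding H_def by algebra
      moreover have "4 * k = H 1 - 2 * H 0 + H (- 1)"
        by (simp add: H_def power2_eq_square algebra_simps)
      ultimately have "4 * k = 0" by simp
      then show False using n(2) by simp
    qed
    ultimately show "v \<noteq> 0 \<and> q2 v = 0" using v by (simp add: q2f)
  qed
qed

end


section \<open>Degree and inversion\<close>

lemma curve_degree_eqI:
  assumes "F \<noteq> 0" "zeros F = S" "total_degree F \<le> n"
    and "\<And>G. G \<noteq> 0 \<Longrightarrow> zeros G = S \<Longrightarrow> n \<le> total_degree G"
  shows "curve_degree S = n"
  unfolding curve_degree_def
proof (rule Least_equality)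
  have "total_degree F = n" using assms by (simp add: le_antisym)
  then show "\<exists>F. F \<noteq> 0 \<and> zeros F = S \<and> total_degree F = n" using assms by blast
qed (use assms(4) in blast)

lemma poly_eq_0_if_infinite:
  fixes P :: "real poly"
  assumes "infinite A" "\<And>x. x \<in> A \<Longrightarrow> poly P x = 0"
  shows "P = 0"
proof (rule ccontr)
  assume "P \<noteq> 0"
  then have "finite {x. poly P x = 0}" by (rule poly_roots_finite)
  moreover have "A \<subseteq> {x. poly P x = 0}" using assms(2) by blast
  ultimately show False using assms(1) finite_subset by blast
qed

lemma ev_eq_double_sum:
  assumes n: "total_degree F \<le> n"
  shows "ev F p = (\<Sum>i\<le>n. \<Sum>j\<le>n - i. coeff (coeff F j) i * fst p ^ i * snd p ^ j)"
proof -
  have "{(i, j). i + j \<le> n} = Sigma {..n} (\<lambda>i. {..n - i})" by auto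
  then show ?thesis unfolding ev_eq_sum[OF n] by (simp add: sum.Sigma)
qed

context conic begin

definition inv_poly :: "real poly poly" where
  "inv_poly = [: [:0, 0, a11, 2 * a1, c:], [:0, 2 * a12, 2 * a2:], [:a22, 2 * a1, 2 * c:], [:2 * a2:], [:c:] :]"

definition conic_poly :: "real poly poly" where
  "conic_poly = [: [:c, 2 * a1, a11:], [:2 * a2, 2 * a12:], [:a22:] :]"

lemma ev_inv_poly: "ev inv_poly p = Inv p"
  by (simp add: inv_poly_def Inv_def q2_def inner_prod_def power2_eq_square algebra_simps)

lemma ev_conic_poly: "ev conic_poly p = q p"
  by (simp add: conic_poly_def q_def power2_eq_square algebra_simps)

lemma zeros_inv_poly: "zeros inv_poly = {p. Inv p = 0}"
  by (auto simp: mem_zeros ev_inv_poly)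

lemma Inv_\<Psi>: "p \<noteq> 0 \<Longrightarrow> Inv (\<Psi> p) = 0 \<longleftrightarrow> q p = 0"
  using Inv_eq[of "\<Psi> p"] by simp

lemma inv_poly_nonzero: "inv_poly \<noteq> 0"
proof
  assume 0: "inv_poly = 0"
  have "q p = 0" if "p \<noteq> 0" for p
    using ev_inv_poly[of "\<Psi> p"] Inv_\<Psi>[OF that] by (simp add: 0)
  then have "q ((1, 0) + s *\<^sub>R (0, 1)) = 0" for s by (simp add: zero_prod_def)
  then show False using no_line_in_conic[of "(0, 1)" "(1, 0)"] by (simp add: zero_prod_def)
qed

text \<open>\<open>?K\<close> and \<open>conic_poly\<close> agree up to powers of \<open>r2\<close>,
  by comparing values off the origin. Neither is divisible by \<open>r2\<close>, the latter because
  its value at the origin is \<open>c\<close>, so the powers cancel exactly.\<close>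

lemma inversion_poly_inv_poly:
  assumes "c \<noteq> 0"
  shows "inversion_poly inv_poly = conic_poly"
proof -
  let ?K = "inversion_poly inv_poly" and ?n = "total_degree inv_poly"
  obtain m where m: "inversion_numerator inv_poly = ?K * r2 ^ m"
    using inversion_poly(1)[OF inv_poly_nonzero] by blast
  have nK: "\<not> r2 dvd ?K" by (rule inversion_poly(2)[OF inv_poly_nonzero])
  have nC: "\<not> r2 dvd conic_poly"
  proof
    assume "r2 dvd conic_poly"
    then obtain K where "conic_poly = r2 * K" ..
    then have "ev conic_poly 0 = ev (r2 * K) 0" by simp
    then show False using assms by (simp add: ev_conic_poly q_def)
  qed
  have r20: "r2 \<noteq> 0" by (simp add: r2_def)
  \<comment> \<open>The exponent \<open>m + 2\<close> accounts for the factor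
    \<open>(p \<bullet> p)^2\<close> in \<open>Inv_eq\<close>.\<close>
  have eq: "?K * r2 ^ (m + 2) = conic_poly * r2 ^ ?n"
  proof (rule ev_eqI)
    fix p :: plane assume p: "p \<noteq> 0"
    have "ev (?K * r2 ^ (m + 2)) p = ev (inversion_numerator inv_poly) p * (p \<bullet> p)\<^sup>2"
      by (simp add: m power_add power2_eq_square)
    also have "\<dots> = (p \<bullet> p) ^ ?n * Inv (\<Psi> p) * (p \<bullet> p)\<^sup>2"
      using ev_inversion_numerator[OF p] by (simp add: ev_inv_poly)
    also have "\<dots> = (p \<bullet> p) ^ ?n * q p"
    proof -
      have "\<Psi> p \<bullet> \<Psi> p = 1 / (p \<bullet> p)" using p by (simp add: \<Psi>_def)
      then show ?thesis using Inv_eq[of "\<Psi> p"] p by (simp add: power_divide)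
    qed
    also have "\<dots> = ev (conic_poly * r2 ^ ?n) p" by (simp add: ev_conic_poly mult.commute)
    finally show "ev (?K * r2 ^ (m + 2)) p = ev (conic_poly * r2 ^ ?n) p" .
  qed
  have nz: "r2 ^ j \<noteq> 0" for j using r20 by simp
  have "m + 2 = ?n"
  proof (rule linorder_cases[of "m + 2" ?n])
    assume "m + 2 < ?n"
    then obtain d where d: "?n = Suc (m + 2 + d)" using less_imp_Suc_add by blast
    have "?K * r2 ^ (m + 2) = (conic_poly * r2 ^ d * r2) * r2 ^ (m + 2)"
      unfolding eq d by (simp add: power_add mult_ac)
    then have "?K = conic_poly * r2 ^ d * r2" by (rule mult_right_cancel[OF nz, THEN iffD1])
    then show ?thesis using nK dvd_triv_right by metis
  next
    assume "?n < m + 2"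
    then obtain d where d: "m + 2 = Suc (?n + d)" using less_imp_Suc_add by blast
    have "conic_poly * r2 ^ ?n = (?K * r2 ^ d * r2) * r2 ^ ?n"
      unfolding eq[symmetric] d by (simp add: power_add mult_ac)
    then have "conic_poly = ?K * r2 ^ d * r2" by (rule mult_right_cancel[OF nz, THEN iffD1])
    then show ?thesis using nC dvd_triv_right by metis
  qed simp
  then have "?K * r2 ^ ?n = conic_poly * r2 ^ ?n" using eq by simp
  then show ?thesis by (rule mult_right_cancel[OF nz, THEN iffD1])
qed

text \<open>Only the origin needs care. If \<open>c \<noteq> 0\<close>, the equation
  \<open>inv_poly\<close> inverts to that of the conic; if \<open>c = 0\<close>, the origin lies on
  the conic anyway. Conversely, an inverted equation that is nonzero at a point of the conic is
  nonzero nearby, where the conic has further points.\<close>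

theorem inversion_Inv:
  assumes ne: "q p0 = 0"
  shows "inversion {p. Inv p = 0} = {p. q p = 0}"
proof (intro equalityI subsetI)
  fix p assume "p \<in> inversion {p. Inv p = 0}"
  then have p: "ev (inversion_poly inv_poly) p = 0"
    unfolding inversion_def using inv_poly_nonzero zeros_inv_poly by (auto simp: mem_zeros)
  show "p \<in> {p. q p = 0}"
  proof (cases "p = 0")
    case True
    then have "c = 0" using p inversion_poly_inv_poly by (cases "c = 0") (auto simp: ev_conic_poly q_def)
    have "q 0 = c" by (simp add: q_def)
    then show ?thesis unfolding mem_Collect_eq True using \<open>c = 0\<close> by (rule trans)
  next
    case False
    then show ?thesis using p ev_inversion_poly[OF inv_poly_nonzero False] Inv_\<Psi>[OF False]
      by (simp add: ev_inv_poly)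
  qed
next
  fix p assume p: "p \<in> {p. q p = 0}"
  have "ev (inversion_poly F) p = 0" if F: "F \<noteq> 0" "zeros F = {p. Inv p = 0}" for F
  proof -
    have nz: "ev (inversion_poly F) z = 0" if "z \<noteq> 0" "q z = 0" for z
      using ev_inversion_poly[OF F(1) that(1)] Inv_\<Psi>[OF that(1)] that(2) mem_zeros[of "\<Psi> z" F]
      unfolding F(2) by simp
    show ?thesis
    proof (rule ccontr)
      assume neg: "ev (inversion_poly F) p \<noteq> 0"
      then have p0: "p = 0" using nz p by blast
      have "(1, 0) \<noteq> (0 :: plane)" by (simp add: zero_prod_def)
      moreover have "p \<in> {p. ev (inversion_poly F) p \<noteq> 0}" using neg by simp
      moreover have "q p = 0" using p by simp
      ultimately obtain z where z: "ev (inversion_poly F) z \<noteq> 0" "q z = 0" "(1, 0) \<bullet> z \<noteq> (1, 0) \<bullet> p"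
        using conic_not_locally_in_line[of p "(1, 0)" "{p. ev (inversion_poly F) p \<noteq> 0}"] open_ev_nonzero
        by blast
      have "z \<noteq> 0" using z(3) p0 by auto
      then show False using nz z by blast
    qed
  qed
  then show "p \<in> inversion {p. Inv p = 0}" unfolding inversion_def by (auto simp: mem_zeros)
qed

section \<open>Lower bounds for the degree\<close>

lemma no_line_in_Inv:
  assumes v: "v \<noteq> 0" and z: "\<And>t. Inv (t *\<^sub>R v) = 0"
  shows False
proof -
  define l where "l = a1 * fst v + a2 * snd v"
  have vv: "v \<bullet> v \<noteq> 0" using v by simp
  have "c * (v \<bullet> v)\<^sup>2 * t\<^sup>2 + 2 * l * (v \<bullet> v) * t + q2 v = 0" if "t \<noteq> 0" for t
  proof -
    have "Inv (t *\<^sub>R v) = t\<^sup>2 * (c * (v \<bullet> v)\<^sup>2 * t\<^sup>2 + 2 * l * (v \<bullet> v) * t + q2 v)"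
      unfolding Inv_def q2_scale by (simp add: l_def power2_eq_square algebra_simps)
    then show ?thesis using z[of t] that by simp
  qed
  from this[of 1] this[of "-1"] this[of 2]
  have "c * (v \<bullet> v)\<^sup>2 + 2 * l * (v \<bullet> v) + q2 v = 0" "c * (v \<bullet> v)\<^sup>2 - 2 * l * (v \<bullet> v) + q2 v = 0"
    "4 * (c * (v \<bullet> v)\<^sup>2) + 4 * (l * (v \<bullet> v)) + q2 v = 0" by simp_all
  then have "c * (v \<bullet> v)\<^sup>2 = 0" "l * (v \<bullet> v) = 0" "q2 v = 0" by linarith+
  then have "c = 0" "l = 0" "q2 v = 0" using vv by simp_all
  moreover have "q (0 + s *\<^sub>R v) = s\<^sup>2 * q2 v + 2 * s * l + c" for s
    by (simp add: q_def q2_def l_def power2_eq_square algebra_simps)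
  ultimately show False using no_line_in_conic[OF v, of 0] by simp
qed

text \<open>The slope \<open>snd z / fst z\<close> is continuous. With finitely many values it would
  be constant near \<open>d\<close>, and the conic would locally lie in a line through the
  origin.\<close>

lemma infinite_slopes:
  assumes ne: "q p0 = 0"
  shows "infinite {s. \<exists>x. x \<noteq> 0 \<and> q (x, x * s) = 0}"
proof
  let ?S = "{s. \<exists>x. x \<noteq> 0 \<and> q (x, x * s) = 0}"
  assume fin: "finite ?S"
  obtain d where d: "q d = 0" "fst d \<noteq> 0"
  proof (cases "fst p0 = 0")
    case True
    obtain z where "q z = 0" "(1, 0) \<bullet> z \<noteq> (1, 0) \<bullet> p0"
      using conic_not_locally_in_line[OF ne _ open_UNIV, of "(1, 0)"] by (auto simp: zero_prod_def)
    then show ?thesis using that[of z] True by (simp add: inner_prod_def)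
  qed (use that ne in blast)
  define s0 where "s0 = snd d / fst d"
  define l where "l = (- snd d, fst d)"
  have cont: "continuous_on {z :: plane. fst z \<noteq> 0} (\<lambda>z. snd z / fst z)" by (intro continuous_intros) auto
  have op: "open {z :: plane. fst z \<noteq> 0}" by (intro open_Collect_neq continuous_intros)
  define V where "V = - (?S - {s0})"
  have "open V" unfolding V_def using fin by (intro open_Compl finite_imp_closed) simp
  then have U: "open ({z. fst z \<noteq> 0} \<inter> (\<lambda>z. snd z / fst z) -` V)"
    by (rule continuous_open_preimage[OF cont op])
  have "l \<noteq> 0" using d by (simp add: l_def zero_prod_def)
  moreover have "d \<in> {z. fst z \<noteq> 0} \<inter> (\<lambda>z. snd z / fst z) -` V" using d by (simp add: V_def s0_def)
  ultimately obtain z where z: "fst z \<noteq> 0" "snd z / fst z \<in> V" "q z = 0" "l \<bullet> z \<noteq> l \<bullet> d"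
    using conic_not_locally_in_line[OF d(1) _ U] by blast
  have "q (fst z, fst z * (snd z / fst z)) = 0" using z by simp
  then have "snd z / fst z \<in> ?S" using z(1) by blast
  then have "snd z / fst z = s0" using z(2) by (simp add: V_def)
  then have "l \<bullet> z = 0" using z(1) d(2) by (simp add: s0_def l_def inner_prod_def field_simps)
  moreover have "l \<bullet> d = 0" by (simp add: l_def inner_prod_def)
  ultimately show False using z(4) by simp
qed

lemma finite_form_roots: "finite {s. q2 (1, s) = 0}" if "a11 \<noteq> 0 \<or> a22 \<noteq> 0 \<or> a12 \<noteq> 0"
proof -
  have "{s. q2 (1, s) = 0} = {s. poly [:a11, 2 * a12, a22:] s = 0}"
    by (auto simp: q2_def power2_eq_square algebra_simps)
  then show ?thesis using that poly_roots_finite[of "[:a11, 2 * a12, a22:]"] by auto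
qed

lemma leading_form_nonzero: "a11 \<noteq> 0 \<or> a22 \<noteq> 0 \<or> a12 \<noteq> 0"
  using disc by auto

text \<open>In the variable \<open>R = r * (1 + s^2)\<close> the second factor is a quadratic whose
  coefficients are those of \<open>q\<close> on the line of slope \<open>s\<close>, in reversed
  order.\<close>

lemma Inv_slope: "Inv (r, r * s) = r\<^sup>2 * (c * (r * (1 + s\<^sup>2))\<^sup>2 + 2 * (a1 + a2 * s) * (r * (1 + s\<^sup>2)) + q2 (1, s))"
  by (simp add: Inv_def q2_def inner_prod_def power2_eq_square algebra_simps)

text \<open>The coefficients of a cubic (quadratic, if \<open>c = 0\<close>) polynomial vanishing on \<open>Inv = 0\<close> are found
  by comparing its nonzero roots on a generic line through the origin with those of \<open>Inv\<close>.
  The resulting identities between polynomials in the slope \<open>s\<close> are evaluated at \<open>s = \<i>\<close>, that is,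
  by alternating sums of coefficients.\<close>

lemma no_cubic_equation:
  assumes c: "c \<noteq> 0" and ne: "q p0 = 0" and F: "F \<noteq> 0" "zeros F = {p. Inv p = 0}"
  shows "4 \<le> total_degree F"
proof (rule ccontr)
  assume "\<not> 4 \<le> total_degree F"
  then have deg: "total_degree F \<le> 3" by simp
  define f where "f i j = coeff (coeff F j) i" for i j
  have evF: "ev F p = f 0 0 + f 1 0 * fst p + f 0 1 * snd p
      + f 2 0 * (fst p)\<^sup>2 + f 1 1 * fst p * snd p + f 0 2 * (snd p)\<^sup>2
      + f 3 0 * fst p ^ 3 + f 2 1 * (fst p)\<^sup>2 * snd p + f 1 2 * fst p * (snd p)\<^sup>2 + f 0 3 * snd p ^ 3" for p
    unfolding ev_eq_double_sum[OF deg] by (simp add: f_def eval_nat_numeral)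
  have zF: "ev F p = 0 \<longleftrightarrow> Inv p = 0" for p
    using mem_zeros[of p F] unfolding F(2) by simp
  have f00: "f 0 0 = 0" using zF[of 0] by (simp add: evF)
  \<comment> \<open>The homogeneous parts of \<open>F\<close> at \<open>(1, s)\<close>, as
    polynomials in the slope.\<close>
  define f1 f2 f3 where "f1 = [:f 1 0, f 0 1:]" and "f2 = [:f 2 0, f 1 1, f 0 2:]"
    and "f3 = [:f 3 0, f 2 1, f 1 2, f 0 3:]"
  define T where "T = [:a11, 2 * a12, a22:]"
  define l where "l = [:a1, a2:]"
  define w where "w = [:1, 0, 1 :: real:]"
  have T: "poly T s = q2 (1, s)" for s by (simp add: T_def q2_def power2_eq_square algebra_simps)
  have w: "poly w s = 1 + s\<^sup>2" for s by (simp add: w_def power2_eq_square)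
  \<comment> \<open>A quarter of the discriminant of the quadratic in \<open>R\<close>.\<close>
  define D where "D = l\<^sup>2 - smult c T"
  have "D \<noteq> 0"
  proof
    assume "D = 0"
    then have "a1\<^sup>2 = c * a11" "a1 * a2 = c * a12" "a2\<^sup>2 = c * a22"
      by (simp_all add: D_def l_def T_def power2_eq_square algebra_simps)
    then have "c\<^sup>2 * \<Delta> = 0" unfolding \<Delta>_def by algebra
    then show False using c \<Delta>_nonzero by simp
  qed
  \<comment> \<open>Lines with two distinct nonzero real roots \<open>R\<close>: a real point of the
    conic makes the discriminant a square, and the excluded slopes are those where it or the product
    of the roots vanishes.\<close>
  define A where "A = {s. \<exists>x. x \<noteq> 0 \<and> q (x, x * s) = 0} - {s. poly D s = 0} - {s. q2 (1, s) = 0}"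
  have A: "infinite A"
    unfolding A_def using infinite_slopes[OF ne] poly_roots_finite[OF \<open>D \<noteq> 0\<close>] finite_form_roots[OF leading_form_nonzero]
    by (intro Diff_infinite_finite) auto
  have key: "c * poly f1 s * (poly w s)\<^sup>2 = poly f3 s * poly T s \<and>
      c * poly f2 s * poly w s = 2 * poly l s * poly f3 s" if s: "s \<in> A" for s
  proof -
    obtain x where x: "x \<noteq> 0" "q (x, x * s) = 0" and s': "poly D s \<noteq> 0" "poly T s \<noteq> 0"
      using s unfolding A_def T by auto
    have "poly T s * x\<^sup>2 + 2 * poly l s * x + c = 0"
      using x(2) by (simp add: T q2_def l_def q_def power2_eq_square algebra_simps)
    then have "poly T s * poly T s * x\<^sup>2 + 2 * poly l s * poly T s * x + c * poly T s = 0" by algebra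
    then have "poly D s = (poly T s * x + poly l s)\<^sup>2"
      by (simp add: D_def power2_eq_square algebra_simps)
    then have "poly D s > 0" using s'(1) by simp
    define e where "e = sqrt (poly D s)"
    have e: "e\<^sup>2 = (poly l s)\<^sup>2 - c * poly T s" "e \<noteq> 0"
      using \<open>poly D s > 0\<close> by (auto simp: e_def D_def power2_eq_square)
    define i where "i = 1 / c"
    have i: "i * c = 1" using c by (simp add: i_def)
    have root: "poly f1 s * (poly w s)\<^sup>2 + poly f2 s * poly w s * R + poly f3 s * R\<^sup>2 = 0"
      if R: "c * R\<^sup>2 + 2 * poly l s * R + poly T s = 0" for R
    proof -
      have R0: "R \<noteq> 0" using R s'(2) by auto
      have w0: "poly w s \<noteq> 0" unfolding w by (simp add: add_nonneg_eq_0_iff)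
      define r where "r = R / poly w s"
      have rw: "r * poly w s = R" using w0 by (simp add: r_def)
      then have "r * (1 + s\<^sup>2) = R" by (simp add: w)
      then have "Inv (r, r * s) = 0"
        unfolding Inv_slope using R by (simp add: T l_def mult.commute)
      then have "r * (poly f1 s + poly f2 s * r + poly f3 s * r\<^sup>2) = 0"
        unfolding zF[symmetric] evF f00 f1_def f2_def f3_def
        by (simp add: power2_eq_square power3_eq_cube algebra_simps)
      moreover have "r \<noteq> 0" using R0 rw by auto
      ultimately have "poly f1 s + poly f2 s * r + poly f3 s * r\<^sup>2 = 0" by simp
      then show ?thesis unfolding rw[symmetric] by algebra
    qed
    define R1 R2 where "R1 = (- poly l s + e) * i" and "R2 = (- poly l s - e) * i"
    have R: "c * R1\<^sup>2 + 2 * poly l s * R1 + poly T s = 0" "c * R2\<^sup>2 + 2 * poly l s * R2 + poly T s = 0"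
      using e(1) i unfolding R1_def R2_def by algebra+
    have "R1 - R2 = 2 * e * i" by (simp add: R1_def R2_def algebra_simps)
    then have R12: "R1 - R2 \<noteq> 0" using e(2) i by auto
    \<comment> \<open>The quadratics in \<open>R\<close> coming from \<open>F\<close> and from
      \<open>Inv\<close> share the roots \<open>R1\<close> and \<open>R2\<close>, so Vieta's
      formulas make them proportional.\<close>
    have "(R1 - R2) * (poly f2 s * poly w s + poly f3 s * (R1 + R2)) = 0"
      using root[OF R(1)] root[OF R(2)] by algebra
    then have 2: "poly f2 s * poly w s + poly f3 s * (R1 + R2) = 0" using R12 by simp
    have "R1 + R2 = - 2 * poly l s * i" by (simp add: R1_def R2_def algebra_simps)
    moreover have "R1 * R2 = ((poly l s)\<^sup>2 - e\<^sup>2) * i\<^sup>2"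
      by (simp add: R1_def R2_def power2_eq_square algebra_simps)
    then have "R1 * R2 = poly T s * i * (i * c)"
      unfolding e(1) by (simp add: power2_eq_square algebra_simps)
    then have "R1 * R2 = poly T s * i" unfolding i by simp
    ultimately have R': "c * (R1 + R2) = - 2 * poly l s" "c * (R1 * R2) = poly T s" using i by algebra+
    have "poly f1 s * (poly w s)\<^sup>2 = poly f3 s * (R1 * R2)"
      using root[OF R(1)] 2 by algebra
    then show ?thesis using 2 R' by algebra
  qed
  have P1: "smult c (f1 * w\<^sup>2) - f3 * T = 0"
    by (rule poly_eq_0_if_infinite[OF A]) (use key in \<open>simp add: algebra_simps\<close>)
  have P2: "smult c (f2 * w) - smult 2 (l * f3) = 0"
    by (rule poly_eq_0_if_infinite[OF A]) (use key in \<open>simp add: algebra_simps\<close>)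
  have e1: "c * f 1 0 = f 3 0 * a11" "c * f 0 1 = f 3 0 * (2 * a12) + f 2 1 * a11"
      "2 * (c * f 1 0) = f 3 0 * a22 + f 2 1 * (2 * a12) + f 1 2 * a11"
      "2 * (c * f 0 1) = f 2 1 * a22 + f 1 2 * (2 * a12) + f 0 3 * a11"
      "c * f 1 0 = f 1 2 * a22 + f 0 3 * (2 * a12)" "c * f 0 1 = f 0 3 * a22"
    using P1 by (simp_all add: f1_def f3_def T_def w_def power2_eq_square algebra_simps)
  have e2: "c * f 2 0 = 2 * (a1 * f 3 0)" "c * f 1 1 = 2 * (a1 * f 2 1 + a2 * f 3 0)"
      "c * f 0 2 = 2 * (a2 * f 0 3)" "c * (f 2 0 + f 0 2) = 2 * (a1 * f 1 2 + a2 * f 2 1)"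
    using P2 by (simp_all add: f2_def f3_def l_def w_def algebra_simps)
  have not0: "\<not> (f 1 0 = 0 \<and> f 0 1 = 0 \<and> f 3 0 = 0 \<and> f 2 1 = 0 \<and> f 1 2 = 0 \<and> f 0 3 = 0)"
  proof
    assume z: "f 1 0 = 0 \<and> f 0 1 = 0 \<and> f 3 0 = 0 \<and> f 2 1 = 0 \<and> f 1 2 = 0 \<and> f 0 3 = 0"
    then have "f 2 0 = 0" "f 1 1 = 0" "f 0 2 = 0" using e2 c by simp_all
    then have "ev F p = 0" for p using z f00 by (simp add: evF)
    then show False using ev_nonzero_ex[OF F(1)] by blast
  qed
  \<comment> \<open>At \<open>s = \<i>\<close> the polynomial \<open>w\<close> vanishes, so
    \<open>f3 * T\<close> does too; the two factors are the squared moduli of \<open>f3\<close> and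
    \<open>T\<close> there.\<close>
  have "((f 3 0 - f 1 2)\<^sup>2 + (f 2 1 - f 0 3)\<^sup>2) * ((a11 - a22)\<^sup>2 + (2 * a12)\<^sup>2) = 0"
    using e1 by algebra
  then have "(f 3 0 = f 1 2 \<and> f 2 1 = f 0 3) \<or> (a11 = a22 \<and> a12 = 0)"
    unfolding mult_eq_0_iff sum_power2_eq_zero_iff by auto
  then have circle: "a11 = a22 \<and> a12 = 0"
  proof
    \<comment> \<open>Now \<open>f3\<close> is \<open>w\<close> times
      \<open>f 3 0 + f 0 3 * s\<close>; after cancelling one \<open>w\<close> the same evaluation
      applies again.\<close>
    assume z: "f 3 0 = f 1 2 \<and> f 2 1 = f 0 3"
    then have "f 1 2 = f 3 0" "f 2 1 = f 0 3" by simp_all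
    then have "f 3 0 * (a11 - a22) - f 0 3 * (2 * a12) = 0" "f 3 0 * (2 * a12) + f 0 3 * (a11 - a22) = 0"
      using e1(1,2,5,6) by (simp_all add: algebra_simps)
    then have "((f 3 0)\<^sup>2 + (f 0 3)\<^sup>2) * ((a11 - a22)\<^sup>2 + (2 * a12)\<^sup>2) = 0"
      by algebra
    then have "(f 3 0 = 0 \<and> f 0 3 = 0) \<or> (a11 = a22 \<and> a12 = 0)"
      unfolding mult_eq_0_iff sum_power2_eq_zero_iff by auto
    moreover have "\<not> (f 3 0 = 0 \<and> f 0 3 = 0)"
    proof
      assume "f 3 0 = 0 \<and> f 0 3 = 0"
      then show False using not0 z e1(1,6) c by simp
    qed
    ultimately show ?thesis by blast
  qed simp
  then have a: "a22 = a11" "a12 = 0" by simp_all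
  have a0: "a11 \<noteq> 0" using leading_form_nonzero a by auto
  have k3: "a11 * f 3 0 = c * f 1 0" "a11 * f 2 1 = c * f 0 1" "a11 * f 1 2 = c * f 1 0" "a11 * f 0 3 = c * f 0 1"
    using e1(1,2,5,6) a by algebra+
  have "c * (a11 * f 2 0) = c * (2 * a1 * f 1 0)" "c * (a11 * f 1 1) = c * (2 * (a1 * f 0 1 + a2 * f 1 0))"
      "c * (a11 * f 0 2) = c * (2 * a2 * f 0 1)"
    using e2 k3 by algebra+
  then have k2: "a11 * f 2 0 = 2 * a1 * f 1 0" "a11 * f 1 1 = 2 * (a1 * f 0 1 + a2 * f 1 0)"
      "a11 * f 0 2 = 2 * a2 * f 0 1" using c by simp_all
  \<comment> \<open>In the circle case \<open>a11 * F\<close> has a linear factor; \<open>v\<close>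
    spans its kernel, a line on which \<open>F\<close> and hence \<open>Inv\<close> would
    vanish.\<close>
  define v where "v = (- f 0 1, f 1 0)"
  have "v \<noteq> 0"
  proof
    assume "v = 0"
    then have z: "f 0 1 = 0" "f 1 0 = 0" by (simp_all add: v_def zero_prod_def)
    then show False using not0 k3 a0 by simp
  qed
  moreover have "Inv (t *\<^sub>R v) = 0" for t
  proof -
    have "a11 * ev F (t *\<^sub>R v) = (f 1 0 * fst (t *\<^sub>R v) + f 0 1 * snd (t *\<^sub>R v)) *
        (a11 + 2 * (a1 * fst (t *\<^sub>R v) + a2 * snd (t *\<^sub>R v)) + c * ((fst (t *\<^sub>R v))\<^sup>2 + (snd (t *\<^sub>R v))\<^sup>2))"
      unfolding evF f00 using k2 k3 by algebra
    also have "\<dots> = 0" by (simp add: v_def)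
    finally show ?thesis using a0 zF by simp
  qed
  ultimately show False by (rule no_line_in_Inv)
qed

text \<open>With \<open>c = 0\<close> a line of generic slope carries one nonzero root of
  \<open>Inv\<close>, which must be a root of \<open>F\<close> as well. This gives an identity in
  the slope that is again evaluated at \<open>s = \<i>\<close>.\<close>

lemma no_quadratic_equation:
  assumes c: "c = 0" and F: "F \<noteq> 0" "zeros F = {p. Inv p = 0}"
  shows "3 \<le> total_degree F"
proof (rule ccontr)
  assume "\<not> 3 \<le> total_degree F"
  then have deg: "total_degree F \<le> 2" by simp
  define f where "f i j = coeff (coeff F j) i" for i j
  have evF: "ev F p = f 0 0 + f 1 0 * fst p + f 0 1 * snd p
      + f 2 0 * (fst p)\<^sup>2 + f 1 1 * fst p * snd p + f 0 2 * (snd p)\<^sup>2" for p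
    unfolding ev_eq_double_sum[OF deg] by (simp add: f_def eval_nat_numeral)
  have zF: "ev F p = 0 \<longleftrightarrow> Inv p = 0" for p
    using mem_zeros[of p F] unfolding F(2) by simp
  have f00: "f 0 0 = 0" using zF[of 0] by (simp add: evF)
  define f1 f2 where "f1 = [:f 1 0, f 0 1:]" and "f2 = [:f 2 0, f 1 1, f 0 2:]"
  define T where "T = [:a11, 2 * a12, a22:]"
  define l where "l = [:a1, a2:]"
  define w where "w = [:1, 0, 1 :: real:]"
  have T: "poly T s = q2 (1, s)" for s by (simp add: T_def q2_def power2_eq_square algebra_simps)
  have w: "poly w s = 1 + s\<^sup>2" for s by (simp add: w_def power2_eq_square)
  have la: "a1 \<noteq> 0 \<or> a2 \<noteq> 0" using disc c by auto
  then have "l \<noteq> 0" by (auto simp: l_def)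
  define A where "A = UNIV - {s. poly l s = 0} - {s. q2 (1, s) = 0}"
  have A: "infinite A"
    unfolding A_def using poly_roots_finite[OF \<open>l \<noteq> 0\<close>] finite_form_roots[OF leading_form_nonzero]
      infinite_UNIV_char_0[where 'a = real] by (intro Diff_infinite_finite) auto
  have key: "2 * poly l s * poly w s * poly f1 s = poly f2 s * poly T s" if s: "s \<in> A" for s
  proof -
    have s': "poly l s \<noteq> 0" "poly T s \<noteq> 0" using s unfolding A_def T by auto
    have w0: "poly w s \<noteq> 0" unfolding w by (simp add: add_nonneg_eq_0_iff)
    define r where "r = - poly T s / (2 * poly l s * poly w s)"
    have r: "2 * poly l s * poly w s * r = - poly T s" using s' w0 by (simp add: r_def)
    then have "2 * (a1 + a2 * s) * (r * (1 + s\<^sup>2)) + q2 (1, s) = 0"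
      unfolding T[symmetric] w[symmetric] by (simp add: l_def algebra_simps)
    then have "Inv (r, r * s) = 0" unfolding Inv_slope by (simp add: c)
    then have "r * (poly f1 s + poly f2 s * r) = 0"
      unfolding zF[symmetric] evF f00 f1_def f2_def by (simp add: power2_eq_square algebra_simps)
    moreover have "r \<noteq> 0" using r s'(2) by auto
    ultimately have "poly f1 s + poly f2 s * r = 0" by simp
    then show ?thesis using r by algebra
  qed
  have P: "smult 2 (l * w * f1) - f2 * T = 0"
    by (rule poly_eq_0_if_infinite[OF A]) (use key in \<open>simp add: algebra_simps\<close>)
  have e: "2 * (a1 * f 1 0) = f 2 0 * a11" "2 * (a1 * f 0 1 + a2 * f 1 0) = f 2 0 * (2 * a12) + f 1 1 * a11"
      "2 * (a1 * f 1 0 + a2 * f 0 1) = f 2 0 * a22 + f 1 1 * (2 * a12) + f 0 2 * a11"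
      "2 * (a1 * f 0 1 + a2 * f 1 0) = f 1 1 * a22 + f 0 2 * (2 * a12)" "2 * (a2 * f 0 1) = f 0 2 * a22"
    using P by (simp_all add: f1_def f2_def l_def T_def w_def algebra_simps)
  have not0: "\<not> (f 1 0 = 0 \<and> f 0 1 = 0 \<and> f 2 0 = 0 \<and> f 1 1 = 0 \<and> f 0 2 = 0)"
  proof
    assume "f 1 0 = 0 \<and> f 0 1 = 0 \<and> f 2 0 = 0 \<and> f 1 1 = 0 \<and> f 0 2 = 0"
    then have "ev F p = 0" for p using f00 by (simp add: evF)
    then show False using ev_nonzero_ex[OF F(1)] by blast
  qed
  have "((f 2 0 - f 0 2)\<^sup>2 + (f 1 1)\<^sup>2) * ((a11 - a22)\<^sup>2 + (2 * a12)\<^sup>2) = 0"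
    using e by algebra
  then have "(f 2 0 = f 0 2 \<and> f 1 1 = 0) \<or> (a11 = a22 \<and> a12 = 0)"
    unfolding mult_eq_0_iff sum_power2_eq_zero_iff by auto
  then have circle: "a11 = a22 \<and> a12 = 0"
  proof
    \<comment> \<open>Now \<open>f2\<close> is \<open>f 0 2\<close> times \<open>w\<close>, so
      \<open>f 0 2 * T\<close> is divisible by \<open>l\<close>. A conic with \<open>c = 0\<close>
      whose linear part divides its quadratic part is reducible; hence
      \<open>f 0 2 = 0\<close>.\<close>
    assume z: "f 2 0 = f 0 2 \<and> f 1 1 = 0"
    have "\<Delta> = 2 * a12 * a1 * a2 - a11 * a2\<^sup>2 - a22 * a1\<^sup>2" unfolding \<Delta>_def using c by algebra
    moreover have "f 2 0 = f 0 2" "f 1 1 = 0" using z by simp_all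
    ultimately have "f 0 2 * \<Delta> = 0" using e by algebra
    then have f02: "f 0 2 = 0" using \<Delta>_nonzero by simp
    then have "a1 * f 1 0 = 0" "a2 * f 0 1 = 0" "a1 * f 0 1 + a2 * f 1 0 = 0" using e z by simp_all
    then have "(a1\<^sup>2 + a2\<^sup>2) * f 1 0 = 0" "(a1\<^sup>2 + a2\<^sup>2) * f 0 1 = 0" by algebra+
    moreover have "a1\<^sup>2 + a2\<^sup>2 \<noteq> 0" using la by (simp add: sum_power2_eq_zero_iff)
    ultimately have "f 1 0 = 0" "f 0 1 = 0" by (metis mult_eq_0_iff)+
    then show ?thesis using not0 z f02 by simp
  qed simp
  then have a: "a22 = a11" "a12 = 0" by simp_all
  have a0: "a11 \<noteq> 0" using leading_form_nonzero a by auto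
  have k: "a11 * f 2 0 = 2 * (a1 * f 1 0)" "a11 * f 1 1 = 2 * (a1 * f 0 1 + a2 * f 1 0)" "a11 * f 0 2 = 2 * (a2 * f 0 1)"
    using e a by (simp_all add: mult.commute)
  define v where "v = (- f 0 1, f 1 0)"
  have "v \<noteq> 0"
  proof
    assume "v = 0"
    then have z: "f 0 1 = 0" "f 1 0 = 0" by (simp_all add: v_def zero_prod_def)
    then show False using not0 k a0 by simp
  qed
  moreover have "Inv (t *\<^sub>R v) = 0" for t
  proof -
    have "a11 * ev F (t *\<^sub>R v) = (f 1 0 * fst (t *\<^sub>R v) + f 0 1 * snd (t *\<^sub>R v)) *
        (a11 + 2 * (a1 * fst (t *\<^sub>R v) + a2 * snd (t *\<^sub>R v)))"
      unfolding evF f00 using k by algebra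
    also have "\<dots> = 0" by (simp add: v_def)
    finally show ?thesis using a0 zF by simp
  qed
  ultimately show False by (rule no_line_in_Inv)
qed

lemma total_degree_inv_poly: "total_degree inv_poly \<le> 4" "c = 0 \<Longrightarrow> total_degree inv_poly \<le> 3"
  unfolding inv_poly_def
  by (rule total_degree_le, auto simp: coeff_pCons split: nat.splits if_splits)+

lemma degree_Inv:
  assumes ne: "q p0 = 0"
  shows "c \<noteq> 0 \<Longrightarrow> quartic_curve {p. Inv p = 0}" "c = 0 \<Longrightarrow> cubic_curve {p. Inv p = 0}"
proof -
  have alg: "algebraic_curve {p. Inv p = 0}"
    unfolding algebraic_curve_def using inv_poly_nonzero zeros_inv_poly by blast
  show "c \<noteq> 0 \<Longrightarrow> quartic_curve {p. Inv p = 0}"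
    unfolding quartic_curve_def using alg no_cubic_equation[OF _ ne]
    by (intro conjI curve_degree_eqI[OF inv_poly_nonzero zeros_inv_poly total_degree_inv_poly(1)]) auto
  show "c = 0 \<Longrightarrow> cubic_curve {p. Inv p = 0}"
    unfolding cubic_curve_def using alg no_quadratic_equation
    by (intro conjI curve_degree_eqI[OF inv_poly_nonzero zeros_inv_poly total_degree_inv_poly(2)]) auto
qed

end


section \<open>Singularities of the inverse of a conic\<close>

lemma local_parametrization_mono:
  assumes "local_parametrization Q S x U n \<gamma> \<tau> \<epsilon>"
    and "\<And>\<gamma> a b. Q \<gamma> {a<..<b} \<Longrightarrow> Q' \<gamma> {a<..<b}"
  shows "local_parametrization Q' S x U n \<gamma> \<tau> \<epsilon>"
  using assms unfolding local_parametrization_def by blast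

lemma regular_arc_imp_front: "regular_arc \<gamma> {a<..<b} \<Longrightarrow> front \<gamma> {a<..<b}"
  unfolding regular_arc_def using regular_imp_front open_greaterThanLessThan by blast

lemma regular_arc_imp_regular: "regular_arc \<gamma> I \<Longrightarrow> regular \<gamma> I"
  unfolding regular_arc_def by blast

lemma isolated_point_front:
  assumes "x isolated_in S"
  shows "\<exists>U n \<gamma> \<tau> \<epsilon>. local_parametrization front S x U n \<gamma> \<tau> \<epsilon>"
proof -
  obtain T where T: "open T" "T \<inter> S = {x}" using assms by (rule isolated_inE)
  then have "local_parametrization front S x T 1 (\<lambda>_ _. x) (\<lambda>_. 0) (\<lambda>_. 1)"
    by (intro local_parametrization_single constant_front) (auto simp: image_constant_conv)
  then show ?thesis by blast
qed

text \<open>Both branches through a point with a nonzero conormal are tangent to the same line.\<close>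

lemma regular_level_not_node:
  assumes H: "(H has_derivative (\<lambda>w. n \<bullet> w)) (at x)" "n \<noteq> 0" and S: "\<And>p. p \<in> S \<Longrightarrow> H p = (0 :: real)"
  shows "\<not> node S x"
proof
  assume "node S x"
  then obtain U \<gamma> \<tau> \<epsilon> where lp: "local_parametrization regular_arc S x U 2 \<gamma> \<tau> \<epsilon>"
    and nc: "\<not> collinear {0, velocity (\<gamma> 0) (\<tau> 0), velocity (\<gamma> 1) (\<tau> (1 :: nat))}"
    unfolding node_def by blast
  have vel: "velocity (\<gamma> i) (\<tau> i) \<bullet> n = 0" if i: "i < 2" for i
  proof -
    let ?I = "{\<tau> i - \<epsilon> i<..<\<tau> i + \<epsilon> i}"
    have e: "\<epsilon> i > 0" "regular_arc (\<gamma> i) ?I" "\<gamma> i (\<tau> i) = x" and inS: "\<gamma> i ` ?I \<subseteq> S"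
      using lp i unfolding local_parametrization_def by blast+
    have t: "\<tau> i \<in> ?I" using e(1) by simp
    have "smooth_on ?I (\<gamma> i)" using e(2) by (simp add: regular_arc_def regular_def)
    from smooth_on_has_vector_derivative[OF this t]
    have "((\<lambda>s. H (\<gamma> i s)) has_vector_derivative n \<bullet> velocity (\<gamma> i) (\<tau> i)) (at (\<tau> i))"
      using has_derivative_along_curve[of H "\<lambda>w. n \<bullet> w" "\<gamma> i" "\<tau> i"] H(1) e(3) by simp
    moreover have "((\<lambda>s. H (\<gamma> i s)) has_vector_derivative 0) (at (\<tau> i))"
      by (rule has_vector_derivative_transform_within_open[OF has_vector_derivative_const
            open_greaterThanLessThan t]) (use S[OF subsetD[OF inS imageI]] in simp)
    ultimately have "n \<bullet> velocity (\<gamma> i) (\<tau> i) = 0" by (rule vector_derivative_unique_at)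
    then show ?thesis by (simp add: inner_commute)
  qed
  from orthogonal_cross[OF vel[of 0] vel[of 1] H(2)] show False
    using nc by (simp add: collinear_iff_cross)
qed

lemma orthonormal_frame_set:
  assumes "orthonormal_frame u v"
  shows "{p + x *\<^sub>R u + y *\<^sub>R v | x y. Q x y} = {z. Q ((z - p) \<bullet> u) ((z - p) \<bullet> v)}"
proof -
  have uv: "u \<bullet> u = 1" "v \<bullet> v = 1" "u \<bullet> v = 0" "v \<bullet> u = 0"
    using assms by (simp_all add: orthonormal_frame_def norm_eq_1 inner_commute)
  have dec: "z = p + ((z - p) \<bullet> u) *\<^sub>R u + ((z - p) \<bullet> v) *\<^sub>R v" for z
  proof -
    define w where "w = z - p"
    define A B where "A = (w \<bullet> u) *\<^sub>R u" and "B = (w \<bullet> v) *\<^sub>R v"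
    define d where "d = w - A - B"
    have "u \<bullet> d = 0" "v \<bullet> d = 0"
      by (simp_all add: d_def A_def B_def inner_diff_right uv inner_commute[of w])
    then have "cross u v * fst d = 0 \<and> cross u v * snd d = 0"
      unfolding inner_prod_def inner_real_def by algebra
    moreover have "(cross u v)\<^sup>2 = (u \<bullet> u) * (v \<bullet> v) - (u \<bullet> v)\<^sup>2"
      by (simp add: inner_prod_def power2_eq_square algebra_simps)
    then have "cross u v \<noteq> 0" using uv by auto
    ultimately have "d = 0" by (simp add: prod_eq_iff)
    then have "z = p + A + B" by (simp add: d_def w_def algebra_simps)
    then show ?thesis unfolding A_def B_def w_def .
  qed
  show ?thesis
  proof (intro equalityI subsetI)
    fix z assume "z \<in> {p + x *\<^sub>R u + y *\<^sub>R v | x y. Q x y}"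
    then obtain x y where z: "z = p + x *\<^sub>R u + y *\<^sub>R v" "Q x y" by blast
    then have "(z - p) \<bullet> u = x" "(z - p) \<bullet> v = y" by (simp_all add: inner_add_left uv)
    then show "z \<in> {z. Q ((z - p) \<bullet> u) ((z - p) \<bullet> v)}" using z(2) by simp
  next
    fix z assume "z \<in> {z. Q ((z - p) \<bullet> u) ((z - p) \<bullet> v)}"
    then show "z \<in> {p + x *\<^sub>R u + y *\<^sub>R v | x y. Q x y}" using dec[of z] by blast
  qed
qed

section \<open>Type of a conic and sign of its discriminant\<close>

context conic begin

text \<open>All three normal forms are covered at once. Equal zero sets determine the coefficients
  up to a factor \<open>l\<close>; the discriminant scales by \<open>l^2\<close>, so its sign is
  intrinsic, and for the parabola the trace excludes \<open>l = 0\<close>.\<close>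

lemma frame_equation_discriminant:
  assumes ne: "q p0 = 0" and uv: "orthonormal_frame u v"
    and eq: "{p. q p = 0} = {z. A * ((z - p) \<bullet> u)\<^sup>2 + B * ((z - p) \<bullet> v)\<^sup>2 + C * ((z - p) \<bullet> u) + K = 0}"
  shows "\<exists>l. l\<^sup>2 * (a12\<^sup>2 - a11 * a22) = - (A * B) \<and> l * (a11 + a22) = A + B"
proof -
  obtain u1 u2 v1 v2 where uv': "u = (u1, u2)" "v = (v1, v2)" by (metis surj_pair)
  have n: "u1\<^sup>2 + u2\<^sup>2 = 1" "v1\<^sup>2 + v2\<^sup>2 = 1" "u1 * v1 + u2 * v2 = 0"
    using uv by (simp_all add: orthonormal_frame_def uv' norm_eq_1 power2_eq_square)
  define \<alpha> \<beta> where "\<alpha> = p \<bullet> u" and "\<beta> = p \<bullet> v"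
  have "quadratic a11 a22 a12 a1 a2 c \<subseteq> quadratic (A * u1\<^sup>2 + B * v1\<^sup>2) (A * u2\<^sup>2 + B * v2\<^sup>2) (A * u1 * u2 + B * v1 * v2)
      (C * u1 / 2 - A * \<alpha> * u1 - B * \<beta> * v1) (C * u2 / 2 - A * \<alpha> * u2 - B * \<beta> * v2)
      (A * \<alpha>\<^sup>2 + B * \<beta>\<^sup>2 - C * \<alpha> + K)"
  proof
    fix z assume "z \<in> quadratic a11 a22 a12 a1 a2 c"
    then have "z \<in> {p. q p = 0}" by (simp add: mem_quadratic)
    then have "A * (z \<bullet> u - \<alpha>)\<^sup>2 + B * (z \<bullet> v - \<beta>)\<^sup>2 + C * (z \<bullet> u - \<alpha>) + K = 0"
      unfolding eq by (simp add: inner_diff_left \<alpha>_def \<beta>_def)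
    then show "z \<in> quadratic (A * u1\<^sup>2 + B * v1\<^sup>2) (A * u2\<^sup>2 + B * v2\<^sup>2) (A * u1 * u2 + B * v1 * v2)
      (C * u1 / 2 - A * \<alpha> * u1 - B * \<beta> * v1) (C * u2 / 2 - A * \<alpha> * u2 - B * \<beta> * v2)
      (A * \<alpha>\<^sup>2 + B * \<beta>\<^sup>2 - C * \<alpha> + K)"
      by (cases z) (simp add: quadratic_def uv' power2_eq_square algebra_simps)
  qed
  from quadratic_coefficients_unique[OF ne this] obtain l where
    l: "A * u1\<^sup>2 + B * v1\<^sup>2 = l * a11" "A * u2\<^sup>2 + B * v2\<^sup>2 = l * a22" "A * u1 * u2 + B * v1 * v2 = l * a12"
    by blast
  have "l\<^sup>2 * (a12\<^sup>2 - a11 * a22) = - (A * B * (u1 * v2 - u2 * v1)\<^sup>2)"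
    using l by algebra
  also have "(u1 * v2 - u2 * v1)\<^sup>2 = 1" using n by algebra
  finally have "l\<^sup>2 * (a12\<^sup>2 - a11 * a22) = - (A * B)" by simp
  moreover have "l * (a11 + a22) = A + B" using l n by algebra
  ultimately show ?thesis by blast
qed

lemma ellipse_discriminant:
  assumes ne: "q p0 = 0" and E: "ellipse {p. q p = 0}"
  shows "a12\<^sup>2 < a11 * a22"
proof -
  obtain p u v r s where uv: "orthonormal_frame u v" "r > 0" "s > 0"
    "{p. q p = 0} = {p + x *\<^sub>R u + y *\<^sub>R v | x y. x\<^sup>2 / r\<^sup>2 + y\<^sup>2 / s\<^sup>2 = 1}"
    using E unfolding ellipse_def by blast
  have "{p. q p = 0} = {z. (1 / r\<^sup>2) * ((z - p) \<bullet> u)\<^sup>2 + (1 / s\<^sup>2) * ((z - p) \<bullet> v)\<^sup>2 + 0 * ((z - p) \<bullet> u) + (- 1) = 0}"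
    unfolding uv(4) orthonormal_frame_set[OF uv(1)] by simp
  from frame_equation_discriminant[OF ne uv(1) this] obtain l
    where "l\<^sup>2 * (a12\<^sup>2 - a11 * a22) = - (1 / r\<^sup>2 * (1 / s\<^sup>2))" by blast
  moreover have "1 / r\<^sup>2 * (1 / s\<^sup>2) > 0" using uv(2,3) by simp
  ultimately have "l\<^sup>2 * (a12\<^sup>2 - a11 * a22) < 0" by simp
  then show ?thesis by (simp add: mult_less_0_iff not_less[symmetric])
qed

lemma hyperbola_discriminant:
  assumes ne: "q p0 = 0" and E: "hyperbola {p. q p = 0}"
  shows "a12\<^sup>2 > a11 * a22"
proof -
  obtain p u v r s where uv: "orthonormal_frame u v" "r > 0" "s > 0"
    "{p. q p = 0} = {p + x *\<^sub>R u + y *\<^sub>R v | x y. x\<^sup>2 / r\<^sup>2 - y\<^sup>2 / s\<^sup>2 = 1}"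
    using E unfolding hyperbola_def by blast
  have "{p. q p = 0} = {z. (1 / r\<^sup>2) * ((z - p) \<bullet> u)\<^sup>2 + (- (1 / s\<^sup>2)) * ((z - p) \<bullet> v)\<^sup>2 + 0 * ((z - p) \<bullet> u) + (- 1) = 0}"
    unfolding uv(4) orthonormal_frame_set[OF uv(1)] by simp
  from frame_equation_discriminant[OF ne uv(1) this] obtain l
    where "l\<^sup>2 * (a12\<^sup>2 - a11 * a22) = - (1 / r\<^sup>2 * (- (1 / s\<^sup>2)))" by blast
  moreover have "1 / r\<^sup>2 * (1 / s\<^sup>2) > 0" using uv(2,3) by simp
  ultimately have "l\<^sup>2 * (a12\<^sup>2 - a11 * a22) > 0" by simp
  then show ?thesis by (simp add: zero_less_mult_iff not_less[symmetric])
qed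

lemma parabola_discriminant:
  assumes ne: "q p0 = 0" and E: "parabola {p. q p = 0}"
  shows "a12\<^sup>2 = a11 * a22"
proof -
  obtain p u v k where uv: "orthonormal_frame u v"
    "{p. q p = 0} = {p + x *\<^sub>R u + y *\<^sub>R v | x y. y\<^sup>2 = 4 * k * x}"
    using E unfolding parabola_def by blast
  have "{p. q p = 0} = {z. 0 * ((z - p) \<bullet> u)\<^sup>2 + 1 * ((z - p) \<bullet> v)\<^sup>2 + (- 4 * k) * ((z - p) \<bullet> u) + 0 = 0}"
    unfolding uv(2) orthonormal_frame_set[OF uv(1)] by simp
  from frame_equation_discriminant[OF ne uv(1) this] obtain l
    where "l\<^sup>2 * (a12\<^sup>2 - a11 * a22) = 0" "l * (a11 + a22) = 1" by auto
  then show ?thesis by auto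
qed

lemma regular_points_front:
  assumes "Inv x = 0" "x \<noteq> 0"
  shows "\<exists>U n \<gamma> \<tau> \<epsilon>. local_parametrization front {p. Inv p = 0} x U n \<gamma> \<tau> \<epsilon>"
  using Inv_regular_point(1)[OF assms] unfolding regular_point_def
  by (blast intro: local_parametrization_mono regular_arc_imp_front)

lemma front_set_Inv: "front_set {p. Inv p = 0}"
  unfolding front_set_def locally_parametrized_by_def
proof
  fix x assume x: "x \<in> {p. Inv p = 0}"
  show "\<exists>U n \<gamma> \<tau> \<epsilon>. local_parametrization front {p. Inv p = 0} x U n \<gamma> \<tau> \<epsilon>"
  proof (cases "x = 0")
    case True
    consider "a12\<^sup>2 < a11 * a22" | "a12\<^sup>2 > a11 * a22" | "a12\<^sup>2 = a11 * a22" by linarith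
    then show ?thesis
    proof cases
      case 1
      then show ?thesis using isolated_point_front[OF isolated_origin] True by simp
    next
      case 2
      then show ?thesis using node_origin True by (blast intro: local_parametrization_mono regular_arc_imp_front)
    next
      case 3
      then show ?thesis using ordinary_cusp_front[OF cusp_origin] True by simp
    qed
  qed (use regular_points_front x in simp)
qed

lemma regular_curve_Inv: "regular_curve ({p. Inv p = 0} - {0})"
  unfolding regular_curve_def using Inv_regular_point(2) by blast

lemma regular_as_parametrized_Inv:
  assumes "a12\<^sup>2 > a11 * a22"
  shows "regular_as_parametrized_curve {p. Inv p = 0}"
  unfolding regular_as_parametrized_curve_def locally_parametrized_by_def
proof
  fix x assume x: "x \<in> {p. Inv p = 0}"
  show "\<exists>U n \<gamma> \<tau> \<epsilon>. local_parametrization regular {p. Inv p = 0} x U n \<gamma> \<tau> \<epsilon>"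
  proof (cases "x = 0")
    case True
    then show ?thesis using node_origin[OF assms]
      by (blast intro: local_parametrization_mono regular_arc_imp_regular)
  next
    case False
    then have "regular_point {p. Inv p = 0} x" using Inv_regular_point(1) x by simp
    then show ?thesis unfolding regular_point_def
      by (blast intro: local_parametrization_mono regular_arc_imp_regular)
  qed
qed

text \<open>The derivative of inversion is a scaled reflection. So up to a multiple of
  \<open>q d\<close>, which is zero, the gradient at \<open>p\<close> is a nonzero multiple of
  \<open>g d\<close> reflected in the line orthogonal to \<open>d = \<Psi> p\<close>, and
  \<open>g d \<noteq> 0\<close>.\<close>

lemma Inv_gradient:
  assumes p: "Inv p = 0" "p \<noteq> 0"
  shows "\<exists>n. n \<noteq> 0 \<and> (Inv has_derivative (\<lambda>w. n \<bullet> w)) (at p)"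
proof -
  define r where "r = p \<bullet> p"
  define n where "n = (2 * r) *\<^sub>R ((2 * c * 1) *\<^sub>R p + (a1, a2)) + (4 * (a1 * fst p + a2 * snd p)) *\<^sub>R p
     + 2 *\<^sub>R (a11 * fst p + a12 * snd p, a12 * fst p + a22 * snd p)"
  have d: "(Inv has_derivative (\<lambda>w. n \<bullet> w)) (at p)"
    unfolding Inv_def[abs_def] q2_def[abs_def] inner_prod_def
    by (auto intro!: derivative_eq_intros simp: n_def r_def inner_prod_def power2_eq_square algebra_simps)
  have "n \<noteq> 0"
  proof
    assume n0: "n = 0"
    define d where "d = \<Psi> p"
    have rp: "r \<noteq> 0" using p by (simp add: r_def)
    have pd: "p = r *\<^sub>R d" using rp by (simp add: d_def \<Psi>_def r_def)
    have qd: "q d = 0" using Inv_eq[OF p(2)] p by (simp add: d_def)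
    have dd: "r * (d \<bullet> d) = 1" using rp by (simp add: d_def \<Psi>_def r_def)
    have "n = (2 * r) *\<^sub>R (g d - (2 * (g d \<bullet> d) * r) *\<^sub>R d + (2 * r * q d) *\<^sub>R d)"
    proof -
      obtain x y where xy: "d = (x, y)" by (cases d)
      show ?thesis
        unfolding n_def pd xy q_def g_def by (simp add: power2_eq_square algebra_simps)
    qed
    then have gd: "g d = (2 * (g d \<bullet> d) * r) *\<^sub>R d" using n0 rp qd by simp
    then have "g d \<bullet> d = 2 * (g d \<bullet> d) * (r * (d \<bullet> d))" by (metis inner_scaleR_left mult.assoc)
    then have "g d \<bullet> d = 0" using dd by simp
    then have "g d = 0" using gd by simp
    then show False using g_nonzero[OF qd] by simp
  qed
  with d show ?thesis by blast
qed

lemma node_Inv_iff: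
  assumes "a12\<^sup>2 > a11 * a22"
  shows "node {p. Inv p = 0} x \<longleftrightarrow> x = 0"
proof
  assume "x = 0"
  moreover obtain U \<gamma> \<epsilon> where "local_parametrization regular_arc {p. Inv p = 0} 0 U 2 \<gamma> (\<lambda>_. 0) (\<lambda>_. \<epsilon>)"
    "cross (velocity (\<gamma> 0) 0) (velocity (\<gamma> 1) 0) \<noteq> 0"
    using node_origin[OF assms] by blast
  then have "\<exists>U \<gamma> \<tau> \<epsilon>. local_parametrization regular_arc {p. Inv p = 0} 0 U 2 \<gamma> \<tau> \<epsilon> \<and>
      \<not> collinear {0, velocity (\<gamma> 0) (\<tau> 0), velocity (\<gamma> 1) (\<tau> (1 :: nat))}"
    unfolding collinear_iff_cross
    by (intro exI[of _ U] exI[of _ \<gamma>] exI[of _ "\<lambda>_. 0"] exI[of _ "\<lambda>_. \<epsilon>"]) simp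
  ultimately show "node {p. Inv p = 0} x" unfolding node_def by simp
next
  assume node: "node {p. Inv p = 0} x"
  show "x = 0"
  proof (rule ccontr)
    assume "x \<noteq> 0"
    moreover have "Inv x = 0" using node by (simp add: node_def)
    ultimately obtain n where "n \<noteq> 0" "(Inv has_derivative (\<lambda>w. n \<bullet> w)) (at x)" using Inv_gradient by blast
    then show False using regular_level_not_node[of Inv n x "{p. Inv p = 0}"] node by simp
  qed
qed

end

lemma disc_det:
  "det (vector [vector [a11, a12, a1], vector [a12, a22, a2], vector [a1, a2, c]] :: real^3^3) =
    a11 * a22 * c + 2 * a12 * a1 * a2 - a11 * a2\<^sup>2 - a22 * a1\<^sup>2 - c * a12\<^sup>2"
  by (simp add: det_3 power2_eq_square algebra_simps)

theorem theorem3p7: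
  fixes \<C> C :: "plane set"
  assumes alg: "algebraic_curve \<C>"
    and origin: "(0, 0) \<in> \<C>"
    and no_line: "\<And>v. v \<noteq> 0 \<Longrightarrow> \<not> span {v} \<subseteq> \<C>"
    and no_circle: "\<And>p. p \<noteq> 0 \<Longrightarrow> \<not> sphere p (norm p) \<subseteq> \<C>"
    and prim: "C = primitive_curve \<C>"
    and quad: "irreducible_quadratic C"
  shows
    "((quartic_curve \<C> \<or> cubic_curve \<C>) \<and> front_set \<C> \<and>
      irreducible_quadratic (inversion \<C>) \<and>
      (\<forall>a11 a22 a12 a1 a2 c. C = quadratic a11 a22 a12 a1 a2 c \<longrightarrow>
         \<C> = {(x, y). (a12\<^sup>2 - a11 * a22) * (x\<^sup>2 + y\<^sup>2)\<^sup>2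
                + 2 * (a12 * a2 - a1 * a22) * (x\<^sup>2 + y\<^sup>2) * x
                + 2 * (a1 * a12 - a2 * a11) * (x\<^sup>2 + y\<^sup>2) * y
                + (a2\<^sup>2 - a22 * c) * x\<^sup>2
                + 2 * (a12 * c - a1 * a2) * x * y
                + (a1\<^sup>2 - a11 * c) * y\<^sup>2 = 0}) \<and>
      (parabola C \<longrightarrow> cubic_curve \<C>))
     \<and>
     (ellipse (inversion \<C>) \<longrightarrow>
        (0, 0) isolated_in \<C> \<and> regular_curve (\<C> - {(0, 0)}))
     \<and>
     (hyperbola (inversion \<C>) \<longrightarrow>
        regular_as_parametrized_curve \<C> \<and>
        (\<forall>x. node \<C> x \<longleftrightarrow> x = (0, 0)) \<and>
        (\<forall>v. tangent_direction \<C> (0, 0) v \<longleftrightarrow> asymptotic_direction (inversion \<C>) v))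
     \<and>
     (parabola (inversion \<C>) \<longrightarrow>
        ordinary_cusp \<C> (0, 0) \<and> regular_curve (\<C> - {(0, 0)}) \<and>
        (\<forall>v. tangent_direction \<C> (0, 0) v \<longleftrightarrow> axis_direction (inversion \<C>) v))"
proof -
  obtain F where F: "F \<noteq> 0" "zeros F = \<C>" using alg unfolding algebraic_curve_def by blast
  obtain \<alpha>11 \<alpha>22 \<alpha>12 \<alpha>1 \<alpha>2 \<alpha> where C: "C \<noteq> {}" "C = quadratic \<alpha>11 \<alpha>22 \<alpha>12 \<alpha>1 \<alpha>2 \<alpha>"
    and det: "\<alpha>11 * \<alpha>22 * \<alpha> + 2 * \<alpha>12 * \<alpha>1 * \<alpha>2 - \<alpha>11 * \<alpha>2\<^sup>2 - \<alpha>22 * \<alpha>1\<^sup>2 - \<alpha> * \<alpha>12\<^sup>2 \<noteq> 0"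
    using quad unfolding irreducible_quadratic_def disc_det by blast
  interpret K: conic_primitive \<alpha>11 \<alpha>22 \<alpha>12 \<alpha>1 \<alpha>2 \<alpha> F
    by unfold_locales (use det F C origin no_line no_circle prim in auto)
  interpret E: conic K.b11 K.b22 K.b12 K.b1 K.b2 K.b by (rule K.dual_conic)
  have \<C>: "\<C> = {p. E.Inv p = 0}" using K.zeros_eq_dual_inverse F by simp
  obtain d where d: "E.q d = 0" using K.dual_conic_nonempty by blast
  have inv: "inversion \<C> = {p. E.q p = 0}" unfolding \<C> by (rule E.inversion_Inv[OF d])
  have o: "(0, 0) = (0 :: plane)" by (simp add: zero_prod_def)
  obtain z where z: "K.q z = 0" using C K.mem_quadratic by blast
  have Ceq: "C = {p. K.q p = 0}" using C(2) K.mem_quadratic by auto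
  have "quartic_curve \<C> \<or> cubic_curve \<C>" unfolding \<C> using E.degree_Inv[OF d] by blast
  moreover have "front_set \<C>" unfolding \<C> by (rule E.front_set_Inv)
  moreover have "irreducible_quadratic (inversion \<C>)"
  proof -
    have "inversion \<C> = quadratic K.b11 K.b22 K.b12 K.b1 K.b2 K.b" unfolding inv using E.mem_quadratic by auto
    moreover have "inversion \<C> \<noteq> {}" unfolding inv using d by blast
    ultimately show ?thesis unfolding irreducible_quadratic_def disc_det using E.disc by blast
  qed
  moreover have "\<C> = {(x, y). (a12\<^sup>2 - a11 * a22) * (x\<^sup>2 + y\<^sup>2)\<^sup>2
                + 2 * (a12 * a2 - a1 * a22) * (x\<^sup>2 + y\<^sup>2) * x
                + 2 * (a1 * a12 - a2 * a11) * (x\<^sup>2 + y\<^sup>2) * y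
                + (a2\<^sup>2 - a22 * c) * x\<^sup>2
                + 2 * (a12 * c - a1 * a2) * x * y
                + (a1\<^sup>2 - a11 * c) * y\<^sup>2 = 0}"
    if eq: "C = quadratic a11 a22 a12 a1 a2 c" for a11 a22 a12 a1 a2 c
  proof -
    have "quadratic \<alpha>11 \<alpha>22 \<alpha>12 \<alpha>1 \<alpha>2 \<alpha> \<subseteq> quadratic a11 a22 a12 a1 a2 c" using C(2) eq by simp
    \<comment> \<open>Any equation of \<open>C\<close> is a multiple of the chosen one; the
      coefficients of the claimed equation are quadratic in it and scale by
      \<open>l^2\<close>.\<close>
    from K.quadratic_coefficients_unique[OF z this] obtain l where
      l: "a11 = l * \<alpha>11" "a22 = l * \<alpha>22" "a12 = l * \<alpha>12" "a1 = l * \<alpha>1" "a2 = l * \<alpha>2" "c = l * \<alpha>" by blast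
    have "l \<noteq> 0"
    proof
      assume "l = 0"
      then have "C = UNIV" using eq l by (auto simp: quadratic_def)
      then have "K.q (0 + s *\<^sub>R (1, 0)) = 0" for s using Ceq by blast
      then show False using K.no_line_in_conic[of "(1, 0)" 0] by (simp add: zero_prod_def)
    qed
    have "(a12\<^sup>2 - a11 * a22) * (x\<^sup>2 + y\<^sup>2)\<^sup>2 + 2 * (a12 * a2 - a1 * a22) * (x\<^sup>2 + y\<^sup>2) * x
        + 2 * (a1 * a12 - a2 * a11) * (x\<^sup>2 + y\<^sup>2) * y + (a2\<^sup>2 - a22 * c) * x\<^sup>2
        + 2 * (a12 * c - a1 * a2) * x * y + (a1\<^sup>2 - a11 * c) * y\<^sup>2 = l\<^sup>2 * E.Inv (x, y)" for x y
    proof -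
      have "E.Inv (x, y) = K.b * (x\<^sup>2 + y\<^sup>2)\<^sup>2 + 2 * (K.b1 * x + K.b2 * y) * (x\<^sup>2 + y\<^sup>2)
          + (K.b11 * x\<^sup>2 + K.b22 * y\<^sup>2 + 2 * K.b12 * x * y)"
        by (simp add: E.Inv_def E.q2_def power2_eq_square)
      then show ?thesis unfolding l K.b_defs by algebra
    qed
    then show ?thesis using \<open>l \<noteq> 0\<close> unfolding \<C> by auto
  qed
  moreover have "parabola C \<longrightarrow> cubic_curve \<C>"
  proof
    assume "parabola C"
    then have "\<alpha>12\<^sup>2 = \<alpha>11 * \<alpha>22" unfolding Ceq by (rule K.parabola_discriminant[OF z])
    \<comment> \<open>\<open>K.b\<close> is both the constant term of the dual conic and the
      coefficient of the quartic term of its inverse.\<close>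
    then have "K.b = 0" by (simp add: K.b_def)
    then show "cubic_curve \<C>" unfolding \<C> by (rule E.degree_Inv(2)[OF d])
  qed
  moreover have "ellipse (inversion \<C>) \<longrightarrow> (0, 0) isolated_in \<C> \<and> regular_curve (\<C> - {(0, 0)})"
    unfolding inv unfolding \<C> o using E.isolated_origin E.ellipse_discriminant[OF d] E.regular_curve_Inv by blast
  moreover have "hyperbola (inversion \<C>) \<longrightarrow> regular_as_parametrized_curve \<C> \<and>
      (\<forall>x. node \<C> x \<longleftrightarrow> x = (0, 0)) \<and>
      (\<forall>v. tangent_direction \<C> (0, 0) v \<longleftrightarrow> asymptotic_direction (inversion \<C>) v)"
  proof (intro impI conjI allI)
    assume "hyperbola (inversion \<C>)"
    then have h: "K.b12\<^sup>2 > K.b11 * K.b22" unfolding inv by (rule E.hyperbola_discriminant[OF d])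
    show "regular_as_parametrized_curve \<C>" unfolding \<C> by (rule E.regular_as_parametrized_Inv[OF h])
    show "node \<C> x \<longleftrightarrow> x = (0, 0)" for x unfolding \<C> o by (rule E.node_Inv_iff[OF h])
    show "tangent_direction \<C> (0, 0) v \<longleftrightarrow> asymptotic_direction (inversion \<C>) v" for v
    proof
      assume t: "tangent_direction \<C> (0, 0) v"
      then have "v \<noteq> 0" by (simp add: tangent_direction_def)
      moreover have "E.q2 v = 0" using t unfolding \<C> o by (rule E.tangent_direction_null)
      ultimately show "asymptotic_direction (inversion \<C>) v" unfolding inv by (rule E.null_asymptotic_direction[OF h])
    next
      assume t: "asymptotic_direction (inversion \<C>) v"
      then have "v \<noteq> 0" by (simp add: asymptotic_direction_def)
      moreover have "E.q2 v = 0" using t unfolding inv by (rule E.asymptotic_direction_null[OF d])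
      ultimately show "tangent_direction \<C> (0, 0) v" unfolding \<C> o by (rule E.null_tangent_hyperbolic[OF h])
    qed
  qed
  moreover have "parabola (inversion \<C>) \<longrightarrow> ordinary_cusp \<C> (0, 0) \<and> regular_curve (\<C> - {(0, 0)}) \<and>
      (\<forall>v. tangent_direction \<C> (0, 0) v \<longleftrightarrow> axis_direction (inversion \<C>) v)"
  proof (intro impI conjI allI)
    assume "parabola (inversion \<C>)"
    then have h: "K.b12\<^sup>2 = K.b11 * K.b22" unfolding inv by (rule E.parabola_discriminant[OF d])
    show "ordinary_cusp \<C> (0, 0)" unfolding \<C> o by (rule E.cusp_origin[OF h])
    show "regular_curve (\<C> - {(0, 0)})" unfolding \<C> o by (rule E.regular_curve_Inv)
    show "tangent_direction \<C> (0, 0) v \<longleftrightarrow> axis_direction (inversion \<C>) v" for v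
    proof -
      have "v \<noteq> 0" if "tangent_direction \<C> (0, 0) v" using that by (simp add: tangent_direction_def)
      then show ?thesis
        unfolding inv unfolding E.axis_direction_iff_null[OF h] \<C> o
        using E.tangent_direction_null E.null_tangent_parabolic[OF h] by blast
    qed
  qed
  ultimately show ?thesis by blast
qed

end
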